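(* Let $R$ be a one-dimensional Noetherian domain, $I$ an ideal of $R$, $M$ a finitely generated $R$-module, and let $F$ be a functor arising from a middle finite complex $A\xrightarrow{\alpha}B\xrightarrow{\beta}C$. Then the sequence of sets $\{\operatorname{Ass}_R F(M/I^nM)\}_{n\ge1}$ is eventually constant.
   Context: For a complex $\mathcal{E}\colon A\to B\to C$ of $R$-modules, the functor arising from $\mathcal{E}$ is the $R$-linear functor $F$ on all $R$-modules given by $F(X)=H(\mathcal{E}\otimes_R X)$, the homology at the middle term of $A\otimes X\to B\otimes X\to C\otimes X$. The complex is middle finite if $B$ is finitely generated ($A$ and $C$ arbitrary). *)

theory Defs
  imports "HOL-Algebra.Algebra" "HOL-Library.Extended_Nat"
begin

text \<open>R-linear maps between R-modules (only their values on the carrier matter).\<close>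
definition mod_hom :: "('r,'c) ring_scheme \<Rightarrow> ('r,'a,'d) module_scheme \<Rightarrow> ('r,'b,'e) module_scheme \<Rightarrow> ('a \<Rightarrow> 'b) set"
  where "mod_hom R M N = {f. f \<in> carrier M \<rightarrow> carrier N
     \<and> (\<forall>x\<in>carrier M. \<forall>y\<in>carrier M. f (x \<oplus>\<^bsub>M\<^esub> y) = f x \<oplus>\<^bsub>N\<^esub> f y)
     \<and> (\<forall>r\<in>carrier R. \<forall>x\<in>carrier M. f (r \<odot>\<^bsub>M\<^esub> x) = r \<odot>\<^bsub>N\<^esub> f x)}"

definition gen_submodule :: "('r,'c) ring_scheme \<Rightarrow> ('r,'a,'d) module_scheme \<Rightarrow> 'a set \<Rightarrow> 'a set"
  where "gen_submodule R M S = \<Inter>{N. submodule N R M \<and> S \<subseteq> N}"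

definition fin_gen_module :: "('r,'c) ring_scheme \<Rightarrow> ('r,'a,'d) module_scheme \<Rightarrow> bool"
  where "fin_gen_module R M \<longleftrightarrow> (\<exists>S. finite S \<and> S \<subseteq> carrier M \<and> gen_submodule R M S = carrier M)"

text \<open>Quotient module M/N, with carrier the cosets of N.
  (The multiplicative fields are irrelevant for a module and are filled with dummies.)\<close>
definition quot_module :: "('r,'c) ring_scheme \<Rightarrow> ('r,'a,'d) module_scheme \<Rightarrow> 'a set \<Rightarrow> ('r,'a set) module"
  where "quot_module R M N = \<lparr>carrier = a_rcosets\<^bsub>M\<^esub> N, monoid.mult = (\<lambda>_ _. N), monoid.one = N, ring.zero = N,
     ring.add = set_add M, module.smult = (\<lambda>r C. \<Union>m\<in>C. N +>\<^bsub>M\<^esub> (r \<odot>\<^bsub>M\<^esub> m))\<rparr>"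

primrec ideal_pow :: "('r,'c) ring_scheme \<Rightarrow> 'r set \<Rightarrow> nat \<Rightarrow> 'r set" where
  "ideal_pow R I 0 = carrier R"
| "ideal_pow R I (Suc n) = ideal_prod R I (ideal_pow R I n)"

definition ideal_smult :: "('r,'c) ring_scheme \<Rightarrow> 'r set \<Rightarrow> ('r,'a,'d) module_scheme \<Rightarrow> 'a set"
  where "ideal_smult R J M = gen_submodule R M {r \<odot>\<^bsub>M\<^esub> m | r m. r \<in> J \<and> m \<in> carrier M}"

definition ann_elem :: "('r,'c) ring_scheme \<Rightarrow> ('r,'a,'d) module_scheme \<Rightarrow> 'a \<Rightarrow> 'r set"
  where "ann_elem R M m = {r \<in> carrier R. r \<odot>\<^bsub>M\<^esub> m = \<zero>\<^bsub>M\<^esub>}"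

definition Ass :: "('r,'c) ring_scheme \<Rightarrow> ('r,'a,'d) module_scheme \<Rightarrow> 'r set set"
  where "Ass R M = {P. primeideal P R \<and> (\<exists>m\<in>carrier M. P = ann_elem R M m)}"

definition prime_chain :: "('r,'c) ring_scheme \<Rightarrow> nat \<Rightarrow> bool"
  where "prime_chain R n \<longleftrightarrow> (\<exists>P :: nat \<Rightarrow> 'r set. (\<forall>i\<le>n. primeideal (P i) R) \<and> (\<forall>i<n. P i \<subset> P (Suc i)))"

definition krull_dim :: "('r,'c) ring_scheme \<Rightarrow> enat"
  where "krull_dim R = Sup {enat n | n. prime_chain R n}"

definition free_module :: "('r,'c) ring_scheme \<Rightarrow> 'p set \<Rightarrow> ('r, 'p \<Rightarrow> 'r) module"
  where "free_module R S = \<lparr>carrier = {f. (\<forall>p. f p \<in> carrier R) \<and> (\<forall>p. p \<notin> S \<longrightarrow> f p = \<zero>\<^bsub>R\<^esub>)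
                                        \<and> finite {p. f p \<noteq> \<zero>\<^bsub>R\<^esub>}},
     monoid.mult = (\<lambda>_ _ _. \<zero>\<^bsub>R\<^esub>), monoid.one = (\<lambda>_. \<zero>\<^bsub>R\<^esub>), ring.zero = (\<lambda>_. \<zero>\<^bsub>R\<^esub>),
     ring.add = (\<lambda>f g p. f p \<oplus>\<^bsub>R\<^esub> g p), module.smult = (\<lambda>r f p. r \<otimes>\<^bsub>R\<^esub> f p)\<rparr>"

definition basis_vec :: "('r,'c) ring_scheme \<Rightarrow> 'p \<Rightarrow> 'p \<Rightarrow> 'r"
  where "basis_vec R q = (\<lambda>p. if p = q then \<one>\<^bsub>R\<^esub> else \<zero>\<^bsub>R\<^esub>)"

definition tensor_rels :: "('r,'c) ring_scheme \<Rightarrow> ('r,'a,'d) module_scheme \<Rightarrow> ('r,'x,'e) module_scheme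
    \<Rightarrow> ('a \<times> 'x \<Rightarrow> 'r) set"
  where "tensor_rels R A Y =
     {(\<lambda>p. a_minus R (a_minus R (basis_vec R (a \<oplus>\<^bsub>A\<^esub> a', x) p) (basis_vec R (a, x) p)) (basis_vec R (a', x) p))
        | a a' x. a \<in> carrier A \<and> a' \<in> carrier A \<and> x \<in> carrier Y}
   \<union> {(\<lambda>p. a_minus R (a_minus R (basis_vec R (a, x \<oplus>\<^bsub>Y\<^esub> x') p) (basis_vec R (a, x) p)) (basis_vec R (a, x') p))
        | a x x'. a \<in> carrier A \<and> x \<in> carrier Y \<and> x' \<in> carrier Y}
   \<union> {(\<lambda>p. a_minus R (basis_vec R (r \<odot>\<^bsub>A\<^esub> a, x) p) (r \<otimes>\<^bsub>R\<^esub> basis_vec R (a, x) p))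
        | r a x. r \<in> carrier R \<and> a \<in> carrier A \<and> x \<in> carrier Y}
   \<union> {(\<lambda>p. a_minus R (basis_vec R (a, r \<odot>\<^bsub>Y\<^esub> x) p) (r \<otimes>\<^bsub>R\<^esub> basis_vec R (a, x) p))
        | r a x. r \<in> carrier R \<and> a \<in> carrier A \<and> x \<in> carrier Y}"

definition tensor_rel_sub :: "('r,'c) ring_scheme \<Rightarrow> ('r,'a,'d) module_scheme \<Rightarrow> ('r,'x,'e) module_scheme
    \<Rightarrow> ('a \<times> 'x \<Rightarrow> 'r) set"
  where "tensor_rel_sub R A Y = gen_submodule R (free_module R (carrier A \<times> carrier Y)) (tensor_rels R A Y)"

definition tensor :: "('r,'c) ring_scheme \<Rightarrow> ('r,'a,'d) module_scheme \<Rightarrow> ('r,'x,'e) module_scheme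
    \<Rightarrow> ('r, ('a \<times> 'x \<Rightarrow> 'r) set) module"
  where "tensor R A Y = quot_module R (free_module R (carrier A \<times> carrier Y)) (tensor_rel_sub R A Y)"

definition push_fwd :: "('r,'c) ring_scheme \<Rightarrow> ('a \<Rightarrow> 'b) \<Rightarrow> ('a \<times> 'x \<Rightarrow> 'r) \<Rightarrow> ('b \<times> 'x \<Rightarrow> 'r)"
  where "push_fwd R f g = (\<lambda>(b, x). finsum R (\<lambda>a. g (a, x)) {a. g (a, x) \<noteq> \<zero>\<^bsub>R\<^esub> \<and> f a = b})"

definition tensor_map :: "('r,'c) ring_scheme \<Rightarrow> ('r,'b,'d) module_scheme \<Rightarrow> ('r,'x,'e) module_scheme
    \<Rightarrow> ('a \<Rightarrow> 'b) \<Rightarrow> ('a \<times> 'x \<Rightarrow> 'r) set \<Rightarrow> ('b \<times> 'x \<Rightarrow> 'r) set"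
  where "tensor_map R B Y f C =
     (\<Union>g\<in>C. tensor_rel_sub R B Y +>\<^bsub>free_module R (carrier B \<times> carrier Y)\<^esub> push_fwd R f g)"

definition complex_functor :: "('r,'c) ring_scheme \<Rightarrow> ('r,'a,'d1) module_scheme \<Rightarrow> ('r,'b,'d2) module_scheme
    \<Rightarrow> ('r,'g,'d3) module_scheme \<Rightarrow> ('a \<Rightarrow> 'b) \<Rightarrow> ('b \<Rightarrow> 'g) \<Rightarrow> ('r,'x,'e) module_scheme
    \<Rightarrow> ('r, ('b \<times> 'x \<Rightarrow> 'r) set set) module"
  where "complex_functor R A B C \<alpha> \<beta> Y =
     (let TB = tensor R B Y;
          K = {t \<in> carrier TB. tensor_map R C Y \<beta> t = \<zero>\<^bsub>tensor R C Y\<^esub>};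
          Im = tensor_map R B Y \<alpha> ` carrier (tensor R A Y)
      in quot_module R (TB\<lparr>carrier := K\<rparr>) Im)"

end

theory Submission
  imports Defs
begin

text \<open>
  Put \<open>U = B \<otimes> M\<close>, \<open>V = im (A \<otimes> M \<rightarrow> U)\<close> and \<open>W = C \<otimes> M\<close>.  Since tensoring is right exact,
  \<open>F(M/I\<^sup>nM) = K\<^sub>n/(V + I\<^sup>nU)\<close>, where \<open>K\<^sub>n\<close> is the preimage of \<open>I\<^sup>nW\<close> in \<open>U\<close>.  As \<open>C\<close> is arbitrary,
  Artin--Rees is not available for \<open>W\<close>; the argument only uses that \<open>U\<close> is finitely generated and
  that \<open>I K\<^sub>n \<subseteq> K\<^sub>n\<^sub>+\<^sub>1 \<subseteq> K\<^sub>n\<close> and \<open>V + I\<^sup>nU \<subseteq> K\<^sub>n\<close>.  For \<open>I \<noteq> 0\<close> only the finitely many primes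
  \<open>P \<supseteq> I\<close>, all of them maximal, can be associated, and \<open>P\<close> is associated iff \<open>K\<^sub>n \<noteq> V + I\<^sup>nU\<close> locally
  at \<open>P\<close>.  If equality holds at \<open>P\<close> for infinitely many \<open>n\<close>, then it holds for all large \<open>n\<close>: this
  follows from \<open>(I\<^sup>n\<^sup>+\<^sup>1U : I) = I\<^sup>nU\<close> modulo torsion for large \<open>n\<close> (Ratliff) and from Artin--Rees for
  the torsion of \<open>U/V\<close>, both of which are instances of the Noetherian property of Rees modules.
\<close>

section \<open>Submodules and powers\<close>

text \<open>For a fixed prime \<open>P\<close> there is a dichotomy: if equality at \<open>P\<close>
  fails for all large \<open>n\<close>, nothing has to be shown; otherwise it holds at infinitely
  many indices, which may be far apart. Two such good indices are combined. A late one,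
  \<open>k \<ge> n\<close>, is reached from \<open>K\<^sub>n\<close> by multiplying with
  \<open>I\<^sup>k\<^sup>-\<^sup>n\<close>, and the multiplication is undone by a colon. An early
  one, fixed once and for all, disposes of the remaining error because the \<open>K\<^sub>n\<close>
  decrease. The colon can be undone only where some element of \<open>I\<close> is a nonzerodivisor,
  so this part takes place modulo torsion, and the error is a torsion element. The torsion of
  \<open>U/V\<close> is killed by a single nonzero \<open>d\<close>, and in dimension one some power
  of \<open>I\<close> lies in \<open>(d)\<close> locally at \<open>P\<close>; hence torsion elements
  deep in the adic filtration vanish locally. No localization is formed: "locally at
  \<open>P\<close>" means after multiplication by some \<open>s\<close> outside \<open>P\<close>.
  The ideal \<open>I\<close> acts through a finite generating set \<open>S\<close>, so that finitely
  many such denominators can be multiplied into a common one and the Rees argument can proceed one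
  generator at a time.\<close>

definition set_smult :: "('r,'c) ring_scheme \<Rightarrow> ('r,'a,'d) module_scheme \<Rightarrow> 'r set \<Rightarrow> 'a set \<Rightarrow> 'a set"
  where "set_smult R M S N = gen_submodule R M {r \<odot>\<^bsub>M\<^esub> x | r x. r \<in> S \<and> x \<in> N}"

abbreviation set_pow_smult :: "('r,'c) ring_scheme \<Rightarrow> ('r,'a,'d) module_scheme \<Rightarrow> 'r set \<Rightarrow> nat \<Rightarrow> 'a set \<Rightarrow> 'a set"
  where "set_pow_smult R M S n N \<equiv> (set_smult R M S ^^ n) N"

text \<open>The chain condition is the form in which the Rees argument uses finiteness, namely for
  chains of leading coefficients; \<open>fin_gen_imp_noetherian\<close> supplies it.\<close>

definition noetherian_module :: "('r,'c) ring_scheme \<Rightarrow> ('r,'a,'d) module_scheme \<Rightarrow> bool"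
  where "noetherian_module R M \<longleftrightarrow> (\<forall>N :: nat \<Rightarrow> 'a set. (\<forall>i. submodule (N i) R M) \<longrightarrow>
     (\<forall>i. N i \<subseteq> N (Suc i)) \<longrightarrow> (\<exists>k. \<forall>i\<ge>k. N i = N k))"

context module
begin

abbreviation smult_M (infixl \<open>\<bullet>\<close> 70) where "smult_M \<equiv> smult M"

abbreviation add_M (infixl \<open>\<boxplus>\<close> 65) where "add_M \<equiv> add M"

abbreviation set_add_M (infixl \<open>\<uplus>\<close> 60) where "set_add_M \<equiv> set_add M"

abbreviation adic :: "'a set \<Rightarrow> nat \<Rightarrow> 'c set" where "adic S n \<equiv> (set_smult R M S ^^ n) (carrier M)"

lemma submoduleD:
  assumes "submodule N R M"
  shows "x \<in> N \<Longrightarrow> x \<in> carrier M"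
    and "\<zero>\<^bsub>M\<^esub> \<in> N"
    and "x \<in> N \<Longrightarrow> y \<in> N \<Longrightarrow> x \<boxplus> y \<in> N"
    and "x \<in> N \<Longrightarrow> \<ominus>\<^bsub>M\<^esub> x \<in> N"
    and "x \<in> N \<Longrightarrow> y \<in> N \<Longrightarrow> x \<ominus>\<^bsub>M\<^esub> y \<in> N"
    and "r \<in> carrier R \<Longrightarrow> x \<in> N \<Longrightarrow> r \<bullet> x \<in> N"
proof -
  note E = submoduleE[OF assms]
  show "x \<in> N \<Longrightarrow> x \<in> carrier M" using E(1) by auto
  show "\<zero>\<^bsub>M\<^esub> \<in> N" using subgroup.one_closed[OF submodule.axioms(1)[OF assms]] by simp
  show "x \<in> N \<Longrightarrow> y \<in> N \<Longrightarrow> x \<boxplus> y \<in> N" by (rule E(5))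
  show "x \<in> N \<Longrightarrow> \<ominus>\<^bsub>M\<^esub> x \<in> N" by (rule E(3))
  show "x \<in> N \<Longrightarrow> y \<in> N \<Longrightarrow> x \<ominus>\<^bsub>M\<^esub> y \<in> N" by (simp add: a_minus_def E(3,5))
  show "r \<in> carrier R \<Longrightarrow> x \<in> N \<Longrightarrow> r \<bullet> x \<in> N" by (rule E(4))
qed

lemma smult_minus_distr:
  assumes "r \<in> carrier R" "x \<in> carrier M" "y \<in> carrier M"
  shows "r \<bullet> (x \<ominus>\<^bsub>M\<^esub> y) = r \<bullet> x \<ominus>\<^bsub>M\<^esub> r \<bullet> y"
  using assms by (simp add: a_minus_def smult_r_distr smult_r_minus)

lemma diff_add_self:
  assumes "x \<in> carrier M" "y \<in> carrier M"
  shows "y \<boxplus> (x \<ominus>\<^bsub>M\<^esub> y) = x" "(x \<ominus>\<^bsub>M\<^esub> y) \<boxplus> y = x" "(y \<boxplus> x) \<ominus>\<^bsub>M\<^esub> y = x" "(x \<boxplus> y) \<ominus>\<^bsub>M\<^esub> y = x"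
     apply (metis (no_types, lifting) M.minus_eq M.a_comm M.a_assoc M.l_neg M.r_zero assms M.a_inv_closed)
    apply (metis (no_types, lifting) M.minus_eq M.a_assoc M.l_neg M.r_zero assms M.a_inv_closed)
   apply (metis (no_types, lifting) M.minus_eq M.a_comm M.a_assoc M.r_neg M.r_zero assms M.a_inv_closed M.a_closed)
  apply (metis (no_types, lifting) M.minus_eq M.a_assoc M.r_neg M.r_zero assms M.a_inv_closed)
  done

lemma smult_commute:
  assumes "r \<in> carrier R" "s \<in> carrier R" "x \<in> carrier M"
  shows "r \<bullet> (s \<bullet> x) = s \<bullet> (r \<bullet> x)"
  using assms by (metis R.m_comm smult_assoc1)

lemma submodule_zero: "submodule {\<zero>\<^bsub>M\<^esub>} R M"
  by (rule submoduleI) auto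

lemma submodule_Int:
  assumes "submodule N R M" "submodule N' R M"
  shows "submodule (N \<inter> N') R M"
  by (rule submoduleI) (auto intro: submoduleD[OF assms(1)] submoduleD[OF assms(2)])

lemma submodule_Inter:
  assumes "\<And>N. N \<in> F \<Longrightarrow> submodule N R M" "F \<noteq> {}"
  shows "submodule (\<Inter>F) R M"
  using assms by (intro submoduleI) (auto dest: submoduleD[OF assms(1)])

lemma submodule_chain_Union:
  fixes N :: "nat \<Rightarrow> _"
  assumes "\<And>i. submodule (N i) R M" "\<And>i. N i \<subseteq> N (Suc i)"
  shows "submodule (\<Union>i. N i) R M"
proof (rule submoduleI)
  have mono: "i \<le> j \<Longrightarrow> N i \<subseteq> N j" for i j
    by (rule lift_Suc_mono_le[of N]) (use assms in auto)
  show "(\<Union>i. N i) \<subseteq> carrier M" using submoduleD(1)[OF assms(1)] by auto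
  show "\<zero>\<^bsub>M\<^esub> \<in> (\<Union>i. N i)" using submoduleD(2)[OF assms(1)] by auto
  show "\<ominus>\<^bsub>M\<^esub> a \<in> (\<Union>i. N i)" if "a \<in> (\<Union>i. N i)" for a
    using that submoduleD(4)[OF assms(1)] by auto
  show "r \<bullet> a \<in> (\<Union>i. N i)" if "r \<in> carrier R" "a \<in> (\<Union>i. N i)" for a r
    using that submoduleD(6)[OF assms(1)] by auto
  fix a b assume "a \<in> (\<Union>i. N i)" "b \<in> (\<Union>i. N i)"
  then obtain i j where "a \<in> N i" "b \<in> N j" by auto
  then have "a \<in> N (max i j)" "b \<in> N (max i j)"
    using mono[of i "max i j"] mono[of j "max i j"] by auto
  then show "a \<boxplus> b \<in> (\<Union>i. N i)" using submoduleD(3)[OF assms(1)] by blast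
qed

text \<open>The standard device below: to see that \<open>r\<close> carries a generated submodule
  into \<open>N\<close>, it is enough to place its generators in this colon.\<close>

lemma submodule_colon:
  assumes "submodule N R M" "r \<in> carrier R"
  shows "submodule {x \<in> carrier M. r \<bullet> x \<in> N} R M"
  using assms
  by (intro submoduleI)
     (auto simp: smult_r_distr smult_r_minus smult_commute[of r] intro: submoduleD[OF assms(1)])

lemma submodule_scaled:
  assumes "submodule N R M" "r \<in> carrier R"
  shows "submodule ((\<lambda>x. r \<bullet> x) ` N) R M"
proof (rule submoduleI)
  note D = submoduleD[OF assms(1)]
  show "(\<bullet>) r ` N \<subseteq> carrier M" using D assms(2) by auto
  show "\<zero>\<^bsub>M\<^esub> \<in> (\<bullet>) r ` N" using D(2) assms(2) smult_r_null by (metis image_eqI)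
  show "\<ominus>\<^bsub>M\<^esub> a \<in> (\<bullet>) r ` N" if a: "a \<in> (\<bullet>) r ` N" for a
  proof -
    obtain x where "x \<in> N" "a = r \<bullet> x" using a by auto
    then show ?thesis using D(1,4) assms(2) smult_r_minus[of r x] by (metis image_eqI)
  qed
  show "a \<boxplus> b \<in> (\<bullet>) r ` N" if "a \<in> (\<bullet>) r ` N" "b \<in> (\<bullet>) r ` N" for a b
    using that D(1,3) assms(2) by (auto simp flip: smult_r_distr)
  show "s \<bullet> a \<in> (\<bullet>) r ` N" if "s \<in> carrier R" "a \<in> (\<bullet>) r ` N" for a s
    using that D(1,6) assms(2) by (auto simp: smult_commute[of s])
qed

lemma set_add_iff: "x \<in> N \<uplus> N' \<longleftrightarrow> (\<exists>y\<in>N. \<exists>z\<in>N'. x = y \<boxplus> z)"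
  by (auto simp: set_add_def')

lemma submodule_add:
  assumes "submodule N R M" "submodule N' R M"
  shows "submodule (N \<uplus> N') R M"
proof (rule submoduleI)
  note D = submoduleD[OF assms(1)] and D' = submoduleD[OF assms(2)]
  show "N \<uplus> N' \<subseteq> carrier M" using D(1) D'(1) by (auto simp: set_add_iff)
  show "\<zero>\<^bsub>M\<^esub> \<in> N \<uplus> N'" unfolding set_add_iff
    by (rule bexI[OF _ D(2)], rule bexI[OF _ D'(2)]) simp
  show "\<ominus>\<^bsub>M\<^esub> a \<in> N \<uplus> N'" if a: "a \<in> N \<uplus> N'" for a
  proof -
    obtain x y where *: "x \<in> N" "y \<in> N'" "a = x \<boxplus> y" using a unfolding set_add_iff by auto
    then have "\<ominus>\<^bsub>M\<^esub> a = \<ominus>\<^bsub>M\<^esub> x \<boxplus> \<ominus>\<^bsub>M\<^esub> y" using D(1) D'(1) by (simp add: M.minus_add)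
    then show ?thesis using * D(4) D'(4) unfolding set_add_iff by blast
  qed
  show "a \<boxplus> b \<in> N \<uplus> N'" if ab: "a \<in> N \<uplus> N'" "b \<in> N \<uplus> N'" for a b
  proof -
    obtain x y x' y' where *: "x \<in> N" "y \<in> N'" "x' \<in> N" "y' \<in> N'" "a = x \<boxplus> y" "b = x' \<boxplus> y'"
      using ab unfolding set_add_iff by auto
    then have "a \<boxplus> b = (x \<boxplus> x') \<boxplus> (y \<boxplus> y')"
      using D(1) D'(1) by (simp add: M.a_ac)
    then show ?thesis using * D(3) D'(3) unfolding set_add_iff by blast
  qed
  show "r \<bullet> a \<in> N \<uplus> N'" if r: "r \<in> carrier R" and a: "a \<in> N \<uplus> N'" for a r
  proof -
    obtain x y where *: "x \<in> N" "y \<in> N'" "a = x \<boxplus> y" using a unfolding set_add_iff by auto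
    then have "r \<bullet> a = r \<bullet> x \<boxplus> r \<bullet> y" using D(1) D'(1) r by (simp add: smult_r_distr)
    then show ?thesis using * r D(6) D'(6) unfolding set_add_iff by blast
  qed
qed

lemma set_add_upper1:
  assumes "submodule N R M" "submodule N' R M" "x \<in> N" shows "x \<in> N \<uplus> N'"
  unfolding set_add_iff
  by (rule bexI[OF _ assms(3)], rule bexI[OF _ submoduleD(2)[OF assms(2)]])
     (simp add: submoduleD(1)[OF assms(1,3)])

lemma set_add_upper2:
  assumes "submodule N R M" "submodule N' R M" "x \<in> N'" shows "x \<in> N \<uplus> N'"
  unfolding set_add_iff
  by (rule bexI[OF _ submoduleD(2)[OF assms(1)]], rule bexI[OF _ assms(3)])
     (simp add: submoduleD(1)[OF assms(2,3)])

lemma set_add_least: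
  assumes "submodule W R M" "N \<subseteq> W" "N' \<subseteq> W"
  shows "N \<uplus> N' \<subseteq> W"
  using assms submoduleD(3)[OF assms(1)] unfolding set_add_iff subset_iff by blast

text \<open>Allows the two summands to have different targets, as when multiplication raises the
  degree of one summand and keeps the other inside a fixed submodule.\<close>

lemma smult_set_add:
  assumes "r \<in> carrier R" "submodule N R M" "submodule N' R M" "x \<in> N \<uplus> N'"
    and "\<And>y. y \<in> N \<Longrightarrow> r \<bullet> y \<in> D" "\<And>y. y \<in> N' \<Longrightarrow> r \<bullet> y \<in> D'"
  shows "r \<bullet> x \<in> D \<uplus> D'"
proof -
  obtain y z where *: "y \<in> N" "z \<in> N'" "x = y \<boxplus> z" using assms(4) by (auto simp: set_add_iff)
  then have "r \<bullet> x = r \<bullet> y \<boxplus> r \<bullet> z"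
    using smult_r_distr[OF assms(1) submoduleD(1)[OF assms(2)] submoduleD(1)[OF assms(3)]] by simp
  then show ?thesis using * assms(5,6) unfolding set_add_iff by blast
qed

section \<open>Generated submodules and the iterated action of a set of scalars\<close>

lemma submodule_gen:
  assumes "S \<subseteq> carrier M" shows "submodule (gen_submodule R M S) R M"
  unfolding gen_submodule_def
  by (rule submodule_Inter) (use assms carrier_is_submodule in auto)

lemma gen_submodule_incl: "x \<in> S \<Longrightarrow> x \<in> gen_submodule R M S"
  by (auto simp: gen_submodule_def)

lemma gen_submodule_least: "submodule N R M \<Longrightarrow> S \<subseteq> N \<Longrightarrow> gen_submodule R M S \<subseteq> N"
  by (auto simp: gen_submodule_def)

lemma submodule_set_smult:
  assumes "S \<subseteq> carrier R" "N \<subseteq> carrier M"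
  shows "submodule (set_smult R M S N) R M"
  unfolding set_smult_def by (rule submodule_gen) (use assms in auto)

lemma set_smult_incl: "r \<in> S \<Longrightarrow> x \<in> N \<Longrightarrow> r \<bullet> x \<in> set_smult R M S N"
  unfolding set_smult_def by (rule gen_submodule_incl) auto

lemma set_smult_least:
  assumes "submodule W R M" "\<And>r x. r \<in> S \<Longrightarrow> x \<in> N \<Longrightarrow> r \<bullet> x \<in> W"
  shows "set_smult R M S N \<subseteq> W"
  unfolding set_smult_def by (rule gen_submodule_least) (use assms in auto)

lemma set_smult_mono:
  assumes "S \<subseteq> S'" "N \<subseteq> N'" "S' \<subseteq> carrier R" "N' \<subseteq> carrier M"
  shows "set_smult R M S N \<subseteq> set_smult R M S' N'"
  using assms by (intro set_smult_least submodule_set_smult set_smult_incl) auto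

lemma set_smult_sub:
  assumes "submodule N R M" "S \<subseteq> carrier R"
  shows "set_smult R M S N \<subseteq> N"
  using assms by (intro set_smult_least) (auto intro: submoduleD[OF assms(1)])

lemma submodule_set_pow:
  assumes "submodule N R M" "S \<subseteq> carrier R"
  shows "submodule (set_pow_smult R M S n N) R M"
  by (induction n) (use assms in \<open>auto intro!: submodule_set_smult dest: submoduleD(1)\<close>)

lemma set_pow_antimono:
  assumes "submodule N R M" "S \<subseteq> carrier R" "m \<le> n"
  shows "set_pow_smult R M S n N \<subseteq> set_pow_smult R M S m N"
  using assms(3)
proof (induction rule: dec_induct)
  case (step n)
  then show ?case using set_smult_sub[OF submodule_set_pow[OF assms(1,2)] assms(2), of n] by auto
qed auto

text \<open>A family as below is a graded submodule of the Rees module of \<open>M/V\<close>, so this is the Hilbert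
  basis theorem for Rees modules.  One generator \<open>a\<close> is added at a time; \<open>J k m\<close> collects the
  coefficients of \<open>a\<^sup>k\<close> that lead an element of degree \<open>k + m\<close>.\<close>
lemma graded_submodule_stable:
  assumes noeth: "noetherian_module R M" and "finite S"
  shows "S \<subseteq> carrier R \<Longrightarrow> submodule V R M \<Longrightarrow> (\<And>n. submodule (L n) R M) \<Longrightarrow> (\<And>n. V \<subseteq> L n) \<Longrightarrow>
     (\<And>n. L n \<subseteq> adic S n \<uplus> V) \<Longrightarrow> (\<And>n. set_smult R M S (L n) \<subseteq> L (Suc n)) \<Longrightarrow>
     \<exists>c. \<forall>n\<ge>c. L (Suc n) \<subseteq> set_smult R M S (L n) \<uplus> V"
  using assms(2)
proof (induction S arbitrary: L rule: finite_induct)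
  case empty
  have sV: "submodule V R M" and sL: "submodule (L n) R M" for n
    using empty by auto
  show ?case
  proof (intro exI allI impI)
    fix n :: nat
    have 1: "set_smult R M {} N \<subseteq> {\<zero>\<^bsub>M\<^esub>}" for N
      by (rule set_smult_least) (auto intro: submodule_zero)
    have "L (Suc n) \<subseteq> set_smult R M {} (adic {} n) \<uplus> V"
      using empty.prems(5)[of "Suc n"] by simp
    also have "\<dots> \<subseteq> V"
      by (rule set_add_least[OF sV]) (use 1 submoduleD(2)[OF sV] in auto)
    also have "\<dots> \<subseteq> set_smult R M {} (L n) \<uplus> V"
      by (rule subsetI, rule set_add_upper2)
        (use sV submodule_set_smult submoduleD(1)[OF sL] in auto)
    finally show "L (Suc n) \<subseteq> set_smult R M {} (L n) \<uplus> V" .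
  qed
next
  case (insert a S)
  have a: "a \<in> carrier R" and S: "S \<subseteq> carrier R" and aS: "insert a S \<subseteq> carrier R" using insert.prems(1) by auto
  note sV = insert.prems(2) and sL = insert.prems(3) and VL = insert.prems(4)
    and Lle = insert.prems(5) and Lmul = insert.prems(6)
  have Lmul': "b \<bullet> x \<in> L (Suc n)" if "b \<in> insert a S" "x \<in> L n" for b x n
    using Lmul[of n] set_smult_incl[OF that] by auto
  define pw where "pw n = adic S n" for n
  have spw: "submodule (pw n) R M" for n
    unfolding pw_def by (rule submodule_set_pow[OF carrier_is_submodule S])
  have pw_mul: "b \<bullet> x \<in> pw (Suc n)" if "b \<in> S" "x \<in> pw n" for b x n
    unfolding pw_def using set_smult_incl[OF that] by (simp add: pw_def)
  \<comment> \<open>\<open>Q k n\<close> is the sum of \<open>a^j pw (n - j)\<close> over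
    \<open>j < k\<close>: the elements of degree \<open>n\<close> whose degree in \<open>a\<close>
    is below \<open>k\<close>. Wherever exact degrees matter, \<open>k\<close> is at most
    \<open>n + 1\<close>, so the subtraction is not truncated.\<close>
  define Q where "Q k n = rec_nat {\<zero>\<^bsub>M\<^esub>} (\<lambda>j W. W \<uplus> ((\<lambda>x. (a [^]\<^bsub>R\<^esub> j) \<bullet> x) ` pw (n - j))) k" for k n
  have Q0: "Q 0 n = {\<zero>\<^bsub>M\<^esub>}" and QS: "Q (Suc k) n = Q k n \<uplus> ((\<lambda>x. (a [^]\<^bsub>R\<^esub> k) \<bullet> x) ` pw (n - k))" for k n
    by (simp_all add: Q_def)
  have ak: "a [^]\<^bsub>R\<^esub> (k::nat) \<in> carrier R" for k using a by simp
  have a_pow: "(a [^] Suc k) \<bullet> x = a \<bullet> ((a [^] k) \<bullet> x)" if "x \<in> carrier M" for k x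
    using a that by (metis R.nat_pow_Suc R.m_comm smult_assoc1 ak)
  have sQ: "submodule (Q k n) R M" for k n
    by (induction k) (auto simp: Q0 QS intro!: submodule_zero submodule_add submodule_scaled spw ak)
  have sI: "submodule ((\<lambda>x. (a [^]\<^bsub>R\<^esub> (k::nat)) \<bullet> x) ` pw n) R M" for k n
    by (intro submodule_scaled spw ak)
  have Q_mono: "Q k n \<subseteq> Q (Suc k) n" for k n
    unfolding QS using set_add_upper1[OF sQ sI] by auto
  have Q_a: "a \<bullet> x \<in> Q (Suc k) (Suc n)" if "x \<in> Q k n" for x k n
  proof -
    have "Q k n \<subseteq> {x \<in> carrier M. a \<bullet> x \<in> Q (Suc k) (Suc n)}"
    proof (induction k)
      case 0
      then show ?case using a submoduleD(2)[OF sQ] by (auto simp: Q0)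
    next
      case (Suc k)
      have s: "submodule {x \<in> carrier M. a \<bullet> x \<in> Q (Suc (Suc k)) (Suc n)} R M"
        by (rule submodule_colon[OF sQ a])
      show ?case unfolding QS[of k n]
      proof (rule set_add_least[OF s])
        show "Q k n \<subseteq> {x \<in> carrier M. a \<bullet> x \<in> Q (Suc (Suc k)) (Suc n)}"
          using Suc Q_mono[of "Suc k" "Suc n"] by blast
        show "(\<bullet>) (a [^] k) ` pw (n - k) \<subseteq> {x \<in> carrier M. a \<bullet> x \<in> Q (Suc (Suc k)) (Suc n)}"
        proof safe
          fix x assume x: "x \<in> pw (n - k)"
          then have xc: "x \<in> carrier M" using submoduleD(1)[OF spw] by auto
          then show "(a [^] k) \<bullet> x \<in> carrier M" using a by simp
          have "a \<bullet> ((a [^] k) \<bullet> x) = (a [^] Suc k) \<bullet> x" by (rule a_pow[OF xc, symmetric])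
          also have "\<dots> \<in> Q (Suc (Suc k)) (Suc n)"
            unfolding QS[of "Suc k"] by (rule set_add_upper2[OF sQ sI]) (use x in auto)
          finally show "a \<bullet> ((a [^] k) \<bullet> x) \<in> Q (Suc (Suc k)) (Suc n)" .
        qed
      qed
    qed
    then show ?thesis using that by auto
  qed
  \<comment> \<open>Multiplication by \<open>a\<close> moves to the next summand, but multiplication
    by \<open>b\<close> raises the degree of the coefficient from \<open>n - k\<close> to
    \<open>Suc n - k\<close>; hence the bound on \<open>k\<close>.\<close>
  have Q_S: "b \<bullet> x \<in> Q k (Suc n)" if "b \<in> S" "x \<in> Q k n" "k \<le> Suc n" for b x k n
  proof -
    have b: "b \<in> carrier R" using that S by auto
    have "Q k n \<subseteq> {x \<in> carrier M. b \<bullet> x \<in> Q k (Suc n)}" using that(3)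
    proof (induction k)
      case 0
      then show ?case using b by (auto simp: Q0)
    next
      case (Suc k)
      have s: "submodule {x \<in> carrier M. b \<bullet> x \<in> Q (Suc k) (Suc n)} R M"
        by (rule submodule_colon[OF sQ b])
      show ?case unfolding QS[of k n]
      proof (rule set_add_least[OF s])
        show "Q k n \<subseteq> {x \<in> carrier M. b \<bullet> x \<in> Q (Suc k) (Suc n)}"
          using Suc Q_mono[of k "Suc n"] by auto
        show "(\<bullet>) (a [^] k) ` pw (n - k) \<subseteq> {x \<in> carrier M. b \<bullet> x \<in> Q (Suc k) (Suc n)}"
        proof safe
          fix x assume x: "x \<in> pw (n - k)"
          then have xc: "x \<in> carrier M" using submoduleD(1)[OF spw] by auto
          then show "(a [^] k) \<bullet> x \<in> carrier M" using a by simp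
          have "b \<bullet> x \<in> pw (Suc n - k)" using pw_mul[OF that(1) x] Suc.prems by (simp add: Suc_diff_le)
          moreover have "b \<bullet> ((a [^] k) \<bullet> x) = (a [^] k) \<bullet> (b \<bullet> x)"
            by (rule smult_commute[OF b ak xc])
          ultimately show "b \<bullet> ((a [^] k) \<bullet> x) \<in> Q (Suc k) (Suc n)"
            unfolding QS[of k] by (auto intro!: set_add_upper2[OF sQ sI])
        qed
      qed
    qed
    then show ?thesis using that by auto
  qed
  have pw_Q: "adic (insert a S) n \<subseteq> Q (Suc n) n" for n
  proof (induction n)
    case 0
    show ?case
    proof
      fix x assume "x \<in> adic (insert a S) 0"
      then have x: "x \<in> carrier M" by simp
      then show "x \<in> Q (Suc 0) 0" unfolding QS
        by (intro set_add_upper2[OF sQ sI]) (auto simp: pw_def intro!: image_eqI[of _ _ x])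
    qed
  next
    case (Suc n)
    have "set_smult R M (insert a S) (adic (insert a S) n) \<subseteq> Q (Suc (Suc n)) (Suc n)"
    proof (rule set_smult_least[OF sQ])
      fix r x assume "r \<in> insert a S" "x \<in> adic (insert a S) n"
      then show "r \<bullet> x \<in> Q (Suc (Suc n)) (Suc n)"
        using Suc Q_a[of x "Suc n" n] Q_S[of r x "Suc n" n] Q_mono[of "Suc n" "Suc n"] by auto
    qed
    then show ?case by simp
  qed
  \<comment> \<open>For fixed \<open>k\<close> this is a graded family over \<open>S\<close> alone,
    so the induction hypothesis applies; for fixed \<open>m\<close> it grows with \<open>k\<close>,
    so the chain condition applies. The intersection with \<open>pw m \<uplus> V\<close> is the
    upper bound that the induction hypothesis demands.\<close>
  define J where "J k m = (pw m \<uplus> V) \<inter> {x \<in> carrier M. (a [^]\<^bsub>R\<^esub> k) \<bullet> x \<in> Q k (k + m) \<uplus> L (k + m)}" for k m :: nat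
  have sLQ: "submodule (Q k n' \<uplus> L n) R M" for n k n' by (rule submodule_add[OF sQ sL])
  have sJ: "submodule (J k m) R M" for k m
    unfolding J_def by (intro submodule_Int submodule_add submodule_colon spw sV sL sQ ak)
  have VJ: "V \<subseteq> J k m" for k m
  proof
    fix v assume v: "v \<in> V"
    have "(a [^] k) \<bullet> v \<in> L (k + m)" using submoduleD(6)[OF sV ak v] VL by auto
    then show "v \<in> J k m"
      unfolding J_def using set_add_upper2[OF spw sV v] submoduleD(1)[OF sV v] set_add_upper2[OF sQ sL] by auto
  qed
  have Jmul: "set_smult R M S (J k m) \<subseteq> J k (Suc m)" for k m
  proof (rule set_smult_least[OF sJ])
    fix r x assume r: "r \<in> S" and x: "x \<in> J k m"
    have rc: "r \<in> carrier R" using r S by auto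
    have xc: "x \<in> carrier M" using x by (auto simp: J_def)
    have "r \<bullet> x \<in> pw (Suc m) \<uplus> V"
      by (rule smult_set_add[OF rc spw sV]) (use x r pw_mul submoduleD(6)[OF sV rc] in \<open>auto simp: J_def\<close>)
    moreover have "r \<bullet> ((a [^] k) \<bullet> x) \<in> Q k (k + Suc m) \<uplus> L (k + Suc m)"
      by (rule smult_set_add[OF rc sQ sL, of _ k "k + m" "k + m"]) (use x r Lmul'[of r] Q_S[OF r] in \<open>auto simp: J_def\<close>)
    ultimately show "r \<bullet> x \<in> J k (Suc m)" using rc xc smult_commute[OF rc ak xc, of k] by (simp add: J_def)
  qed
  have Jup: "J k m \<subseteq> J (Suc k) m" for k m
  proof
    fix x assume x: "x \<in> J k m"
    have xc: "x \<in> carrier M" using x by (auto simp: J_def)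
    have "(a [^] Suc k) \<bullet> x = a \<bullet> ((a [^] k) \<bullet> x)" by (rule a_pow[OF xc])
    also have "\<dots> \<in> Q (Suc k) (Suc k + m) \<uplus> L (Suc k + m)"
      by (rule smult_set_add[OF a sQ sL, of _ k "k + m" "k + m"]) (use x Lmul'[of a] Q_a in \<open>auto simp: J_def\<close>)
    finally show "x \<in> J (Suc k) m" using x unfolding J_def by auto
  qed
  have Jmono: "k \<le> k' \<Longrightarrow> J k m \<subseteq> J k' m" for k k' m
    by (rule lift_Suc_mono_le[of "\<lambda>k. J k m"]) (use Jup in auto)
  have Jle: "J k m \<subseteq> pw m \<uplus> V" for k m by (auto simp: J_def)
  \<comment> \<open>The induction hypothesis gives for each \<open>k\<close> a bound
    \<open>c k\<close> depending on \<open>k\<close>. Applying it to the union over \<open>k\<close>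
    as well is what makes finitely many of these bounds suffice.\<close>
  define Ji where "Ji m = (\<Union>k. J k m)" for m
  have sJi: "submodule (Ji m) R M" for m
    unfolding Ji_def by (rule submodule_chain_Union[of "\<lambda>k. J k m"]) (rule sJ, rule Jup)
  have IH: "\<exists>c. \<forall>m\<ge>c. J k (Suc m) \<subseteq> set_smult R M S (J k m) \<uplus> V" for k
    by (rule insert.IH[OF S sV]) (use sJ VJ Jle Jmul in \<open>auto simp: pw_def\<close>)
  then obtain c where c: "\<And>k m. m \<ge> c k \<Longrightarrow> J k (Suc m) \<subseteq> set_smult R M S (J k m) \<uplus> V" by metis
  have "\<exists>c. \<forall>m\<ge>c. Ji (Suc m) \<subseteq> set_smult R M S (Ji m) \<uplus> V"
  proof (rule insert.IH[OF S sV sJi])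
    show "V \<subseteq> Ji n" for n using VJ by (auto simp: Ji_def)
    show "Ji n \<subseteq> adic S n \<uplus> V" for n
      using Jle unfolding Ji_def pw_def by blast
    show "set_smult R M S (Ji n) \<subseteq> Ji (Suc n)" for n
    proof (rule set_smult_least[OF sJi])
      fix r x assume "r \<in> S" "x \<in> Ji n"
      then show "r \<bullet> x \<in> Ji (Suc n)"
        using Jmul set_smult_incl[of r S x] unfolding Ji_def by blast
    qed
  qed
  then obtain ci where ci: "\<And>m. m \<ge> ci \<Longrightarrow> Ji (Suc m) \<subseteq> set_smult R M S (Ji m) \<uplus> V" by metis
  have "\<exists>k0. \<forall>k\<ge>k0. J k m = J k0 m" for m
    using noeth[unfolded noetherian_module_def, rule_format, of "\<lambda>k. J k m"] sJ Jup by auto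
  then obtain km where km: "\<And>m k. k \<ge> km m \<Longrightarrow> J k m = J (km m) m" by metis
  \<comment> \<open>Up to degree \<open>ci\<close> only finitely many chains have to become
    stationary. Beyond \<open>ci\<close> the union is generated from the preceding degree, so
    \<open>J k m\<close> equals the union in all degrees once \<open>k \<ge> k0\<close>.\<close>
  define k0 where "k0 = Max (km ` {..ci})"
  have JJi: "Ji m \<subseteq> J k m" if k: "k \<ge> k0" for k m
  proof (induction m)
    have low: "Ji m \<subseteq> J k m" if m: "m \<le> ci" for m
    proof -
      have "km m \<le> k0" unfolding k0_def using m by auto
      then have k: "k \<ge> km m" using k by simp
      have "J i m \<subseteq> J k m" for i
        using Jmono[of i "max i k" m] km[of m "max i k"] km[of m k] k by auto
      then show ?thesis unfolding Ji_def by auto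
    qed
    case 0
    then show ?case using low by simp
    case (Suc m)
    show ?case
    proof (cases "Suc m \<le> ci")
      case False
      have "set_smult R M S (Ji m) \<subseteq> J k (Suc m)"
        using set_smult_mono[OF order.refl Suc S, of] Jmul[of k m] submoduleD(1)[OF sJ] by blast
      then have "set_smult R M S (Ji m) \<uplus> V \<subseteq> J k (Suc m)"
        by (rule set_add_least[OF sJ _ VJ])
      then show ?thesis using ci[of m] False by auto
    qed (use low in auto)
  qed
  \<comment> \<open>Only \<open>k \<le> k0\<close> needs a bound, since larger \<open>k\<close> are
    reduced to \<open>k - 1\<close>. For \<open>n \<ge> k0 + c0\<close> the degree
    \<open>n - k\<close> is past \<open>c k\<close> for every such \<open>k\<close>.\<close>
  define c0 where "c0 = Max (c ` {..k0})"
  show ?case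
  proof (intro exI[of _ "k0 + c0"] allI impI)
    fix n assume n: "n \<ge> k0 + c0"
    define W where "W = set_smult R M (insert a S) (L n) \<uplus> V"
    have sX0: "submodule (set_smult R M (insert a S) (L n)) R M"
      by (rule submodule_set_smult[OF aS]) (use submoduleD(1)[OF sL] in auto)
    have sX: "submodule W R M" unfolding W_def by (rule submodule_add[OF sX0 sV])
    have XL: "W \<subseteq> L (Suc n)" unfolding W_def
      by (rule set_add_least[OF sL Lmul VL])
    have VX: "V \<subseteq> W" unfolding W_def using set_add_upper2[OF sX0 sV] by auto
    have LX: "b \<bullet> l \<in> W" if "b \<in> insert a S" "l \<in> L n" for b l
      unfolding W_def by (rule set_add_upper1[OF sX0 sV set_smult_incl[OF that]])
    have sQX: "submodule (Q k (Suc n) \<uplus> W) R M" for k by (rule submodule_add[OF sQ sX])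
    \<comment> \<open>A leading coefficient in degree \<open>n + 1\<close> comes from degree
      \<open>n\<close>: for \<open>k > k0\<close> a factor \<open>a\<close> can be removed because
      \<open>J k\<close> and \<open>J (k - 1)\<close> agree, and for \<open>k \<le> k0\<close> a
      factor from \<open>S\<close> can be removed because the degree of \<open>y\<close> is past
      \<open>c k\<close>.\<close>
    have key: "(a [^] k) \<bullet> y \<in> Q k (Suc n) \<uplus> W"
      if k: "k \<le> Suc n" and y: "y \<in> J k (Suc n - k)" for k y
    proof (cases "k > k0")
      case True
      define k' where "k' = k - 1"
      have kk: "k = Suc k'" "k' \<ge> k0" using True by (auto simp: k'_def)
      have "y \<in> J k' (Suc n - k)" using y JJi[OF kk(2)] by (auto simp: Ji_def)
      then have yc: "y \<in> carrier M" and ay: "(a [^] k') \<bullet> y \<in> Q k' n \<uplus> L n"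
        using kk k by (auto simp: J_def)
      have "(a [^] k) \<bullet> y = a \<bullet> ((a [^] k') \<bullet> y)" unfolding kk by (rule a_pow[OF yc])
      also have "\<dots> \<in> Q k (Suc n) \<uplus> W"
        by (rule smult_set_add[OF a sQ sL, of _ k' n n]) (use ay kk Q_a LX[of a] in auto)
      finally show ?thesis .
    next
      case False
      define m where "m = n - k"
      have m: "Suc n - k = Suc m" "k + m = n" using False n by (auto simp: m_def)
      have "c k \<le> c0" unfolding c0_def using False by auto
      then have "m \<ge> c k" using False n by (auto simp: m_def)
      then have "y \<in> set_smult R M S (J k m) \<uplus> V" using y c m by auto
      moreover have "set_smult R M S (J k m) \<uplus> V \<subseteq> {y \<in> carrier M. (a [^] k) \<bullet> y \<in> Q k (Suc n) \<uplus> W}" (is "_ \<subseteq> ?Y")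
      proof (rule set_add_least)
        show sY: "submodule ?Y R M" by (rule submodule_colon[OF sQX ak])
        show "V \<subseteq> ?Y"
        proof
          fix v assume v: "v \<in> V"
          have "(a [^] k) \<bullet> v \<in> W" using submoduleD(6)[OF sV ak v] VX by auto
          then show "v \<in> ?Y" using submoduleD(1)[OF sV v] set_add_upper2[OF sQ sX] by auto
        qed
        show "set_smult R M S (J k m) \<subseteq> ?Y"
        proof (rule set_smult_least[OF sY])
          fix r x assume r: "r \<in> S" and x: "x \<in> J k m"
          have rc: "r \<in> carrier R" using r S by auto
          have xc: "x \<in> carrier M" using x by (auto simp: J_def)
          have "(a [^] k) \<bullet> (r \<bullet> x) = r \<bullet> ((a [^] k) \<bullet> x)"
            by (rule smult_commute[OF ak rc xc])
          also have "\<dots> \<in> Q k (Suc n) \<uplus> W"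
            by (rule smult_set_add[OF rc sQ sL, of _ k n n]) (use x m r k Q_S[OF r] LX[of r] in \<open>auto simp: J_def\<close>)
          finally show "r \<bullet> x \<in> ?Y" using rc xc by simp
        qed
      qed
      ultimately show ?thesis by auto
    qed
    \<comment> \<open>Division with remainder: \<open>key\<close> trades the term with
      \<open>a^k\<close> for an element of \<open>W\<close> and terms of lower order in
      \<open>a\<close>, until \<open>Q 0\<close>, which is zero, is reached.\<close>
    have "L (Suc n) \<inter> (Q k (Suc n) \<uplus> W) \<subseteq> W" if "k \<le> Suc (Suc n)" for k
      using that
    proof (induction k)
      case 0
      then show ?case using submoduleD(1)[OF sX] by (auto simp: Q0 set_add_iff)
    next
      case (Suc k)
      show ?case
      proof safe
        fix x assume x: "x \<in> L (Suc n)" "x \<in> Q (Suc k) (Suc n) \<uplus> W"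
        then obtain q y z where q: "q \<in> Q k (Suc n)" and y: "y \<in> pw (Suc n - k)" and z: "z \<in> W"
          and xe: "x = (q \<boxplus> (a [^] k) \<bullet> y) \<boxplus> z"
          by (auto simp: QS set_add_iff)
        have qc: "q \<in> carrier M" and yc: "y \<in> carrier M" and zc: "z \<in> carrier M" and zL: "z \<in> L (Suc n)"
          using q y z XL submoduleD(1)[OF sQ] submoduleD(1)[OF spw] submoduleD(1)[OF sX] by auto
        define w where "w = (a [^] k) \<bullet> y"
        have wc: "w \<in> carrier M" using yc ak by (simp add: w_def)
        have xw: "x = w \<boxplus> (q \<boxplus> z)" unfolding xe w_def[symmetric]
          using qc zc wc by (simp add: M.a_ac)
        have "w = (x \<ominus>\<^bsub>M\<^esub> (q \<boxplus> z))"
          unfolding xw using qc zc wc diff_add_self(4)[of w "q \<boxplus> z"] by simp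
        moreover have "q \<in> Q k (Suc n) \<uplus> L (Suc n)" "z \<in> Q k (Suc n) \<uplus> L (Suc n)" "x \<in> Q k (Suc n) \<uplus> L (Suc n)"
          using set_add_upper1[OF sQ sL] set_add_upper2[OF sQ sL] q zL x by auto
        ultimately have "w \<in> Q k (Suc n) \<uplus> L (Suc n)"
          by (metis submoduleD(3,5)[OF sLQ])
        then have "y \<in> J k (Suc n - k)"
          using Suc.prems yc set_add_upper1[OF spw sV y] by (auto simp: J_def w_def)
        then have "w \<in> Q k (Suc n) \<uplus> W" unfolding w_def using key Suc.prems by auto
        then have "x \<in> Q k (Suc n) \<uplus> W" unfolding xw
          using set_add_upper1[OF sQ sX q] set_add_upper2[OF sQ sX z] by (auto intro: submoduleD(3)[OF sQX])
        then show "x \<in> W" using Suc x by auto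
      qed
    qed
    from this[of "Suc (Suc n)"] have 1: "L (Suc n) \<inter> (Q (Suc (Suc n)) (Suc n) \<uplus> W) \<subseteq> W" by simp
    have "L (Suc n) \<subseteq> Q (Suc (Suc n)) (Suc n) \<uplus> W"
      using Lle[of "Suc n"] pw_Q[of "Suc n"] VX unfolding set_add_iff subset_iff by blast
    then have "L (Suc n) \<subseteq> W" using 1 by auto
    then show "L (Suc n) \<subseteq> set_smult R M (insert a S) (L n) \<uplus> V" unfolding W_def .
  qed
qed

end

section \<open>One-dimensional Noetherian domains\<close>

text \<open>For finite \<open>S\<close> this is a finite generating set of the \<open>m\<close>-th
  power of the ideal of \<open>S\<close>. Finiteness matters because one denominator outside a prime
  has to serve for all these products.\<close>

primrec set_prods :: "('r,'c) ring_scheme \<Rightarrow> 'r set \<Rightarrow> nat \<Rightarrow> 'r set" where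
  "set_prods R S 0 = {\<one>\<^bsub>R\<^esub>}"
| "set_prods R S (Suc m) = (\<lambda>(a, p). a \<otimes>\<^bsub>R\<^esub> p) ` (S \<times> set_prods R S m)"

lemma finite_set_prods: "finite S \<Longrightarrow> finite (set_prods R S m)"
  by (induction m) auto

context cring
begin

lemma set_prods_carrier: "S \<subseteq> carrier R \<Longrightarrow> set_prods R S m \<subseteq> carrier R"
  by (induction m) auto

lemma ideal_by_closure:
  assumes "J \<subseteq> carrier R" "\<zero> \<in> J" "\<And>x y. x \<in> J \<Longrightarrow> y \<in> J \<Longrightarrow> x \<oplus> y \<in> J"
    "\<And>r x. r \<in> carrier R \<Longrightarrow> x \<in> J \<Longrightarrow> r \<otimes> x \<in> J"
  shows "ideal J R"
proof (rule idealI)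
  show "ring R" by (rule ring_axioms)
  have neg: "\<ominus> x \<in> J" if "x \<in> J" for x
    using assms(4)[of "\<ominus> \<one>" x] that assms(1) by (auto simp: l_minus)
  show "subgroup J (add_monoid R)"
    by (rule subgroup.intro) (use assms neg in \<open>auto simp: a_inv_def\<close>)
  show "x \<otimes> a \<in> J" if "a \<in> J" "x \<in> carrier R" for a x using that assms by auto
  then show "a \<otimes> x \<in> J" if "a \<in> J" "x \<in> carrier R" for a x
    using that assms(1) m_comm[of a x] by auto
qed

lemma ideal_colon:
  assumes "ideal J R" "r \<in> carrier R"
  shows "ideal {s \<in> carrier R. s \<otimes> r \<in> J} R"
proof -
  interpret J: ideal J R by fact
  show ?thesis
    by (rule ideal_by_closure)
       (use assms(2) in \<open>auto simp: l_distr m_assoc intro: J.I_l_closed\<close>)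
qed

lemma primeideal_pow_mem:
  assumes "primeideal P R" "r \<in> carrier R" "r [^] (n::nat) \<in> P"
  shows "r \<in> P"
proof -
  interpret P: primeideal P R by fact
  show ?thesis using assms(3)
  proof (induction n)
    case 0
    then have "P = carrier R" using P.one_imp_carrier by simp
    then show ?case using P.I_notcarr by simp
  next
    case (Suc n)
    then show ?case using P.I_prime[of "r [^] n" r] assms(2) by auto
  qed
qed

lemma primeideal_mult_notin:
  assumes "primeideal P R" "s \<in> carrier R - P" "t \<in> carrier R - P"
  shows "s \<otimes> t \<in> carrier R - P"
  using primeideal.I_prime[OF assms(1), of s t] assms(2,3) by auto

lemma primeideal_one_notin:
  assumes "primeideal P R" shows "\<one> \<in> carrier R - P"
  using ideal.one_imp_carrier[OF primeideal.axioms(1)[OF assms]] primeideal.I_notcarr[OF assms] by auto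

end

lemma (in noetherian_ring) maximal_ideal_exists:
  assumes "F \<noteq> {}" "\<And>J. J \<in> F \<Longrightarrow> ideal J R"
  obtains J where "J \<in> F" "\<And>J'. J' \<in> F \<Longrightarrow> J \<subseteq> J' \<Longrightarrow> J' = J"
proof -
  have "\<exists>J\<in>F. \<forall>J'\<in>F. J \<subseteq> J' \<longrightarrow> J' = J"
  proof (rule subset_Zorn)
    fix C assume C: "subset.chain F C"
    show "\<exists>U\<in>F. \<forall>Y\<in>C. Y \<subseteq> U"
    proof (cases "C = {}")
      case True
      then show ?thesis using assms(1) by auto
    next
      case False
      have "subset.chain {I. ideal I R} C" using C assms(2) unfolding pred_on.chain_def by blast
      then have "\<Union>C \<in> C" by (rule ideal_chain_is_trivial[OF False])
      then have "\<Union>C \<in> F" using C by (auto simp: pred_on.chain_def)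
      then show ?thesis by (rule bexI[rotated]) auto
    qed
  qed
  then show ?thesis using that by blast
qed

lemma (in noetherian_ring) ideal_chain_stable:
  fixes J :: "nat \<Rightarrow> 'a set"
  assumes "\<And>i. ideal (J i) R" "\<And>i. J i \<subseteq> J (Suc i)"
  shows "\<exists>k. \<forall>i\<ge>k. J i = J k"
proof -
  have mono: "i \<le> j \<Longrightarrow> J i \<subseteq> J j" for i j
    by (rule lift_Suc_mono_le[of J]) (use assms in auto)
  obtain K where K: "K \<in> range J" "\<And>J'. J' \<in> range J \<Longrightarrow> K \<subseteq> J' \<Longrightarrow> J' = K"
    by (rule maximal_ideal_exists[of "range J"]) (use assms in auto)
  then obtain k where "K = J k" by auto
  show ?thesis
  proof (intro exI[of _ k] allI impI)
    fix i assume "i \<ge> k"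
    then show "J i = J k" using K(2)[of "J i"] mono[of k i] \<open>K = J k\<close> by auto
  qed
qed

text \<open>The form in which dimension one is used: a strict inclusion of nonzero primes would
  extend by the zero ideal to a chain of length two.\<close>

locale one_dim_noetherian_domain = noetherian_domain +
  assumes nonzero_primes_incomparable:
    "primeideal P R \<Longrightarrow> primeideal Q R \<Longrightarrow> P \<subseteq> Q \<Longrightarrow> P \<noteq> {\<zero>} \<Longrightarrow> P = Q"

lemma one_dim_noetherian_domainI:
  assumes "noetherian_domain R" "krull_dim R = 1"
  shows "one_dim_noetherian_domain R"
proof -
  interpret noetherian_domain R by fact
  show ?thesis
  proof (unfold_locales, rule ccontr)
    fix P Q assume PQ: "primeideal P R" "primeideal Q R" "P \<subseteq> Q" "P \<noteq> {\<zero>\<^bsub>R\<^esub>}" "P \<noteq> Q"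
    interpret P: primeideal P R by fact
    have "{\<zero>\<^bsub>R\<^esub>} \<subset> P" using PQ(4) P.zero_closed by blast
    then have "prime_chain R 2" unfolding prime_chain_def
      by (intro exI[of _ "\<lambda>i. if i = 0 then {\<zero>\<^bsub>R\<^esub>} else if i = 1 then P else Q"])
         (use PQ zeroprimeideal in \<open>auto simp: less_2_cases_iff\<close>)
    then have "enat 2 \<le> krull_dim R" unfolding krull_dim_def by (intro Sup_upper) auto
    then show False using assms(2) by (simp add: one_enat_def)
  qed
qed

context one_dim_noetherian_domain
begin

text \<open>A maximal element among the \<open>(J : r) \<subseteq> P\<close> is prime, and nonzero because it contains \<open>J\<close>.\<close>
lemma prime_is_colon:
  assumes J: "ideal J R" "J \<noteq> {\<zero>}" and P: "primeideal P R" and JP: "J \<subseteq> P"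
  obtains r where "r \<in> carrier R" "{s \<in> carrier R. s \<otimes> r \<in> J} = P"
proof -
  interpret J: ideal J R by fact
  interpret P: primeideal P R by fact
  define c where "c r = {s \<in> carrier R. s \<otimes> r \<in> J}" for r
  define F where "F = {c r | r. r \<in> carrier R \<and> c r \<subseteq> P}"
  have "c \<one> = J" using J.a_subset by (auto simp: c_def)
  then have "F \<noteq> {}" using JP by (auto simp: F_def intro!: exI[of _ \<one>])
  then obtain K where K: "K \<in> F" "\<And>J'. J' \<in> F \<Longrightarrow> K \<subseteq> J' \<Longrightarrow> J' = K"
    by (rule maximal_ideal_exists) (auto simp: F_def c_def intro: ideal_colon[OF J(1)])
  then obtain r where r: "r \<in> carrier R" "K = c r" "c r \<subseteq> P" by (auto simp: F_def)
  have JK: "J \<subseteq> K" using r J.a_subset by (auto simp: c_def intro: J.I_r_closed)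
  have idK: "ideal K R" unfolding r c_def by (rule ideal_colon[OF J(1) r(1)])
  interpret K: ideal K R by (rule idK)
  have "primeideal K R"
  proof (rule primeidealI[OF idK])
    show "cring R" by (rule is_cring)
    show "carrier R \<noteq> K" using r P.I_notcarr P.a_subset by auto
    fix b d assume b: "b \<in> carrier R" and d: "d \<in> carrier R" and bd: "b \<otimes> d \<in> K"
    show "b \<in> K \<or> d \<in> K"
    proof (rule ccontr)
      assume n: "\<not> (b \<in> K \<or> d \<in> K)"
      \<comment> \<open>Multiplying \<open>r\<close> by an element can only enlarge the colon, so by
        maximality it stays \<open>K\<close> or leaves \<open>P\<close>. For \<open>r b\<close> it
        gains \<open>d\<close>, hence leaves \<open>P\<close>, and this gives \<open>s\<close>
        outside \<open>P\<close> with \<open>s r b\<close> in \<open>J\<close>. For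
        \<open>r s\<close> it stays inside \<open>P\<close>, hence equals \<open>K\<close>, although
        it contains \<open>b\<close>.\<close>
      have up: "K \<subseteq> c (r \<otimes> t)" if t: "t \<in> carrier R" for t
      proof
        fix s assume "s \<in> K"
        then have s: "s \<in> carrier R" "s \<otimes> r \<in> J" unfolding r c_def by auto
        then have "s \<otimes> (r \<otimes> t) = (s \<otimes> r) \<otimes> t" using r(1) t by (simp add: m_assoc)
        then show "s \<in> c (r \<otimes> t)" using s J.I_r_closed[OF s(2) t] by (simp add: c_def)
      qed
      have "d \<in> c (r \<otimes> b)" using bd b d r(1) unfolding r(2) c_def by (simp add: m_ac)
      then have "c (r \<otimes> b) \<noteq> K" using n by auto
      then have "c (r \<otimes> b) \<notin> F" using K(2)[of "c (r \<otimes> b)"] up[OF b] by auto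
      then have "\<not> c (r \<otimes> b) \<subseteq> P" using r(1) b by (auto simp: F_def)
      then obtain s where s: "s \<in> carrier R" "s \<otimes> (r \<otimes> b) \<in> J" "s \<notin> P"
        by (auto simp: c_def)
      have "c (r \<otimes> s) \<subseteq> P"
      proof
        fix t assume "t \<in> c (r \<otimes> s)"
        then have t: "t \<in> carrier R" "t \<otimes> s \<in> c r" using r(1) s(1) by (auto simp: c_def m_ac)
        then have "t \<otimes> s \<in> P" using r(3) by auto
        then show "t \<in> P" using P.I_prime[OF t(1) s(1)] s(3) by auto
      qed
      then have "c (r \<otimes> s) = K" using K(2)[of "c (r \<otimes> s)"] up[OF s(1)] r(1) s(1) by (auto simp: F_def)
      moreover have "b \<in> c (r \<otimes> s)" using s b r(1) by (auto simp: c_def m_ac)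
      ultimately show False using n by auto
    qed
  qed
  moreover have "K \<noteq> {\<zero>}" using JK J(2) J.zero_closed by auto
  ultimately have "K = P" using nonzero_primes_incomparable[OF _ P] r by auto
  then have "{s \<in> carrier R. s \<otimes> r \<in> J} = P" unfolding r(2) c_def .
  then show ?thesis by (rule that[OF r(1)])
qed

text \<open>Noetherian induction. A maximal counterexample \<open>K\<close> is not prime, since a
  nonzero prime lies properly below no other prime. So it contains a product \<open>b d\<close> of
  two elements outside it; every prime above \<open>K\<close> contains \<open>b\<close> or
  \<open>d\<close>, and adjoining either element gives a larger ideal, with only finitely many
  primes above it.\<close>

lemma finite_primes_above:
  assumes "ideal J R" "J \<noteq> {\<zero>}"
  shows "finite {P. primeideal P R \<and> J \<subseteq> P}"
proof (rule ccontr)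
  define F where "F = {J. ideal J R \<and> J \<noteq> {\<zero>} \<and> infinite {P. primeideal P R \<and> J \<subseteq> P}}"
  assume "infinite {P. primeideal P R \<and> J \<subseteq> P}"
  then have "F \<noteq> {}" using assms by (auto simp: F_def)
  then obtain K where K: "K \<in> F" "\<And>J'. J' \<in> F \<Longrightarrow> K \<subseteq> J' \<Longrightarrow> J' = K"
    by (rule maximal_ideal_exists) (auto simp: F_def)
  then have K': "ideal K R" "K \<noteq> {\<zero>}" "infinite {P. primeideal P R \<and> K \<subseteq> P}" by (auto simp: F_def)
  interpret K: ideal K R by (rule K')
  have np: "\<not> primeideal K R"
  proof
    assume "primeideal K R"
    then have "{P. primeideal P R \<and> K \<subseteq> P} \<subseteq> {K}" using nonzero_primes_incomparable K'(2) by blast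
    then show False using K'(3) finite_subset by blast
  qed
  have nc: "carrier R \<noteq> K"
  proof
    assume "carrier R = K"
    have "\<not> K \<subseteq> P" if P: "primeideal P R" for P
    proof -
      interpret P: primeideal P R by (rule P)
      show ?thesis using P.I_notcarr P.a_subset \<open>carrier R = K\<close> by auto
    qed
    then have "{P. primeideal P R \<and> K \<subseteq> P} = {}" by auto
    then show False using K'(3) by (metis finite.emptyI)
  qed
  obtain b d where bd: "b \<in> carrier R" "d \<in> carrier R" "b \<otimes> d \<in> K" "b \<notin> K" "d \<notin> K"
    using K.primeidealCD[OF is_cring np] nc by auto
  have fin: "finite {P. primeideal P R \<and> insert x K \<subseteq> P}" if x: "x \<in> carrier R" "x \<notin> K" for x
  proof -
    let ?G = "Idl (insert x K)"
    have sub: "insert x K \<subseteq> carrier R" using x K.a_subset by auto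
    have G: "ideal ?G R" "insert x K \<subseteq> ?G" using genideal_ideal[OF sub] genideal_self[OF sub] by auto
    have "?G \<notin> F" using K(2)[of ?G] G x by auto
    moreover have "?G \<noteq> {\<zero>}" using G(2) K.zero_closed K'(2) by blast
    ultimately have "finite {P. primeideal P R \<and> ?G \<subseteq> P}" using G(1) by (auto simp: F_def)
    moreover have "{P. primeideal P R \<and> insert x K \<subseteq> P} \<subseteq> {P. primeideal P R \<and> ?G \<subseteq> P}"
      using genideal_minimal[OF primeideal.axioms(1)] by blast
    ultimately show ?thesis by (rule finite_subset[rotated])
  qed
  have "{P. primeideal P R \<and> K \<subseteq> P} \<subseteq>
     {P. primeideal P R \<and> insert b K \<subseteq> P} \<union> {P. primeideal P R \<and> insert d K \<subseteq> P}"
    using primeideal.I_prime[OF _ bd(1,2)] bd(3) by blast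
  from finite_subset[OF this finite_UnI[OF fin[OF bd(1,4)] fin[OF bd(2,5)]]] show False
    using K'(3) by blast
qed

text \<open>In the local ring at \<open>P\<close> the maximal ideal is the only nonzero prime, so
  the ideal \<open>(d)\<close> contains a power of the ideal of \<open>S\<close>. The denominator
  \<open>s\<close> makes this a statement about \<open>R\<close> itself.\<close>

lemma local_power_in_principal:
  assumes S: "finite S" "S \<subseteq> P" and P: "primeideal P R" and d: "d \<in> carrier R" "d \<noteq> \<zero>"
  obtains s m where "s \<in> carrier R - P" "\<And>p. p \<in> set_prods R S m \<Longrightarrow> \<exists>c\<in>carrier R. s \<otimes> p = c \<otimes> d"
proof -
  interpret P: primeideal P R by fact
  have Sc: "S \<subseteq> carrier R" using S P.a_subset by auto
  have pc: "p \<in> set_prods R S m \<Longrightarrow> p \<in> carrier R" for p m using set_prods_carrier[OF Sc] by auto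
  define dvds where "dvds r m \<longleftrightarrow> (\<forall>p\<in>set_prods R S m. \<exists>c\<in>carrier R. r \<otimes> p = c \<otimes> d)" for r m
  have dvds_Suc: "dvds r (Suc m)" if r: "r \<in> carrier R" and h: "dvds r m" for r m
    unfolding dvds_def
  proof
    fix p assume "p \<in> set_prods R S (Suc m)"
    then obtain a q where p: "p = a \<otimes> q" "a \<in> S" "q \<in> set_prods R S m" by auto
    obtain c where c: "c \<in> carrier R" "r \<otimes> q = c \<otimes> d" using h p(3) unfolding dvds_def by auto
    have a: "a \<in> carrier R" using p Sc by auto
    have "r \<otimes> p = a \<otimes> (r \<otimes> q)" unfolding p(1) using r a pc[OF p(3)] by (simp add: m_ac)
    also have "\<dots> = (a \<otimes> c) \<otimes> d" unfolding c(2) using a c(1) d by (simp add: m_ac)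
    finally show "\<exists>c\<in>carrier R. r \<otimes> p = c \<otimes> d" using a c(1) by blast
  qed
  have dvds_mono: "m \<le> m' \<Longrightarrow> r \<in> carrier R \<Longrightarrow> dvds r m \<Longrightarrow> dvds r m'" for r m m'
    by (induction rule: dec_induct) (auto intro: dvds_Suc)
  \<comment> \<open>All possible denominators, including those inside \<open>P\<close>, together
    with an exponent for each. This is a nonzero ideal because it contains \<open>d\<close>; what
    remains is that it is not contained in \<open>P\<close>.\<close>
  define J where "J = {r \<in> carrier R. \<exists>m. dvds r m}"
  have idJ: "ideal J R"
  proof (rule ideal_by_closure)
    have "dvds \<zero> 0" using d by (auto simp: dvds_def intro!: bexI[of _ \<zero>])
    then show "\<zero> \<in> J" by (auto simp: J_def)
    show "x \<oplus> y \<in> J" if xy: "x \<in> J" "y \<in> J" for x y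
    proof -
      obtain m n where mn: "x \<in> carrier R" "y \<in> carrier R" "dvds x m" "dvds y n" using xy by (auto simp: J_def)
      then have h: "dvds x (max m n)" "dvds y (max m n)"
        using dvds_mono[of m "max m n" x] dvds_mono[of n "max m n" y] by auto
      have "dvds (x \<oplus> y) (max m n)" unfolding dvds_def
      proof
        fix p assume p: "p \<in> set_prods R S (max m n)"
        obtain c c' where c: "c \<in> carrier R" "x \<otimes> p = c \<otimes> d" "c' \<in> carrier R" "y \<otimes> p = c' \<otimes> d"
          using h p unfolding dvds_def by blast
        have "(x \<oplus> y) \<otimes> p = (c \<oplus> c') \<otimes> d" using c mn pc[OF p] d by (simp add: l_distr)
        then show "\<exists>c\<in>carrier R. (x \<oplus> y) \<otimes> p = c \<otimes> d" using c by blast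
      qed
      then show ?thesis using mn by (auto simp: J_def)
    qed
    show "r \<otimes> x \<in> J" if rx: "r \<in> carrier R" "x \<in> J" for r x
    proof -
      obtain m where m: "x \<in> carrier R" "dvds x m" using rx by (auto simp: J_def)
      have "dvds (r \<otimes> x) m" unfolding dvds_def
      proof
        fix p assume p: "p \<in> set_prods R S m"
        obtain c where c: "c \<in> carrier R" "x \<otimes> p = c \<otimes> d" using m p unfolding dvds_def by blast
        have "(r \<otimes> x) \<otimes> p = (r \<otimes> c) \<otimes> d" using c m rx(1) pc[OF p] d by (simp add: m_assoc)
        then show "\<exists>c\<in>carrier R. (r \<otimes> x) \<otimes> p = c \<otimes> d" using c rx by blast
      qed
      then show ?thesis using m rx by (auto simp: J_def)
    qed
  qed (auto simp: J_def)
  have "dvds d 0" using d by (auto simp: dvds_def intro!: bexI[of _ \<one>])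
  then have "d \<in> J" using d by (auto simp: J_def)
  then have J0: "J \<noteq> {\<zero>}" using d by auto
  have "\<not> J \<subseteq> P"
  proof
    assume "J \<subseteq> P"
    \<comment> \<open>With \<open>P\<close> written as the colon \<open>(J : r)\<close>, each
      \<open>b r\<close> with \<open>b\<close> in the finite set \<open>S\<close> has its own
      exponent. One more than the largest of them works for \<open>r\<close>, so \<open>r\<close> is
      in \<open>J\<close> and the colon contains \<open>1\<close>.\<close>
    then obtain r where r: "r \<in> carrier R" "{s \<in> carrier R. s \<otimes> r \<in> J} = P"
      by (rule prime_is_colon[OF idJ J0 P])
    have "\<exists>m. dvds (b \<otimes> r) m" if "b \<in> S" for b
      using r(2) that S(2) by (auto simp: J_def)
    then obtain f where f: "\<And>b. b \<in> S \<Longrightarrow> dvds (b \<otimes> r) (f b)" by metis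
    define m where "m = Max (f ` S)"
    have "dvds r (Suc m)" unfolding dvds_def
    proof
      fix p assume "p \<in> set_prods R S (Suc m)"
      then obtain a q where p: "p = a \<otimes> q" "a \<in> S" "q \<in> set_prods R S m" by auto
      have a: "a \<in> carrier R" using p Sc by auto
      have "f a \<le> m" unfolding m_def using p(2) S(1) by auto
      then have "dvds (a \<otimes> r) m" using dvds_mono f[OF p(2)] a r(1) by blast
      moreover have "r \<otimes> p = (a \<otimes> r) \<otimes> q" unfolding p(1) using r(1) a pc[OF p(3)] by (simp add: m_ac)
      ultimately show "\<exists>c\<in>carrier R. r \<otimes> p = c \<otimes> d" using p(3) unfolding dvds_def by auto
    qed
    then have "r \<in> J" using r(1) by (auto simp: J_def)
    then have "\<one> \<in> P" using r(1) by (subst r(2)[symmetric]) simp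
    then show False using primeideal_one_notin[OF P] by auto
  qed
  then obtain s m where "s \<in> carrier R - P" "dvds s m" by (auto simp: J_def)
  then show ?thesis using that[of s m] by (auto simp: dvds_def)
qed

end

section \<open>Noetherian modules and Ratliff stability\<close>

context module
begin

lemma submodule_cyclic:
  assumes "u \<in> carrier M"
  shows "submodule ((\<lambda>r. r \<bullet> u) ` carrier R) R M"
proof (rule submoduleI)
  show "\<zero>\<^bsub>M\<^esub> \<in> (\<lambda>r. r \<bullet> u) ` carrier R"
    by (rule image_eqI[of _ _ \<zero>]) (use assms in auto)
qed (use assms in \<open>auto simp flip: smult_l_distr smult_l_minus smult_assoc1\<close>)

text \<open>The coefficients at \<open>u\<close> of those elements of \<open>N\<close> that lie in
  \<open>R u + D\<close>. Together with the part of \<open>N\<close> inside \<open>D\<close> they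
  control \<open>N\<close> on \<open>R u + D\<close>.\<close>

lemma ideal_projection:
  assumes "submodule N R M" "submodule D R M" "u \<in> carrier M"
  shows "ideal {r \<in> carrier R. \<exists>y\<in>D. r \<bullet> u \<boxplus> y \<in> N} R"
proof (rule R.ideal_by_closure)
  note N = submoduleD[OF assms(1)] and D = submoduleD[OF assms(2)]
  show "\<zero> \<in> {r \<in> carrier R. \<exists>y\<in>D. r \<bullet> u \<boxplus> y \<in> N}"
    using N(2) D(2) assms(3) by (auto intro!: bexI[of _ "\<zero>\<^bsub>M\<^esub>"])
  show "r \<oplus> s \<in> {r \<in> carrier R. \<exists>y\<in>D. r \<bullet> u \<boxplus> y \<in> N}"
    if r: "r \<in> {r \<in> carrier R. \<exists>y\<in>D. r \<bullet> u \<boxplus> y \<in> N}"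
      and s: "s \<in> {r \<in> carrier R. \<exists>y\<in>D. r \<bullet> u \<boxplus> y \<in> N}" for r s
  proof -
    obtain y z where *: "r \<in> carrier R" "s \<in> carrier R" "y \<in> D" "z \<in> D"
      "r \<bullet> u \<boxplus> y \<in> N" "s \<bullet> u \<boxplus> z \<in> N" using r s by auto
    then have "(r \<oplus> s) \<bullet> u \<boxplus> (y \<boxplus> z) = (r \<bullet> u \<boxplus> y) \<boxplus> (s \<bullet> u \<boxplus> z)"
      using assms(3) D(1) by (simp add: smult_l_distr M.a_ac)
    then show ?thesis using * N(3) D(3) by (metis (mono_tags, lifting) R.a_closed mem_Collect_eq)
  qed
  show "s \<otimes> r \<in> {r \<in> carrier R. \<exists>y\<in>D. r \<bullet> u \<boxplus> y \<in> N}"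
    if s: "s \<in> carrier R" and r: "r \<in> {r \<in> carrier R. \<exists>y\<in>D. r \<bullet> u \<boxplus> y \<in> N}" for r s
  proof -
    obtain y where *: "r \<in> carrier R" "y \<in> D" "r \<bullet> u \<boxplus> y \<in> N" using r by auto
    then have "(s \<otimes> r) \<bullet> u \<boxplus> (s \<bullet> y) = s \<bullet> (r \<bullet> u \<boxplus> y)"
      using assms(3) D(1) s by (simp add: smult_r_distr smult_assoc1)
    then have "(s \<otimes> r) \<bullet> u \<boxplus> (s \<bullet> y) \<in> N" using N(6)[OF s *(3)] by simp
    then show ?thesis using *(1) s D(6)[OF s *(2)] by blast
  qed
qed auto

text \<open>The chain is fixed first and a submodule \<open>D\<close> on which it is stationary
  grows by one generator at a time. On \<open>R u + D\<close> an increasing chain is stationary as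
  soon as its traces on \<open>D\<close> and its coefficient ideals at \<open>u\<close> are.\<close>

lemma fin_gen_imp_noetherian:
  assumes "noetherian_ring R" "fin_gen_module R M"
  shows "noetherian_module R M"
  unfolding noetherian_module_def
proof (intro allI impI)
  interpret N: noetherian_ring R by fact
  fix N :: "nat \<Rightarrow> _" assume sN0: "\<forall>i. submodule (N i) R M" and inc0: "\<forall>i. N i \<subseteq> N (Suc i)"
  have sN: "submodule (N i) R M" for i using sN0 by simp
  have inc: "N i \<subseteq> N (Suc i)" for i using inc0 by simp
  have mono: "i \<le> j \<Longrightarrow> N i \<subseteq> N j" for i j
    by (rule lift_Suc_mono_le[of N]) (use inc in auto)
  obtain G where G: "finite G" "G \<subseteq> carrier M" "gen_submodule R M G = carrier M"
    using assms(2) unfolding fin_gen_module_def by blast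
  have "\<exists>D. submodule D R M \<and> G \<subseteq> D \<and> (\<exists>k. \<forall>i\<ge>k. N i \<inter> D = N k \<inter> D)"
    using G(1,2)
  proof (induction G rule: finite_induct)
    case empty
    have "\<forall>i\<ge>0. N i \<inter> {\<zero>\<^bsub>M\<^esub>} = N 0 \<inter> {\<zero>\<^bsub>M\<^esub>}" using submoduleD(2)[OF sN] by auto
    then show ?case using submodule_zero by blast
  next
    case (insert u G)
    then obtain D k where D: "submodule D R M" "G \<subseteq> D" "\<And>i. i \<ge> k \<Longrightarrow> N i \<inter> D = N k \<inter> D" by auto
    have u: "u \<in> carrier M" using insert by auto
    define A where "A i = {r \<in> carrier R. \<exists>y\<in>D. r \<bullet> u \<boxplus> y \<in> N i}" for i
    obtain k' where k': "\<And>i. i \<ge> k' \<Longrightarrow> A i = A k'"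
      using N.ideal_chain_stable[of A] ideal_projection[OF sN D(1) u] inc unfolding A_def by blast
    define Ru where "Ru = (\<lambda>r. r \<bullet> u) ` carrier R"
    have sRu: "submodule Ru R M" unfolding Ru_def by (rule submodule_cyclic[OF u])
    have "u \<in> Ru" unfolding Ru_def by (rule image_eqI[of _ _ \<one>]) (use u in auto)
    define D' where "D' = Ru \<uplus> D"
    have sD': "submodule D' R M" unfolding D'_def by (rule submodule_add[OF sRu D(1)])
    have "insert u G \<subseteq> D'"
      using set_add_upper1[OF sRu D(1) \<open>u \<in> Ru\<close>] set_add_upper2[OF sRu D(1)] D(2) unfolding D'_def by auto
    moreover have "N i \<inter> D' = N (max k k') \<inter> D'" if i: "i \<ge> max k k'" for i
    proof
      show "N (max k k') \<inter> D' \<subseteq> N i \<inter> D'" using mono[OF i] by auto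
      show "N i \<inter> D' \<subseteq> N (max k k') \<inter> D'"
      proof safe
        fix x assume x: "x \<in> N i" "x \<in> D'"
        then obtain r y where ry: "r \<in> carrier R" "y \<in> D" "x = r \<bullet> u \<boxplus> y"
          unfolding D'_def set_add_iff Ru_def by auto
        then have "r \<in> A i" using x by (auto simp: A_def)
        then have "r \<in> A (max k k')" using k'[of i] k'[of "max k k'"] i by auto
        then obtain z where z: "z \<in> D" "r \<bullet> u \<boxplus> z \<in> N (max k k')" by (auto simp: A_def)
        define w where "w = r \<bullet> u \<boxplus> z"
        have c: "r \<bullet> u \<in> carrier M" "y \<in> carrier M" "z \<in> carrier M" "x \<in> carrier M" "w \<in> carrier M"
          using ry u submoduleD(1)[OF D(1)] z x submoduleD(1)[OF sN] by (auto simp: w_def)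
        \<comment> \<open>Both \<open>x\<close> and \<open>w\<close> have coefficient
          \<open>r\<close> at \<open>u\<close>, so their difference lies in \<open>D\<close>, where
          the chain is already stationary.\<close>
        have "x \<ominus>\<^bsub>M\<^esub> w = y \<ominus>\<^bsub>M\<^esub> z"
        proof -
          have "x = w \<boxplus> (y \<ominus>\<^bsub>M\<^esub> z)"
          proof -
            have "w \<boxplus> (y \<ominus>\<^bsub>M\<^esub> z) = r \<bullet> u \<boxplus> (z \<boxplus> (y \<ominus>\<^bsub>M\<^esub> z))"
              unfolding w_def using c by (simp add: M.a_assoc)
            then show ?thesis using diff_add_self(1)[of y z] c ry by simp
          qed
          then show ?thesis using diff_add_self(3)[of "y \<ominus>\<^bsub>M\<^esub> z" w] c by simp
        qed
        moreover have "w \<in> N i" using z(2) mono[OF i] by (auto simp: w_def)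
        ultimately have "x \<ominus>\<^bsub>M\<^esub> w \<in> N i \<inter> D"
          using submoduleD(5)[OF sN x(1) \<open>w \<in> N i\<close>] submoduleD(5)[OF D(1) ry(2) z(1)] by simp
        then have "x \<ominus>\<^bsub>M\<^esub> w \<in> N (max k k')" using D(3)[of i] D(3)[of "max k k'"] i by auto
        then have "(x \<ominus>\<^bsub>M\<^esub> w) \<boxplus> w \<in> N (max k k')" using z(2) submoduleD(3)[OF sN] by (auto simp: w_def)
        then show "x \<in> N (max k k')" using diff_add_self(2)[of x w] c by simp
      qed
    qed
    ultimately show ?case using sD' by blast
  qed
  then obtain D k where D: "submodule D R M" "G \<subseteq> D" "\<And>i. i \<ge> k \<Longrightarrow> N i \<inter> D = N k \<inter> D" by auto
  have "carrier M \<subseteq> D" using gen_submodule_least[OF D(1,2)] G(3) by simp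
  then have "N i \<inter> D = N i" for i using submoduleD(1)[OF sN] by auto
  then show "\<exists>k. \<forall>i\<ge>k. N i = N k" using D(3) by auto
qed

lemma noetherian_module_maximal:
  assumes "noetherian_module R M" "F \<noteq> {}" "\<And>N. N \<in> F \<Longrightarrow> submodule N R M"
  obtains N where "N \<in> F" "\<And>N'. N' \<in> F \<Longrightarrow> N \<subseteq> N' \<Longrightarrow> N' = N"
proof -
  have "\<exists>N\<in>F. \<forall>N'\<in>F. N \<subseteq> N' \<longrightarrow> N' = N"
  proof (rule ccontr)
    assume "\<not> ?thesis"
    then have "\<forall>N\<in>F. \<exists>N'. N' \<in> F \<and> N \<subset> N'" by blast
    then obtain f where f: "\<And>N. N \<in> F \<Longrightarrow> f N \<in> F \<and> N \<subset> f N" by metis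
    obtain N0 where N0: "N0 \<in> F" using assms(2) by auto
    define N where "N i = (f ^^ i) N0" for i :: nat
    have NF: "N i \<in> F" for i by (induction i) (auto simp: N_def N0 f)
    have "N i \<subset> N (Suc i)" for i using f[OF NF[of i]] by (simp add: N_def)
    moreover from this obtain k where "\<forall>i\<ge>k. N i = N k"
      using assms(1)[unfolded noetherian_module_def, rule_format, of N] assms(3)[OF NF] by blast
    ultimately show False by (metis le_Suc_eq less_irrefl order_refl psubset_eq)
  qed
  then show ?thesis using that by blast
qed

section \<open>Products of generators, cancellation and colons in the adic filtration\<close>

lemma set_prods_smult_mem:
  assumes "S \<subseteq> carrier R" "p \<in> set_prods R S m" "x \<in> K n" "\<And>n. K n \<subseteq> carrier M"
    and "\<And>n b x. b \<in> S \<Longrightarrow> x \<in> K n \<Longrightarrow> b \<bullet> x \<in> K (Suc n)"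
  shows "p \<bullet> x \<in> K (n + m)"
  using assms(2)
proof (induction m arbitrary: p)
  case 0
  have "x \<in> carrier M" using assms(3,4) by blast
  then show ?case using 0 assms(3) by simp
next
  case (Suc m)
  then obtain a q where aq: "a \<in> S" "q \<in> set_prods R S m" "p = a \<otimes> q" by auto
  then have c: "a \<in> carrier R" "q \<in> carrier R" "x \<in> carrier M"
    using assms(1) subsetD[OF assms(4,3)] subsetD[OF R.set_prods_carrier[OF assms(1)] aq(2)] by auto
  show ?case using assms(5)[OF aq(1) Suc.IH[OF aq(2)]] aq(3) smult_assoc1[OF c] by simp
qed

text \<open>Reduces inclusions of powers to products of generators. The induction varies
  \<open>W\<close>, because splitting off one factor \<open>a\<close> replaces \<open>W\<close> by
  its colon with \<open>a\<close>.\<close>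

lemma set_pow_least:
  assumes S: "S \<subseteq> carrier R" and N: "submodule N R M"
    and "submodule W R M" "\<And>p x. p \<in> set_prods R S m \<Longrightarrow> x \<in> N \<Longrightarrow> p \<bullet> x \<in> W"
  shows "set_pow_smult R M S m N \<subseteq> W"
  using assms(3,4)
proof (induction m arbitrary: W)
  case 0
  have "x \<in> W" if "x \<in> N" for x using 0(2)[of \<one> x] that submoduleD(1)[OF N that] by simp
  then show ?case by auto
next
  case (Suc m)
  have "set_smult R M S (set_pow_smult R M S m N) \<subseteq> W"
  proof (rule set_smult_least[OF Suc.prems(1)])
    fix a x assume a: "a \<in> S" and x: "x \<in> set_pow_smult R M S m N"
    have ac: "a \<in> carrier R" using a S by auto
    have "set_pow_smult R M S m N \<subseteq> {x \<in> carrier M. a \<bullet> x \<in> W}"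
    proof (rule Suc.IH[OF submodule_colon[OF Suc.prems(1) ac]])
      fix p y assume p: "p \<in> set_prods R S m" and y: "y \<in> N"
      have c: "p \<in> carrier R" "y \<in> carrier M" using p y submoduleD(1)[OF N] R.set_prods_carrier[OF S] by auto
      have "(a \<otimes> p) \<bullet> y \<in> W" by (rule Suc.prems(2)) (use a p y in auto)
      then show "p \<bullet> y \<in> {x \<in> carrier M. a \<bullet> x \<in> W}"
        using c ac smult_assoc1[OF ac c] by auto
    qed
    then show "a \<bullet> x \<in> W" using x by auto
  qed
  then show ?case by simp
qed

lemma submodule_colon_set:
  assumes "submodule N R M" "S \<subseteq> carrier R"
  shows "submodule {x \<in> carrier M. \<forall>b\<in>S. b \<bullet> x \<in> N} R M"
proof -
  have "{x \<in> carrier M. \<forall>b\<in>S. b \<bullet> x \<in> N} = \<Inter>(insert (carrier M) ((\<lambda>b. {x \<in> carrier M. b \<bullet> x \<in> N}) ` S))"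
    by auto
  also have "submodule \<dots> R M"
    by (rule submodule_Inter) (use assms carrier_is_submodule submodule_colon[OF assms(1)] in auto)
  finally show ?thesis .
qed

lemma smult_set_pow_add:
  assumes "S \<subseteq> carrier R" "submodule T R M" "b \<in> S" "x \<in> adic S n \<uplus> T"
  shows "b \<bullet> x \<in> adic S (Suc n) \<uplus> T"
proof -
  have b: "b \<in> carrier R" using assms by auto
  show ?thesis
    by (rule smult_set_add[OF b submodule_set_pow[OF carrier_is_submodule assms(1)] assms(2,4)])
       (use assms(3) submoduleD(6)[OF assms(2) b] in \<open>auto intro: set_smult_incl\<close>)
qed

lemma set_pow_add_antimono:
  assumes "S \<subseteq> carrier R" "m \<le> n" "T \<subseteq> T'"
  shows "adic S n \<uplus> T \<subseteq> adic S m \<uplus> T'"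
  using set_pow_antimono[OF carrier_is_submodule assms(1,2)] assms(3)
  unfolding set_add_iff subset_iff by blast

text \<open>Artin--Rees for the submodule \<open>a M\<close> of \<open>M/T\<close>.\<close>
lemma cancel_nonzerodivisor:
  assumes noeth: "noetherian_module R M" and S: "finite S" "S \<subseteq> carrier R" and sT: "submodule T R M"
    and a: "a \<in> carrier R" and aT: "\<And>x. x \<in> carrier M \<Longrightarrow> a \<bullet> x \<in> T \<Longrightarrow> x \<in> T"
  obtains c where "\<And>m x. x \<in> carrier M \<Longrightarrow> a \<bullet> x \<in> adic S (c + m) \<uplus> T
     \<Longrightarrow> x \<in> adic S m \<uplus> T"
proof -
  define pw where "pw n = adic S n" for n
  have spw: "submodule (pw n) R M" for n
    unfolding pw_def by (rule submodule_set_pow[OF carrier_is_submodule S(2)])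
  have sI: "submodule ((\<lambda>x. a \<bullet> x) ` pw m) R M" for m by (rule submodule_scaled[OF spw a])
  \<comment> \<open>The part of the adic filtration modulo \<open>T\<close> that consists of
    multiples of \<open>a\<close>. From degree \<open>c\<close> on it is generated by its degree
    \<open>c\<close>, so \<open>m\<close> further degrees put \<open>m\<close> factors from
    \<open>S\<close> onto the cofactor of \<open>a\<close>. Since \<open>pw 0\<close> is the whole
    module, this holds for \<open>m = 0\<close> by definition.\<close>
  define L where "L n = (pw n \<uplus> T) \<inter> (((\<lambda>x. a \<bullet> x) ` pw 0) \<uplus> T)" for n
  have sL: "submodule (L n) R M" for n
    unfolding L_def by (intro submodule_Int submodule_add spw sI sT)
  have "\<exists>c. \<forall>n\<ge>c. L (Suc n) \<subseteq> set_smult R M S (L n) \<uplus> T"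
  proof (rule graded_submodule_stable[OF noeth S sT sL])
    show "T \<subseteq> L n" for n
      unfolding L_def using set_add_upper2[OF spw sT] set_add_upper2[OF sI sT] by auto
    show "L n \<subseteq> adic S n \<uplus> T" for n
      by (auto simp: L_def pw_def)
    show "set_smult R M S (L n) \<subseteq> L (Suc n)" for n
    proof (rule set_smult_least[OF sL])
      fix r x assume r: "r \<in> S" and x: "x \<in> L n"
      have "r \<bullet> x \<in> pw (Suc n) \<uplus> T"
        using smult_set_pow_add[OF S(2) sT r, of x n] x by (auto simp: L_def pw_def)
      moreover have "r \<bullet> x \<in> ((\<lambda>x. a \<bullet> x) ` pw 0) \<uplus> T"
        using submoduleD(6)[OF submodule_add[OF sI sT], of r x] x r S(2) by (auto simp: L_def)
      ultimately show "r \<bullet> x \<in> L (Suc n)" by (simp add: L_def)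
    qed
  qed
  then obtain c where c: "\<And>n. n \<ge> c \<Longrightarrow> L (Suc n) \<subseteq> set_smult R M S (L n) \<uplus> T" by blast
  have Lc: "L (c + m) \<subseteq> ((\<lambda>x. a \<bullet> x) ` pw m) \<uplus> T" for m
  proof (induction m)
    case 0
    then show ?case by (auto simp: L_def)
  next
    case (Suc m)
    have sE: "submodule (((\<lambda>x. a \<bullet> x) ` pw (Suc m)) \<uplus> T) R M" by (rule submodule_add[OF sI sT])
    have "set_smult R M S (L (c + m)) \<uplus> T \<subseteq> ((\<lambda>x. a \<bullet> x) ` pw (Suc m)) \<uplus> T"
    proof (rule set_add_least[OF sE])
      show "T \<subseteq> ((\<lambda>x. a \<bullet> x) ` pw (Suc m)) \<uplus> T" using set_add_upper2[OF sI sT] by auto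
      show "set_smult R M S (L (c + m)) \<subseteq> ((\<lambda>x. a \<bullet> x) ` pw (Suc m)) \<uplus> T"
      proof (rule set_smult_least[OF sE])
        fix r x assume r: "r \<in> S" and x: "x \<in> L (c + m)"
        have rc: "r \<in> carrier R" using r S by auto
        have x': "x \<in> ((\<lambda>x. a \<bullet> x) ` pw m) \<uplus> T" using x Suc by blast
        show "r \<bullet> x \<in> ((\<lambda>x. a \<bullet> x) ` pw (Suc m)) \<uplus> T"
        proof (rule smult_set_add[OF rc sI sT x' _ submoduleD(6)[OF sT rc]])
          fix z assume "z \<in> (\<lambda>x. a \<bullet> x) ` pw m"
          then obtain y where y: "y \<in> pw m" "z = a \<bullet> y" by blast
          have "r \<bullet> y \<in> pw (Suc m)" using set_smult_incl[OF r y(1)] by (simp add: pw_def)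
          then show "r \<bullet> z \<in> (\<lambda>x. a \<bullet> x) ` pw (Suc m)"
            using smult_commute[OF rc a submoduleD(1)[OF spw y(1)]] y(2) by blast
        qed
      qed
    qed
    then show ?case using c[of "c + m"] by auto
  qed
  show ?thesis
  proof (rule that[of c])
    fix m x assume x: "x \<in> carrier M" and ax: "a \<bullet> x \<in> adic S (c + m) \<uplus> T"
    have "a \<bullet> x \<in> ((\<lambda>x. a \<bullet> x) ` pw 0) \<uplus> T"
      by (rule set_add_upper1[OF sI sT]) (use x in \<open>auto simp: pw_def\<close>)
    then have "a \<bullet> x \<in> L (c + m)" using ax by (simp add: L_def pw_def)
    then have "a \<bullet> x \<in> ((\<lambda>x. a \<bullet> x) ` pw m) \<uplus> T" using Lc[of m] by blast
    then obtain y t where yt: "y \<in> pw m" "t \<in> T" "a \<bullet> x = a \<bullet> y \<boxplus> t"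
      by (auto simp: set_add_iff)
    have yc: "y \<in> carrier M" "t \<in> carrier M" using yt submoduleD(1)[OF spw] submoduleD(1)[OF sT] by auto
    have "a \<bullet> (x \<ominus>\<^bsub>M\<^esub> y) = t"
      using yt(3) smult_minus_distr[OF a x yc(1)] diff_add_self(3)[of t "a \<bullet> y"] yc a by simp
    then have "x \<ominus>\<^bsub>M\<^esub> y \<in> T" using aT[of "x \<ominus>\<^bsub>M\<^esub> y"] x yc yt(2) by simp
    moreover have "x = y \<boxplus> (x \<ominus>\<^bsub>M\<^esub> y)" using diff_add_self(1)[OF x yc(1)] by simp
    ultimately show "x \<in> adic S m \<uplus> T"
      using yt(1) unfolding set_add_iff pw_def by blast
  qed
qed

text \<open>Ratliff's theorem that \<open>(I\<^sup>n\<^sup>+\<^sup>1 : I) = I\<^sup>n\<close> for large \<open>n\<close>, for the module \<open>M/T\<close>.\<close>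
lemma colon_set_pow_stable:
  assumes noeth: "noetherian_module R M" and S: "finite S" "S \<subseteq> carrier R" and sT: "submodule T R M"
    and a: "a \<in> S" and aT: "\<And>x. x \<in> carrier M \<Longrightarrow> a \<bullet> x \<in> T \<Longrightarrow> x \<in> T"
  obtains N where "\<And>n x. n \<ge> N \<Longrightarrow> x \<in> carrier M \<Longrightarrow>
     (\<And>b. b \<in> S \<Longrightarrow> b \<bullet> x \<in> adic S (Suc n) \<uplus> T) \<Longrightarrow>
     x \<in> adic S n \<uplus> T"
proof -
  have ac: "a \<in> carrier R" using a S by auto
  define pT where "pT n = adic S n \<uplus> T" for n
  have spw: "submodule (adic S n) R M" for n
    by (rule submodule_set_pow[OF carrier_is_submodule S(2)])
  have spT: "submodule (pT n) R M" for n unfolding pT_def by (rule submodule_add[OF spw sT])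
  have TpT: "T \<subseteq> pT n" for n unfolding pT_def using set_add_upper2[OF spw sT] by auto
  have mul: "r \<bullet> x \<in> pT (Suc n)" if "r \<in> S" "x \<in> pT n" for r x n
    using smult_set_pow_add[OF S(2) sT that(1)] that(2) by (simp add: pT_def)
  obtain c where c: "\<And>m x. x \<in> carrier M \<Longrightarrow> a \<bullet> x \<in> pT (c + m) \<Longrightarrow> x \<in> pT m"
    using cancel_nonzerodivisor[OF noeth S sT ac aT] unfolding pT_def by blast
  \<comment> \<open>Cancelling \<open>a\<close> loses \<open>c\<close> degrees, so the colon is
    shifted by \<open>c\<close> in order to be a graded part of the adic filtration. The gain is
    that \<open>S\<close> carries \<open>L n\<close> into \<open>pT (Suc (n + c))\<close> by
    definition, so stability of \<open>L\<close> recovers exactly the lost degrees.\<close>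
  define L where "L n = pT n \<inter> {x \<in> carrier M. \<forall>b\<in>S. b \<bullet> x \<in> pT (Suc (n + c))}" for n
  have sL: "submodule (L n) R M" for n
    unfolding L_def by (intro submodule_Int submodule_colon_set spT S)
  have "\<exists>c. \<forall>n\<ge>c. L (Suc n) \<subseteq> set_smult R M S (L n) \<uplus> T"
  proof (rule graded_submodule_stable[OF noeth S sT sL])
    show "T \<subseteq> L n" for n
    proof
      fix t assume t: "t \<in> T"
      have "b \<bullet> t \<in> pT m" if "b \<in> S" for b m
        using submoduleD(6)[OF sT, of b t] t S that TpT by auto
      then show "t \<in> L n" using t TpT submoduleD(1)[OF sT t] by (auto simp: L_def)
    qed
    show "L n \<subseteq> adic S n \<uplus> T" for n
      by (auto simp: L_def pT_def)
    show "set_smult R M S (L n) \<subseteq> L (Suc n)" for n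
    proof (rule set_smult_least[OF sL])
      fix r x assume r: "r \<in> S" and x: "x \<in> L n"
      have rc: "r \<in> carrier R" using r S by auto
      have xc: "x \<in> carrier M" using x by (auto simp: L_def)
      have "b \<bullet> (r \<bullet> x) \<in> pT (Suc (Suc n + c))" if b: "b \<in> S" for b
      proof -
        have "b \<bullet> (r \<bullet> x) = r \<bullet> (b \<bullet> x)" using b S rc xc by (intro smult_commute) auto
        then show ?thesis using mul[OF r, of "b \<bullet> x" "Suc (n + c)"] x b by (simp add: L_def)
      qed
      then show "r \<bullet> x \<in> L (Suc n)" using mul[OF r] x rc by (simp add: L_def)
    qed
  qed
  then obtain N where N: "\<And>n. n \<ge> N \<Longrightarrow> L (Suc n) \<subseteq> set_smult R M S (L n) \<uplus> T" by blast
  have LN: "L (Suc n) \<subseteq> pT (Suc (n + c))" if n: "n \<ge> N" for n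
  proof -
    have "set_smult R M S (L n) \<subseteq> pT (Suc (n + c))"
      by (rule set_smult_least[OF spT]) (auto simp: L_def)
    then have "set_smult R M S (L n) \<uplus> T \<subseteq> pT (Suc (n + c))"
      by (rule set_add_least[OF spT _ TpT])
    then show ?thesis using N[OF n] by auto
  qed
  show ?thesis
  proof (rule that[of "Suc (N + c)", folded pT_def])
    fix n x assume n: "n \<ge> Suc (N + c)" and x: "x \<in> carrier M" and Sx: "\<And>b. b \<in> S \<Longrightarrow> b \<bullet> x \<in> pT (Suc n)"
    \<comment> \<open>Chosen with \<open>n = Suc k + c\<close>, so that the hypothesis on
      \<open>x\<close> is the colon condition of \<open>L (Suc k)\<close>.\<close>
    define k where "k = n - Suc c"
    have k: "n = Suc (k + c)" "k \<ge> N" using n by (auto simp: k_def)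
    have "x \<in> pT (Suc (Suc k))" using c[OF x, of "Suc (Suc k)"] Sx[OF a] k by (simp add: add.commute)
    then have "x \<in> pT (Suc k)" using set_pow_add_antimono[OF S(2), of "Suc k" "Suc (Suc k)" T T] by (auto simp: pT_def)
    then have "x \<in> L (Suc k)" using x Sx k by (simp add: L_def)
    then show "x \<in> pT n" using LN[OF k(2)] k by auto
  qed
qed

text \<open>The factors of a product are removed one at a time. The same \<open>N\<close> serves for
  every \<open>m\<close> because the degree only rises during the induction.\<close>

lemma colon_set_prods_stable:
  assumes noeth: "noetherian_module R M" and S: "finite S" "S \<subseteq> carrier R" and sT: "submodule T R M"
    and a: "a \<in> S" and aT: "\<And>x. x \<in> carrier M \<Longrightarrow> a \<bullet> x \<in> T \<Longrightarrow> x \<in> T"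
  obtains N where "\<And>n m x. n \<ge> N \<Longrightarrow> x \<in> carrier M \<Longrightarrow>
     (\<And>p. p \<in> set_prods R S m \<Longrightarrow> p \<bullet> x \<in> adic S (n + m) \<uplus> T) \<Longrightarrow>
     x \<in> adic S n \<uplus> T"
proof -
  obtain N where N: "\<And>n x. n \<ge> N \<Longrightarrow> x \<in> carrier M \<Longrightarrow>
     (\<And>b. b \<in> S \<Longrightarrow> b \<bullet> x \<in> adic S (Suc n) \<uplus> T) \<Longrightarrow>
     x \<in> adic S n \<uplus> T"
    by (rule colon_set_pow_stable[OF noeth S sT a aT]) blast+
  show ?thesis
  proof (rule that[of N])
    fix n m x
    show "n \<ge> N \<Longrightarrow> x \<in> carrier M \<Longrightarrow>
     (\<And>p. p \<in> set_prods R S m \<Longrightarrow> p \<bullet> x \<in> adic S (n + m) \<uplus> T) \<Longrightarrow>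
     x \<in> adic S n \<uplus> T"
    proof (induction m arbitrary: n x)
      case 0
      then show ?case using 0(3)[of \<one>] by simp
    next
      case (Suc m)
      show ?case
      proof (rule N[OF Suc.prems(1,2)])
        fix b assume b: "b \<in> S"
        then have bc: "b \<in> carrier R" using S by auto
        show "b \<bullet> x \<in> adic S (Suc n) \<uplus> T"
        proof (rule Suc.IH)
          show "Suc n \<ge> N" "b \<bullet> x \<in> carrier M" using Suc.prems bc by auto
          fix p assume p: "p \<in> set_prods R S m"
          then have pc: "p \<in> carrier R" using R.set_prods_carrier[OF S(2)] by auto
          have "b \<otimes> p \<in> set_prods R S (Suc m)" using b p by auto
          from Suc.prems(3)[OF this] have "(p \<otimes> b) \<bullet> x \<in> adic S (n + Suc m) \<uplus> T"
            using R.m_comm[OF bc pc] by simp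
          then show "p \<bullet> (b \<bullet> x) \<in> adic S (Suc n + m) \<uplus> T"
            using smult_assoc1[OF pc bc Suc.prems(2)] by simp
        qed
      qed
    qed
  qed
qed

end

section \<open>Local comparison of filtrations\<close>

context module
begin

text \<open>\<open>T\<close> is the preimage of the torsion of \<open>M/V\<close>. Every nonzero
  scalar is a nonzerodivisor modulo it, as the cancellation lemmas require.\<close>

lemma torsion_submodule:
  assumes "domain R" "submodule V R M"
  defines "T \<equiv> {x \<in> carrier M. \<exists>s\<in>carrier R. s \<noteq> \<zero> \<and> s \<bullet> x \<in> V}"
  shows "submodule T R M" "V \<subseteq> T" "\<And>a x. a \<in> carrier R \<Longrightarrow> a \<noteq> \<zero> \<Longrightarrow> x \<in> carrier M \<Longrightarrow> a \<bullet> x \<in> T \<Longrightarrow> x \<in> T"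
proof -
  interpret domain R by fact
  note V = submoduleD[OF assms(2)]
  have nz: "s \<otimes> t \<in> carrier R \<and> s \<otimes> t \<noteq> \<zero>" if "s \<in> carrier R" "t \<in> carrier R" "s \<noteq> \<zero>" "t \<noteq> \<zero>" for s t
    using that integral[of s t] by auto
  show VT: "V \<subseteq> T" using V(1) by (auto simp: T_def intro!: bexI[of _ \<one>])
  show "submodule T R M"
  proof (rule submoduleI)
    show "T \<subseteq> carrier M" by (auto simp: T_def)
    show "\<zero>\<^bsub>M\<^esub> \<in> T" using V(2) VT by auto
    show "\<ominus>\<^bsub>M\<^esub> x \<in> T" if "x \<in> T" for x
      using that V(4) by (auto simp: T_def smult_r_minus)
    show "x \<boxplus> y \<in> T" if xy: "x \<in> T" "y \<in> T" for x y
    proof -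
      obtain s t where st: "s \<in> carrier R" "s \<noteq> \<zero>" "s \<bullet> x \<in> V" "t \<in> carrier R" "t \<noteq> \<zero>" "t \<bullet> y \<in> V"
        and c: "x \<in> carrier M" "y \<in> carrier M"
        using xy by (auto simp: T_def)
      have "(s \<otimes> t) \<bullet> (x \<boxplus> y) = (t \<otimes> s) \<bullet> x \<boxplus> (s \<otimes> t) \<bullet> y"
        using st c by (simp add: smult_r_distr R.m_comm)
      also have "\<dots> = t \<bullet> (s \<bullet> x) \<boxplus> s \<bullet> (t \<bullet> y)"
        using st c by (simp add: smult_assoc1)
      also have "\<dots> \<in> V" by (rule V(3)[OF V(6)[OF st(4,3)] V(6)[OF st(1,6)]])
      finally show ?thesis using nz[OF st(1,4,2,5)] c by (auto simp: T_def)
    qed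
    show "r \<bullet> x \<in> T" if r: "r \<in> carrier R" and x: "x \<in> T" for r x
    proof -
      obtain s where s: "s \<in> carrier R" "s \<noteq> \<zero>" "s \<bullet> x \<in> V" and c: "x \<in> carrier M" using x by (auto simp: T_def)
      have "s \<bullet> (r \<bullet> x) \<in> V" using smult_commute[OF s(1) r c] V(6)[OF r s(3)] by simp
      then show ?thesis using s r c by (auto simp: T_def)
    qed
  qed
  show "x \<in> T" if a: "a \<in> carrier R" "a \<noteq> \<zero>" and x: "x \<in> carrier M" and ax: "a \<bullet> x \<in> T" for a x
  proof -
    obtain s where s: "s \<in> carrier R" "s \<noteq> \<zero>" "s \<bullet> (a \<bullet> x) \<in> V" using ax by (auto simp: T_def)
    then have "(s \<otimes> a) \<bullet> x \<in> V" using smult_assoc1[OF s(1) a(1) x] by simp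
    then show ?thesis using nz[OF s(1) a(1) s(2) a(2)] x by (auto simp: T_def)
  qed
qed

text \<open>Both \<open>(V : d)\<close> and \<open>(V : s)\<close> lie in \<open>(V : d s)\<close>,
  and \<open>d s\<close> is again nonzero. So a maximal colon by a nonzero scalar contains all the
  others and hence the whole torsion.\<close>

lemma torsion_bounded:
  assumes "domain R" "noetherian_module R M" "submodule V R M"
  obtains d where "d \<in> carrier R" "d \<noteq> \<zero>"
    "\<And>x s. x \<in> carrier M \<Longrightarrow> s \<in> carrier R \<Longrightarrow> s \<noteq> \<zero> \<Longrightarrow> s \<bullet> x \<in> V \<Longrightarrow> d \<bullet> x \<in> V"
proof -
  interpret domain R by fact
  note V = submoduleD[OF assms(3)]
  define A where "A d = {x \<in> carrier M. d \<bullet> x \<in> V}" for d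
  have ne: "A ` (carrier R - {\<zero>}) \<noteq> {}" using R.one_closed one_not_zero by blast
  obtain N where N: "N \<in> A ` (carrier R - {\<zero>})" "\<And>N'. N' \<in> A ` (carrier R - {\<zero>}) \<Longrightarrow> N \<subseteq> N' \<Longrightarrow> N' = N"
    by (rule noetherian_module_maximal[OF assms(2) ne]) (auto simp: A_def intro: submodule_colon[OF assms(3)])
  then obtain d where d: "d \<in> carrier R" "d \<noteq> \<zero>" "N = A d" by auto
  show ?thesis
  proof (rule that[OF d(1,2)])
    fix x s assume x: "x \<in> carrier M" and s: "s \<in> carrier R" "s \<noteq> \<zero>" and sx: "s \<bullet> x \<in> V"
    have "A d \<subseteq> A (d \<otimes> s)"
    proof
      fix y assume "y \<in> A d"
      then have y: "y \<in> carrier M" "d \<bullet> y \<in> V" by (auto simp: A_def)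
      have "(d \<otimes> s) \<bullet> y = s \<bullet> (d \<bullet> y)"
        using smult_assoc1[OF d(1) s(1) y(1)] smult_commute[OF d(1) s(1) y(1)] by simp
      then show "y \<in> A (d \<otimes> s)" using y V(6)[OF s(1) y(2)] by (simp add: A_def)
    qed
    moreover have "d \<otimes> s \<in> carrier R - {\<zero>}" using d s integral[of d s] by auto
    ultimately have "A (d \<otimes> s) = A d" using N(2)[of "A (d \<otimes> s)"] d(3) by blast
    moreover have "x \<in> A (d \<otimes> s)"
      using x smult_assoc1[OF d(1) s(1) x] V(6)[OF d(1) sx] by (simp add: A_def)
    ultimately show "d \<bullet> x \<in> V" by (auto simp: A_def)
  qed
qed

text \<open>By Artin--Rees the torsion part of \<open>I^k M + V\<close> lies in
  \<open>I^m T + V\<close> for \<open>k \<ge> c + m\<close>. One nonzero \<open>d\<close> carries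
  \<open>T\<close> into \<open>V\<close>, and \<open>m\<close> is chosen so that \<open>I^m\<close>
  lies in \<open>(d)\<close> locally at \<open>P\<close>; then \<open>I^m T\<close> lies in
  \<open>V\<close> locally.\<close>

lemma torsion_locally_trivial:
  assumes "one_dim_noetherian_domain R" and noeth: "noetherian_module R M" and sV: "submodule V R M"
    and S: "finite S" "S \<subseteq> P" and P: "primeideal P R"
  obtains N where "\<And>k x t. k \<ge> N \<Longrightarrow> x \<in> adic S k \<uplus> V \<Longrightarrow>
      t \<in> carrier R \<Longrightarrow> t \<noteq> \<zero> \<Longrightarrow> t \<bullet> x \<in> V \<Longrightarrow> \<exists>s\<in>carrier R - P. s \<bullet> x \<in> V"
proof -
  interpret one_dim_noetherian_domain R by fact
  interpret P: primeideal P R by fact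
  have Sc: "S \<subseteq> carrier R" using S P.a_subset by auto
  define T where "T = {x \<in> carrier M. \<exists>s\<in>carrier R. s \<noteq> \<zero> \<and> s \<bullet> x \<in> V}"
  note T = torsion_submodule[OF domain_axioms sV, folded T_def]
  note sT = T(1)
  have spw: "submodule (set_pow_smult R M S n N) R M" if "submodule N R M" for n N
    by (rule submodule_set_pow[OF that Sc])
  note spwc = spw[OF carrier_is_submodule] and spwT = spw[OF sT]
  define L where "L n = (adic S n \<uplus> V) \<inter> T" for n
  have sL: "submodule (L n) R M" for n
    unfolding L_def by (intro submodule_Int submodule_add spwc sV sT)
  have "\<exists>c. \<forall>n\<ge>c. L (Suc n) \<subseteq> set_smult R M S (L n) \<uplus> V"
  proof (rule graded_submodule_stable[OF noeth S(1) Sc sV sL])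
    show "V \<subseteq> L n" for n using T(2) set_add_upper2[OF spwc sV] by (auto simp: L_def)
    show "L n \<subseteq> adic S n \<uplus> V" for n by (auto simp: L_def)
    show "set_smult R M S (L n) \<subseteq> L (Suc n)" for n
    proof (rule set_smult_least[OF sL])
      fix r x assume r: "r \<in> S" and x: "x \<in> L n"
      have rc: "r \<in> carrier R" using r Sc by auto
      show "r \<bullet> x \<in> L (Suc n)"
        using smult_set_pow_add[OF Sc sV r, of x n] x submoduleD(6)[OF sT rc, of x] by (simp add: L_def)
    qed
  qed
  then obtain c where c: "\<And>n. n \<ge> c \<Longrightarrow> L (Suc n) \<subseteq> set_smult R M S (L n) \<uplus> V" by blast
  have Lc: "L (c + m) \<subseteq> set_pow_smult R M S m T \<uplus> V" for m
  proof (induction m)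
    case 0
    show ?case using set_add_upper1[OF sT sV] by (auto simp: L_def)
  next
    case (Suc m)
    have sE: "submodule (set_pow_smult R M S (Suc m) T \<uplus> V) R M" by (rule submodule_add[OF spwT sV])
    have "set_smult R M S (L (c + m)) \<uplus> V \<subseteq> set_pow_smult R M S (Suc m) T \<uplus> V"
    proof (rule set_add_least[OF sE])
      show "V \<subseteq> set_pow_smult R M S (Suc m) T \<uplus> V" using set_add_upper2[OF spwT sV] by blast
      show "set_smult R M S (L (c + m)) \<subseteq> set_pow_smult R M S (Suc m) T \<uplus> V"
      proof (rule set_smult_least[OF sE])
        fix r x assume r: "r \<in> S" and x: "x \<in> L (c + m)"
        have rc: "r \<in> carrier R" using r Sc by auto
        have x': "x \<in> set_pow_smult R M S m T \<uplus> V" using x Suc by blast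
        show "r \<bullet> x \<in> set_pow_smult R M S (Suc m) T \<uplus> V"
          by (rule smult_set_add[OF rc spwT sV x' _ submoduleD(6)[OF sV rc]]) (use r in \<open>auto intro: set_smult_incl\<close>)
      qed
    qed
    then show ?case using c[of "c + m"] by auto
  qed
  obtain d where d: "d \<in> carrier R" "d \<noteq> \<zero>"
    "\<And>x s. x \<in> carrier M \<Longrightarrow> s \<in> carrier R \<Longrightarrow> s \<noteq> \<zero> \<Longrightarrow> s \<bullet> x \<in> V \<Longrightarrow> d \<bullet> x \<in> V"
    by (rule torsion_bounded[OF domain_axioms noeth sV]) blast
  obtain s m where s: "s \<in> carrier R - P" "\<And>p. p \<in> set_prods R S m \<Longrightarrow> \<exists>c\<in>carrier R. s \<otimes> p = c \<otimes> d"
    by (rule local_power_in_principal[OF S P d(1,2)]) blast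
  have sc: "s \<in> carrier R" using s by auto
  have sW: "submodule {x \<in> carrier M. s \<bullet> x \<in> V} R M" by (rule submodule_colon[OF sV sc])
  have "set_pow_smult R M S m T \<subseteq> {x \<in> carrier M. s \<bullet> x \<in> V}"
  proof (rule set_pow_least[OF Sc sT sW])
    fix p x assume p: "p \<in> set_prods R S m" and x: "x \<in> T"
    have pc: "p \<in> carrier R" using p set_prods_carrier[OF Sc] by blast
    have xc: "x \<in> carrier M" and dx: "d \<bullet> x \<in> V" using x d(3) by (auto simp: T_def)
    obtain e where e: "e \<in> carrier R" "s \<otimes> p = e \<otimes> d" using s(2)[OF p] by blast
    have "s \<bullet> (p \<bullet> x) = e \<bullet> (d \<bullet> x)"
      using smult_assoc1[OF sc pc xc] smult_assoc1[OF e(1) d(1) xc] e(2) by simp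
    then show "p \<bullet> x \<in> {x \<in> carrier M. s \<bullet> x \<in> V}" using submoduleD(6)[OF sV e(1) dx] pc xc by simp
  qed
  moreover have "V \<subseteq> {x \<in> carrier M. s \<bullet> x \<in> V}" using submoduleD(1,6)[OF sV] sc by auto
  ultimately have "set_pow_smult R M S m T \<uplus> V \<subseteq> {x \<in> carrier M. s \<bullet> x \<in> V}"
    by (rule set_add_least[OF sW])
  then have fin: "L (c + m) \<subseteq> {x \<in> carrier M. s \<bullet> x \<in> V}" using Lc[of m] by blast
  show ?thesis
  proof (rule that[of "c + m"])
    fix k x t assume k: "k \<ge> c + m" and x: "x \<in> adic S k \<uplus> V"
      and t: "t \<in> carrier R" "t \<noteq> \<zero>" "t \<bullet> x \<in> V"
    have "x \<in> carrier M" using x submoduleD(1)[OF submodule_add[OF spwc sV]] by blast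
    then have "x \<in> T" using t by (auto simp: T_def)
    moreover have "x \<in> adic S (c + m) \<uplus> V"
      using x set_pow_add_antimono[OF Sc k, of V V] by blast
    ultimately have "x \<in> L (c + m)" by (simp add: L_def)
    then show "\<exists>s\<in>carrier R - P. s \<bullet> x \<in> V" using fin s(1) by blast
  qed
qed

text \<open>For \<open>x \<in> K\<^sub>n\<close> and a later good index \<open>k\<close>, \<open>I\<^sup>k\<^sup>-\<^sup>n x \<subseteq> K\<^sub>k = V + I\<^sup>k M\<close> locally, so \<open>x\<close> lies in \<open>I\<^sup>n M\<close> up
  to torsion; the torsion part of \<open>K\<^sub>n\<close> vanishes by comparison with a fixed earlier good index.\<close>
lemma locally_equal_eventually:
  assumes dim: "one_dim_noetherian_domain R" and noeth: "noetherian_module R M" and sV: "submodule V R M"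
    and S: "finite S" "S \<subseteq> P" and a: "a \<in> S" "a \<noteq> \<zero>" and P: "primeideal P R"
    and sK: "\<And>n. submodule (K n) R M" and Kdec: "\<And>n. K (Suc n) \<subseteq> K n"
    and Kmul: "\<And>n b x. b \<in> S \<Longrightarrow> x \<in> K n \<Longrightarrow> b \<bullet> x \<in> K (Suc n)"
    and Kpow: "\<And>n. adic S n \<uplus> V \<subseteq> K n"
    and inf: "\<And>n. \<exists>k\<ge>n. \<forall>x\<in>K k. \<exists>s\<in>carrier R - P. s \<bullet> x \<in> adic S k \<uplus> V"
  obtains N where "\<And>n x. n \<ge> N \<Longrightarrow> x \<in> K n \<Longrightarrow>
      \<exists>s\<in>carrier R - P. s \<bullet> x \<in> adic S n \<uplus> V"
proof -
  interpret one_dim_noetherian_domain R by fact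
  interpret P: primeideal P R by fact
  have Sc: "S \<subseteq> carrier R" using S P.a_subset by auto
  have ac: "a \<in> carrier R" using a Sc by auto
  define T where "T = {x \<in> carrier M. \<exists>s\<in>carrier R. s \<noteq> \<zero> \<and> s \<bullet> x \<in> V}"
  note T = torsion_submodule[OF domain_axioms sV, folded T_def]
  note sT = T(1)
  define pw where "pw n = adic S n" for n
  have spw: "submodule (pw n) R M" for n unfolding pw_def by (rule submodule_set_pow[OF carrier_is_submodule Sc])
  have spV: "submodule (pw n \<uplus> V) R M" for n by (rule submodule_add[OF spw sV])
  obtain N1 where N1: "\<And>n m x. n \<ge> N1 \<Longrightarrow> x \<in> carrier M \<Longrightarrow>
     (\<And>p. p \<in> set_prods R S m \<Longrightarrow> p \<bullet> x \<in> pw (n + m) \<uplus> T) \<Longrightarrow> x \<in> pw n \<uplus> T"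
    using colon_set_prods_stable[OF noeth S(1) Sc sT a(1) T(3)[OF ac a(2)]] unfolding pw_def by blast
  obtain N2 where N2: "\<And>k x t. k \<ge> N2 \<Longrightarrow> x \<in> pw k \<uplus> V \<Longrightarrow>
      t \<in> carrier R \<Longrightarrow> t \<noteq> \<zero> \<Longrightarrow> t \<bullet> x \<in> V \<Longrightarrow> \<exists>s\<in>carrier R - P. s \<bullet> x \<in> V"
    using torsion_locally_trivial[OF dim noeth sV S P] unfolding pw_def by blast
  \<comment> \<open>A good index past \<open>N2\<close>, fixed before \<open>n\<close>: the torsion
    error of every later \<open>n\<close> is compared with it.\<close>
  obtain k0 where k0: "k0 \<ge> N2" "\<And>x. x \<in> K k0 \<Longrightarrow> \<exists>s\<in>carrier R - P. s \<bullet> x \<in> pw k0 \<uplus> V"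
    using inf[of N2] unfolding pw_def by blast
  have Kmono: "m \<le> n \<Longrightarrow> K n \<subseteq> K m" for m n
    by (induction rule: dec_induct) (use Kdec in auto)
  show ?thesis
  proof (rule that[of "max N1 k0", folded pw_def])
    fix n x assume n: "n \<ge> max N1 k0" and x: "x \<in> K n"
    have xc: "x \<in> carrier M" using x submoduleD(1)[OF sK] by auto
    obtain k where k: "k \<ge> n" "\<And>x. x \<in> K k \<Longrightarrow> \<exists>s\<in>carrier R - P. s \<bullet> x \<in> pw k \<uplus> V"
      using inf[of n] unfolding pw_def by blast
    define m where "m = k - n"
    have km: "k = n + m" using k by (simp add: m_def)
    \<comment> \<open>The good index \<open>k\<close> provides a separate denominator for each
      \<open>p x\<close>; multiplying them gives a common one for the finitely many products
      \<open>p\<close>.\<close>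
    have "\<exists>s\<in>carrier R - P. \<forall>p\<in>Q. s \<bullet> (p \<bullet> x) \<in> pw k \<uplus> V"
      if "finite Q" "Q \<subseteq> set_prods R S m" for Q
      using that
    proof (induction Q rule: finite_induct)
      case empty
      then show ?case using primeideal_one_notin[OF P] by auto
    next
      case (insert p Q)
      then obtain s where s: "s \<in> carrier R - P" "\<forall>p\<in>Q. s \<bullet> (p \<bullet> x) \<in> pw k \<uplus> V" by auto
      have "p \<bullet> x \<in> K k" unfolding km
        by (rule set_prods_smult_mem[OF Sc _ x _ Kmul]) (use insert.prems submoduleD(1)[OF sK] in auto)
      then obtain t where t: "t \<in> carrier R - P" "t \<bullet> (p \<bullet> x) \<in> pw k \<uplus> V" using k(2) by blast
      have "(s \<otimes> t) \<bullet> (q \<bullet> x) \<in> pw k \<uplus> V" if q: "q \<in> insert p Q" for q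
      proof -
        have qc: "q \<in> carrier R" using q insert.prems set_prods_carrier[OF Sc] by blast
        have c: "s \<in> carrier R" "t \<in> carrier R" "q \<bullet> x \<in> carrier M" using s t qc xc by auto
        have 1: "(s \<otimes> t) \<bullet> (q \<bullet> x) = s \<bullet> (t \<bullet> (q \<bullet> x))"
          by (rule smult_assoc1[OF c])
        have 2: "s \<bullet> (t \<bullet> (q \<bullet> x)) = t \<bullet> (s \<bullet> (q \<bullet> x))"
          by (rule smult_commute[OF c])
        show ?thesis
        proof (cases "q = p")
          case True
          then show ?thesis using 1 submoduleD(6)[OF spV c(1) t(2)] by simp
        next
          case False
          then have "s \<bullet> (q \<bullet> x) \<in> pw k \<uplus> V" using s(2) q by auto
          then show ?thesis using 1 2 submoduleD(6)[OF spV c(2)] by simp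
        qed
      qed
      then show ?case using primeideal_mult_notin[OF P s(1) t(1)] by blast
    qed
    from this[OF finite_set_prods[OF S(1)] order.refl]
    obtain s where s: "s \<in> carrier R - P" "\<And>p. p \<in> set_prods R S m \<Longrightarrow> s \<bullet> (p \<bullet> x) \<in> pw k \<uplus> V" by blast
    have sc: "s \<in> carrier R" using s by auto
    \<comment> \<open>Enlarging \<open>V\<close> to \<open>T\<close> makes the colon lemma
      applicable. The price is the torsion summand \<open>t\<close>, treated next.\<close>
    have "s \<bullet> x \<in> pw n \<uplus> T"
    proof (rule N1)
      show "N1 \<le> n" "s \<bullet> x \<in> carrier M" using n sc xc by auto
      fix p assume p: "p \<in> set_prods R S m"
      have pc: "p \<in> carrier R" using p set_prods_carrier[OF Sc] by blast
      have "s \<bullet> (p \<bullet> x) \<in> pw (n + m) \<uplus> T"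
        using s(2)[OF p] T(2) unfolding km set_add_iff by blast
      then show "p \<bullet> (s \<bullet> x) \<in> pw (n + m) \<uplus> T" using smult_commute[OF sc pc xc] by simp
    qed
    then obtain y t where yt: "y \<in> pw n" "t \<in> T" "s \<bullet> x = y \<boxplus> t" by (auto simp: set_add_iff)
    have c: "y \<in> carrier M" "t \<in> carrier M" using yt submoduleD(1)[OF spw] submoduleD(1)[OF sT] by auto
    \<comment> \<open>The error \<open>t\<close> is the difference of \<open>s x\<close> and
      \<open>y\<close>, both in \<open>K n\<close>, so it lies in the larger \<open>K k0\<close>.
      Since \<open>k0\<close> is good, some multiple of \<open>t\<close> is in
      \<open>pw k0 \<uplus> V\<close>; that multiple is torsion too, so \<open>N2\<close> puts a
      further multiple into \<open>V\<close>.\<close>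
    have yV: "y \<in> pw n \<uplus> V" by (rule set_add_upper1[OF spw sV yt(1)])
    then have "y \<in> K n" using Kpow[of n] by (auto simp: pw_def)
    then have "s \<bullet> x \<ominus>\<^bsub>M\<^esub> y \<in> K n" by (rule submoduleD(5)[OF sK submoduleD(6)[OF sK sc x]])
    then have "t \<in> K n" using yt(3) diff_add_self(3)[OF c(2,1)] by simp
    then have "t \<in> K k0" using Kmono[of k0 n] n by auto
    then obtain s' where s': "s' \<in> carrier R - P" "s' \<bullet> t \<in> pw k0 \<uplus> V" using k0(2) by blast
    have s'c: "s' \<in> carrier R" using s' by auto
    have "s' \<bullet> t \<in> T" by (rule submoduleD(6)[OF sT s'c yt(2)])
    then obtain u where u: "u \<in> carrier R" "u \<noteq> \<zero>" "u \<bullet> (s' \<bullet> t) \<in> V" by (auto simp: T_def)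
    obtain s'' where s'': "s'' \<in> carrier R - P" "s'' \<bullet> (s' \<bullet> t) \<in> V" using N2[OF k0(1) s'(2) u] by blast
    have s''c: "s'' \<in> carrier R" using s'' by auto
    define r where "r = s'' \<otimes> s'"
    have r: "r \<in> carrier R - P" unfolding r_def by (rule primeideal_mult_notin[OF P s''(1) s'(1)])
    then have rc: "r \<in> carrier R" by auto
    have "r \<bullet> t \<in> V" using s''(2) smult_assoc1[OF s''c s'c c(2)] by (simp add: r_def)
    then have "r \<bullet> t \<in> pw n \<uplus> V" by (rule set_add_upper2[OF spw sV])
    moreover have "r \<bullet> y \<in> pw n \<uplus> V" by (rule submoduleD(6)[OF spV rc yV])
    moreover have "(r \<otimes> s) \<bullet> x = r \<bullet> y \<boxplus> r \<bullet> t"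
      using smult_assoc1[OF rc sc xc] yt(3) smult_r_distr[OF rc c] by simp
    ultimately have "(r \<otimes> s) \<bullet> x \<in> pw n \<uplus> V" using submoduleD(3)[OF spV] by simp
    then show "\<exists>s\<in>carrier R - P. s \<bullet> x \<in> pw n \<uplus> V"
      using primeideal_mult_notin[OF P r s(1)] by blast
  qed
qed

text \<open>Nonzero primes are maximal, so \<open>P\<close> is associated to \<open>K\<^sub>n/(V + I\<^sup>n M)\<close> iff that module is nonzero at \<open>P\<close>.\<close>
lemma colon_primes_eventually_constant:
  assumes dim: "one_dim_noetherian_domain R" and noeth: "noetherian_module R M" and sV: "submodule V R M"
    and S: "finite S" "S \<subseteq> carrier R" and a: "a \<in> S" "a \<noteq> \<zero>"
    and sK: "\<And>n. submodule (K n) R M" and Kdec: "\<And>n. K (Suc n) \<subseteq> K n"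
    and Kmul: "\<And>n b x. b \<in> S \<Longrightarrow> x \<in> K n \<Longrightarrow> b \<bullet> x \<in> K (Suc n)"
    and Kpow: "\<And>n. adic S n \<uplus> V \<subseteq> K n"
  defines "A \<equiv> \<lambda>n. {P. primeideal P R \<and> (\<exists>x\<in>K n. P = {r \<in> carrier R. r \<bullet> x \<in> adic S n \<uplus> V})}"
  shows "\<exists>N. \<forall>n\<ge>N. A n = A N"
proof -
  interpret one_dim_noetherian_domain R by fact
  define pV where "pV n = adic S n \<uplus> V" for n
  have spw: "submodule (adic S n) R M" for n
    by (rule submodule_set_pow[OF carrier_is_submodule S(2)])
  have spV: "submodule (pV n) R M" for n unfolding pV_def by (rule submodule_add[OF spw sV])
  have A: "A n = {P. primeideal P R \<and> (\<exists>x\<in>K n. P = {r \<in> carrier R. r \<bullet> x \<in> pV n})}" for n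
    unfolding A_def pV_def ..
  have powpV: "(b [^] n) \<bullet> x \<in> pV n" if b: "b \<in> S" and x: "x \<in> carrier M" for b n x
  proof -
    have bc: "b \<in> carrier R" using b S by auto
    have "(b [^] n) \<bullet> x \<in> adic S n"
    proof (induction n)
      case (Suc n)
      have "b [^] Suc n = b \<otimes> b [^] n" using bc by (simp add: m_comm)
      then have "(b [^] Suc n) \<bullet> x = b \<bullet> ((b [^] n) \<bullet> x)"
        using smult_assoc1[OF bc _ x, of "b [^] n"] bc by simp
      then show ?case using set_smult_incl[OF b Suc] by simp
    qed (use x in simp)
    then show ?thesis unfolding pV_def by (rule set_add_upper1[OF spw sV])
  qed
  have idc: "ideal {r \<in> carrier R. r \<bullet> x \<in> pV n} R" if x: "x \<in> carrier M" for x n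
    by (rule ideal_by_closure)
       (use x submoduleD[OF spV] in \<open>auto simp: smult_l_distr smult_assoc1\<close>)
  \<comment> \<open>This says that \<open>K n\<close> and \<open>pV n\<close> agree after
    localization at \<open>P\<close>.\<close>
  define pure where "pure P n \<longleftrightarrow> (\<forall>x\<in>K n. \<exists>s\<in>carrier R - P. s \<bullet> x \<in> pV n)" for P n
  define J where "J = Idl S"
  have J: "ideal J R" "S \<subseteq> J" unfolding J_def using genideal_ideal[OF S(2)] genideal_self[OF S(2)] by auto
  then have "J \<noteq> {\<zero>}" using a by auto
  \<comment> \<open>A finite set containing all primes that can ever occur, so that eventual
    constancy may be proved for one prime at a time.\<close>
  define PP where "PP = {P. primeideal P R \<and> J \<subseteq> P}"
  have finPP: "finite PP" unfolding PP_def by (rule finite_primes_above[OF J(1) \<open>J \<noteq> {\<zero>}\<close>])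
  have APP: "A n \<subseteq> PP" for n
  proof
    fix P assume "P \<in> A n"
    then obtain x where P: "primeideal P R" and x: "x \<in> K n" "P = {r \<in> carrier R. r \<bullet> x \<in> pV n}"
      unfolding A by blast
    have xc: "x \<in> carrier M" using x submoduleD(1)[OF sK] by blast
    have "b \<in> P" if b: "b \<in> S" for b
    proof -
      have bc: "b \<in> carrier R" using b S by auto
      have "b [^] n \<in> P" unfolding x(2) using powpV[OF b xc] bc by simp
      then show ?thesis by (rule primeideal_pow_mem[OF P bc])
    qed
    then have "J \<subseteq> P" unfolding J_def by (intro genideal_minimal[OF primeideal.axioms(1)[OF P]]) auto
    then show "P \<in> PP" using P by (simp add: PP_def)
  qed
  have Apure: "P \<in> A n \<longleftrightarrow> \<not> pure P n" if P: "P \<in> PP" for P n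
  proof
    have pP: "primeideal P R" using P by (simp add: PP_def)
    show "\<not> pure P n" if "P \<in> A n"
    proof -
      obtain x where x: "x \<in> K n" "P = {r \<in> carrier R. r \<bullet> x \<in> pV n}"
        using \<open>P \<in> A n\<close> unfolding A by blast
      then have "s \<in> P" if "s \<in> carrier R" "s \<bullet> x \<in> pV n" for s using that by blast
      then show ?thesis using x(1) unfolding pure_def by blast
    qed
    show "P \<in> A n" if np: "\<not> pure P n"
    proof -
      obtain x where x: "x \<in> K n" "\<And>s. s \<in> carrier R - P \<Longrightarrow> s \<bullet> x \<notin> pV n"
        using np unfolding pure_def by blast
      have xc: "x \<in> carrier M" using x submoduleD(1)[OF sK] by blast
      \<comment> \<open>The annihilator \<open>H\<close> of the class of \<open>x\<close> contains
        \<open>a^n\<close>, hence is nonzero. Therefore \<open>P\<close> is a colon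
        \<open>(H : r)\<close>, and this colon is the annihilator of the class of
        \<open>r x\<close>.\<close>
      define H where "H = {r \<in> carrier R. r \<bullet> x \<in> pV n}"
      have HP: "H \<subseteq> P" using x(2) by (auto simp: H_def)
      have idH: "ideal H R" unfolding H_def by (rule idc[OF xc])
      have ac: "a \<in> carrier R" using a S by auto
      have "a [^] n \<in> H" using powpV[OF a(1) xc] ac by (simp add: H_def)
      moreover have "a [^] n \<noteq> \<zero>"
        using primeideal_pow_mem[OF zeroprimeideal ac, of n] a(2) by blast
      ultimately have "H \<noteq> {\<zero>}" by auto
      obtain r where r: "r \<in> carrier R" "{s \<in> carrier R. s \<otimes> r \<in> H} = P"
        by (rule prime_is_colon[OF idH \<open>H \<noteq> {\<zero>}\<close> pP HP])
      have "{s \<in> carrier R. s \<otimes> r \<in> H} = {s \<in> carrier R. s \<bullet> (r \<bullet> x) \<in> pV n}"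
        using r(1) xc by (auto simp: H_def smult_assoc1)
      then have "P = {s \<in> carrier R. s \<bullet> (r \<bullet> x) \<in> pV n}" using r(2) by simp
      then show ?thesis using submoduleD(6)[OF sK r(1) x(1)] pP unfolding A by blast
    qed
  qed
  have "\<exists>N. \<forall>n\<ge>N. \<forall>n'\<ge>N. P \<in> A n \<longleftrightarrow> P \<in> A n'" if P: "P \<in> PP" for P
  \<comment> \<open>Either equality at \<open>P\<close> recurs, and then it holds from some index
    on, or it fails from some index on. Both make membership of \<open>P\<close> eventually
    constant.\<close>
  proof (cases "\<forall>n. \<exists>k\<ge>n. pure P k")
    case True
    have pP: "primeideal P R" and SP: "S \<subseteq> P" using P J by (auto simp: PP_def)
    have inf: "\<exists>k\<ge>n. \<forall>x\<in>K k. \<exists>s\<in>carrier R - P. s \<bullet> x \<in> adic S k \<uplus> V" for n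
      using True unfolding pure_def pV_def by blast
    obtain N where N: "\<And>n x. n \<ge> N \<Longrightarrow> x \<in> K n \<Longrightarrow> \<exists>s\<in>carrier R - P. s \<bullet> x \<in> pV n"
      using locally_equal_eventually[OF dim noeth sV S(1) SP a pP sK Kdec Kmul Kpow inf] unfolding pV_def by blast
    then have "pure P n" if "n \<ge> N" for n using that unfolding pure_def by blast
    then show ?thesis using Apure[OF P] by blast
  next
    case False
    then show ?thesis using Apure[OF P] by blast
  qed
  then obtain f where f: "\<And>P n n'. P \<in> PP \<Longrightarrow> n \<ge> f P \<Longrightarrow> n' \<ge> f P \<Longrightarrow> P \<in> A n \<longleftrightarrow> P \<in> A n'" by metis
  \<comment> \<open>The inserted \<open>0\<close> keeps the maximum meaningful when no prime
    contains \<open>S\<close>, as for the unit ideal.\<close>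
  define N where "N = Max (insert 0 (f ` PP))"
  have fN: "f P \<le> N" if "P \<in> PP" for P unfolding N_def using that finPP by auto
  show ?thesis
  proof (intro exI[of _ N] allI impI)
    fix n assume n: "n \<ge> N"
    have "P \<in> A n \<longleftrightarrow> P \<in> A N" if "P \<in> PP" for P
      using f[OF that, of n N] fN[OF that] n by auto
    then show "A n = A N" using APP by blast
  qed
qed

end

section \<open>Homomorphisms and quotient modules\<close>

lemma mod_homI:
  assumes "\<And>x. x \<in> carrier M \<Longrightarrow> f x \<in> carrier N"
    and "\<And>x y. x \<in> carrier M \<Longrightarrow> y \<in> carrier M \<Longrightarrow> f (x \<oplus>\<^bsub>M\<^esub> y) = f x \<oplus>\<^bsub>N\<^esub> f y"
    and "\<And>r x. r \<in> carrier R \<Longrightarrow> x \<in> carrier M \<Longrightarrow> f (r \<odot>\<^bsub>M\<^esub> x) = r \<odot>\<^bsub>N\<^esub> f x"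
  shows "f \<in> mod_hom R M N"
  using assms by (auto simp: mod_hom_def)

lemma mod_homD:
  assumes "f \<in> mod_hom R M N"
  shows "x \<in> carrier M \<Longrightarrow> f x \<in> carrier N"
    and "x \<in> carrier M \<Longrightarrow> y \<in> carrier M \<Longrightarrow> f (x \<oplus>\<^bsub>M\<^esub> y) = f x \<oplus>\<^bsub>N\<^esub> f y"
    and "r \<in> carrier R \<Longrightarrow> x \<in> carrier M \<Longrightarrow> f (r \<odot>\<^bsub>M\<^esub> x) = r \<odot>\<^bsub>N\<^esub> f x"
  using assms by (auto simp: mod_hom_def)

lemma mod_hom_compose:
  assumes "f \<in> mod_hom R M N" "g \<in> mod_hom R N L"
  shows "(\<lambda>x. g (f x)) \<in> mod_hom R M L"
  by (rule mod_homI) (simp_all add: mod_homD[OF assms(1)] mod_homD[OF assms(2)])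

text \<open>Linearity for the scalar \<open>\<zero>\<close> gives this directly; negatives are then
  treated with the scalar \<open>-1\<close>.\<close>

lemma mod_hom_zero:
  assumes "module R M" "module R N" "f \<in> mod_hom R M N"
  shows "f \<zero>\<^bsub>M\<^esub> = \<zero>\<^bsub>N\<^esub>"
proof -
  interpret M: module R M by fact
  interpret N: module R N by fact
  have "f (\<zero>\<^bsub>R\<^esub> \<odot>\<^bsub>M\<^esub> \<zero>\<^bsub>M\<^esub>) = \<zero>\<^bsub>R\<^esub> \<odot>\<^bsub>N\<^esub> f \<zero>\<^bsub>M\<^esub>"
    by (rule mod_homD(3)[OF assms(3)]) auto
  then show ?thesis using mod_homD(1)[OF assms(3), of "\<zero>\<^bsub>M\<^esub>"] by simp
qed

lemma mod_hom_minus: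
  assumes "module R M" "module R N" "f \<in> mod_hom R M N" "x \<in> carrier M"
  shows "f (\<ominus>\<^bsub>M\<^esub> x) = \<ominus>\<^bsub>N\<^esub> f x"
proof -
  interpret M: module R M by fact
  interpret N: module R N by fact
  have "f (\<ominus>\<^bsub>R\<^esub> \<one>\<^bsub>R\<^esub> \<odot>\<^bsub>M\<^esub> x) = \<ominus>\<^bsub>R\<^esub> \<one>\<^bsub>R\<^esub> \<odot>\<^bsub>N\<^esub> f x"
    by (rule mod_homD(3)[OF assms(3)]) (use assms(4) in auto)
  then show ?thesis using mod_homD(1)[OF assms(3,4)] assms(4) by (simp add: M.smult_l_minus N.smult_l_minus)
qed

lemma mod_hom_diff:
  assumes "module R M" "module R N" "f \<in> mod_hom R M N" "x \<in> carrier M" "y \<in> carrier M"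
  shows "f (x \<ominus>\<^bsub>M\<^esub> y) = f x \<ominus>\<^bsub>N\<^esub> f y"
proof -
  interpret M: module R M by fact
  show ?thesis using assms(4,5)
    by (simp add: a_minus_def mod_homD(2)[OF assms(3)] mod_hom_minus[OF assms(1-3)])
qed

lemma submodule_preimage:
  assumes "module R M" "module R N" "f \<in> mod_hom R M N" "submodule D R N"
  shows "submodule {x \<in> carrier M. f x \<in> D} R M"
proof -
  interpret M: module R M by fact
  interpret N: module R N by fact
  note D = N.submoduleD[OF assms(4)]
  show ?thesis
    by (rule M.submoduleI)
       (auto simp: mod_hom_zero[OF assms(1-3)] mod_hom_minus[OF assms(1-3)] mod_homD[OF assms(3)] D(2-6))
qed

lemma submodule_image:
  assumes "module R M" "module R N" "f \<in> mod_hom R M N"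
  shows "submodule (f ` carrier M) R N"
proof -
  interpret M: module R M by fact
  interpret N: module R N by fact
  show ?thesis
  proof (rule N.submoduleI)
    show "f ` carrier M \<subseteq> carrier N" using mod_homD(1)[OF assms(3)] by auto
    show "\<zero>\<^bsub>N\<^esub> \<in> f ` carrier M" using mod_hom_zero[OF assms] by (metis M.M.zero_closed image_eqI)
    show "\<ominus>\<^bsub>N\<^esub> a \<in> f ` carrier M" if "a \<in> f ` carrier M" for a
      using that by (auto simp flip: mod_hom_minus[OF assms])
    show "a \<oplus>\<^bsub>N\<^esub> b \<in> f ` carrier M" if "a \<in> f ` carrier M" "b \<in> f ` carrier M" for a b
      using that by (auto simp flip: mod_homD(2)[OF assms(3)])
    show "r \<odot>\<^bsub>N\<^esub> a \<in> f ` carrier M" if "r \<in> carrier R" "a \<in> f ` carrier M" for r a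
      using that by (auto simp flip: mod_homD(3)[OF assms(3)])
  qed
qed

text \<open>Phrased as an induction principle: a linear condition on \<open>M\<close> has to be
  checked on \<open>G\<close> only. In this form it passes to quotients and is applied to pure
  tensors.\<close>

definition spans :: "('r,'c) ring_scheme \<Rightarrow> ('r,'a,'d) module_scheme \<Rightarrow> 'a set \<Rightarrow> bool"
  where "spans R M G \<longleftrightarrow> G \<subseteq> carrier M \<and> (\<forall>D. submodule D R M \<longrightarrow> G \<subseteq> D \<longrightarrow> carrier M \<subseteq> D)"

lemma mod_hom_eq_on_span:
  assumes "module R M" "module R N" "f \<in> mod_hom R M N" "g \<in> mod_hom R M N" "spans R M G"
    and "\<And>x. x \<in> G \<Longrightarrow> f x = g x" and "x \<in> carrier M"
  shows "f x = g x"
proof -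
  interpret M: module R M by fact
  interpret N: module R N by fact
  have "submodule {x \<in> carrier M. f x = g x} R M"
    by (rule M.submoduleI)
       (auto simp: mod_hom_zero[OF assms(1-3)] mod_hom_zero[OF assms(1,2,4)] mod_hom_minus[OF assms(1-3)]
          mod_hom_minus[OF assms(1,2,4)] mod_homD(2,3)[OF assms(3)] mod_homD(2,3)[OF assms(4)])
  moreover have "G \<subseteq> {x \<in> carrier M. f x = g x}" using assms(5,6) by (auto simp: spans_def)
  ultimately show ?thesis using assms(5,7) unfolding spans_def by blast
qed

lemma mod_hom_span_surj:
  assumes "module R M" "module R N" "f \<in> mod_hom R M N" "spans R N G" "G \<subseteq> f ` carrier M"
  shows "f ` carrier M = carrier N"
  using submodule_image[OF assms(1-3)] assms(4,5) mod_homD(1)[OF assms(3)] unfolding spans_def by blast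

lemma (in module) spans_imp_fin_gen:
  assumes "spans R M G" "finite G" shows "fin_gen_module R M"
  unfolding fin_gen_module_def
proof (intro exI[of _ G] conjI)
  have G: "G \<subseteq> carrier M" using assms by (simp add: spans_def)
  then show "G \<subseteq> carrier M" .
  show "gen_submodule R M G = carrier M"
    using assms(1) submodule_gen[OF G] gen_submodule_incl[of _ G] submoduleD(1)[OF submodule_gen[OF G]]
    unfolding spans_def by blast
qed (rule assms(2))

lemma (in module) fin_gen_spans:
  assumes "fin_gen_module R M" obtains G where "finite G" "spans R M G"
  using assms gen_submodule_least unfolding fin_gen_module_def spans_def by (metis order.refl)

section \<open>Cosets, quotient modules and induced maps\<close>

context module
begin

context
  fixes N assumes N: "submodule N R M"
begin

interpretation N: abelian_subgroup N M
  by (rule abelian_subgroupI3[OF additive_subgroupI[OF submodule.axioms(1)[OF N]] M.abelian_group_axioms])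

lemma coset_mem_iff:
  assumes "x \<in> carrier M" "y \<in> carrier M"
  shows "y \<in> N +>\<^bsub>M\<^esub> x \<longleftrightarrow> y \<ominus>\<^bsub>M\<^esub> x \<in> N"
  using N.a_rcos_module[OF assms] by (simp add: a_minus_def)

lemma coset_self: "x \<in> carrier M \<Longrightarrow> x \<in> N +>\<^bsub>M\<^esub> x"
  by (rule N.a_rcos_self)

lemma coset_subset: "x \<in> carrier M \<Longrightarrow> y \<in> N +>\<^bsub>M\<^esub> x \<Longrightarrow> y \<in> carrier M"
  by (rule N.a_elemrcos_carrier)

lemma coset_eq_iff:
  assumes "x \<in> carrier M" "y \<in> carrier M"
  shows "N +>\<^bsub>M\<^esub> x = N +>\<^bsub>M\<^esub> y \<longleftrightarrow> x \<ominus>\<^bsub>M\<^esub> y \<in> N"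
proof
  show "x \<ominus>\<^bsub>M\<^esub> y \<in> N" if "N +>\<^bsub>M\<^esub> x = N +>\<^bsub>M\<^esub> y"
    using coset_self[OF assms(1)] that coset_mem_iff[OF assms(2,1)] by simp
  show "N +>\<^bsub>M\<^esub> x = N +>\<^bsub>M\<^esub> y" if "x \<ominus>\<^bsub>M\<^esub> y \<in> N"
    using N.a_repr_independence'[of x y] coset_mem_iff[OF assms(2,1)] that assms by simp
qed

lemma coset_eq_self_iff:
  assumes "x \<in> carrier M"
  shows "N +>\<^bsub>M\<^esub> x = N \<longleftrightarrow> x \<in> N"
proof
  show "x \<in> N" if "N +>\<^bsub>M\<^esub> x = N" using coset_self[OF assms] that by simp
qed (rule N.a_rcos_const)

lemma coset_zero: "N +>\<^bsub>M\<^esub> \<zero>\<^bsub>M\<^esub> = N"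
  by (simp add: coset_eq_self_iff submoduleD(2)[OF N])

lemma quot_module_carrier: "carrier (quot_module R M N) = (\<lambda>x. N +>\<^bsub>M\<^esub> x) ` carrier M"
  by (auto simp: quot_module_def A_RCOSETS_def' )

lemma quot_module_zero: "\<zero>\<^bsub>quot_module R M N\<^esub> = N"
  by (simp add: quot_module_def)

lemma quot_module_add:
  "x \<in> carrier M \<Longrightarrow> y \<in> carrier M \<Longrightarrow> (N +>\<^bsub>M\<^esub> x) \<oplus>\<^bsub>quot_module R M N\<^esub> (N +>\<^bsub>M\<^esub> y) = N +>\<^bsub>M\<^esub> (x \<boxplus> y)"
  by (simp add: quot_module_def N.a_rcos_sum)

text \<open>The defining union over all representatives of a coset collapses, because the cosets
  that are united all coincide.\<close>

lemma quot_module_smult: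
  assumes "r \<in> carrier R" "x \<in> carrier M"
  shows "r \<odot>\<^bsub>quot_module R M N\<^esub> (N +>\<^bsub>M\<^esub> x) = N +>\<^bsub>M\<^esub> (r \<bullet> x)"
proof -
  have "N +>\<^bsub>M\<^esub> (r \<bullet> y) = N +>\<^bsub>M\<^esub> (r \<bullet> x)" if y: "y \<in> N +>\<^bsub>M\<^esub> x" for y
  proof -
    have yc: "y \<in> carrier M" using coset_subset[OF assms(2) y] .
    have "r \<bullet> (y \<ominus>\<^bsub>M\<^esub> x) \<in> N"
      using y coset_mem_iff[OF assms(2) yc] submoduleD(6)[OF N assms(1)] by simp
    then show ?thesis using assms yc by (simp add: coset_eq_iff smult_minus_distr)
  qed
  then have "(\<Union>m\<in>N +>\<^bsub>M\<^esub> x. N +>\<^bsub>M\<^esub> (r \<bullet> m)) = N +>\<^bsub>M\<^esub> (r \<bullet> x)"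
    using coset_self[OF assms(2)] by blast
  then show ?thesis by (simp add: quot_module_def)
qed

lemma quot_module_is_module: "module R (quot_module R M N)"
proof (rule moduleI)
  show "cring R" by (rule R.is_cring)
  note q = quot_module_add quot_module_smult
  show "abelian_group (quot_module R M N)"
  proof (rule abelian_groupI)
    fix x assume "x \<in> carrier (quot_module R M N)"
    then obtain a where a: "a \<in> carrier M" "x = N +>\<^bsub>M\<^esub> a" by (auto simp: quot_module_carrier)
    show "\<zero>\<^bsub>quot_module R M N\<^esub> \<oplus>\<^bsub>quot_module R M N\<^esub> x = x"
      using quot_module_add[of "\<zero>\<^bsub>M\<^esub>" a] a by (simp add: quot_module_zero coset_zero)
    have "(N +>\<^bsub>M\<^esub> \<ominus>\<^bsub>M\<^esub> a) \<oplus>\<^bsub>quot_module R M N\<^esub> x = \<zero>\<^bsub>quot_module R M N\<^esub>"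
      using a by (simp add: q quot_module_zero M.l_neg coset_zero)
    then show "\<exists>y\<in>carrier (quot_module R M N). y \<oplus>\<^bsub>quot_module R M N\<^esub> x = \<zero>\<^bsub>quot_module R M N\<^esub>"
      using a by (auto simp: quot_module_carrier)
  next
    show "\<zero>\<^bsub>quot_module R M N\<^esub> \<in> carrier (quot_module R M N)"
      unfolding quot_module_carrier quot_module_zero
      by (rule image_eqI[of _ _ "\<zero>\<^bsub>M\<^esub>"]) (simp_all add: coset_zero)
  qed (auto simp: quot_module_carrier q M.a_ac)
qed (auto simp: quot_module_carrier quot_module_add quot_module_smult smult_l_distr smult_r_distr smult_assoc1)

lemma quot_proj_hom: "(\<lambda>x. N +>\<^bsub>M\<^esub> x) \<in> mod_hom R M (quot_module R M N)"
  by (rule mod_homI) (auto simp: quot_module_carrier quot_module_add quot_module_smult)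

text \<open>The induced map is an explicit term, a choice of representative followed by
  \<open>f\<close>, so that a family of induced maps can be written down, as for
  \<open>\<psi>\<close> in \<open>tensor_quotient\<close>.\<close>

lemma quot_lift:
  assumes L: "module R L" and f: "f \<in> mod_hom R M L" and fN: "\<And>x. x \<in> N \<Longrightarrow> f x = \<zero>\<^bsub>L\<^esub>"
  defines "h \<equiv> \<lambda>c. f (SOME x. x \<in> c)"
  shows "x \<in> carrier M \<Longrightarrow> h (N +>\<^bsub>M\<^esub> x) = f x"
    and "h \<in> mod_hom R (quot_module R M N) L"
proof -
  interpret L: module R L by fact
  have mM: "module R M" by (rule module_axioms)
  have h: "h (N +>\<^bsub>M\<^esub> x) = f x" if x: "x \<in> carrier M" for x
  proof -
    define y where "y = (SOME y. y \<in> N +>\<^bsub>M\<^esub> x)"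
    have y: "y \<in> N +>\<^bsub>M\<^esub> x" unfolding y_def by (rule someI[of _ x]) (rule coset_self[OF x])
    have yc: "y \<in> carrier M" by (rule coset_subset[OF x y])
    have "y \<ominus>\<^bsub>M\<^esub> x \<in> N" using y coset_mem_iff[OF x yc] by simp
    then have "f (y \<ominus>\<^bsub>M\<^esub> x) = \<zero>\<^bsub>L\<^esub>" by (rule fN)
    moreover have "f y = f (y \<ominus>\<^bsub>M\<^esub> x) \<oplus>\<^bsub>L\<^esub> f x"
      using mod_homD(2)[OF f, of "y \<ominus>\<^bsub>M\<^esub> x" x] diff_add_self(2)[OF yc x] yc x by simp
    ultimately show ?thesis using mod_homD(1)[OF f x] by (simp add: h_def y_def)
  qed
  then show "x \<in> carrier M \<Longrightarrow> h (N +>\<^bsub>M\<^esub> x) = f x" .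
  show "h \<in> mod_hom R (quot_module R M N) L"
    by (rule mod_homI)
       (auto simp: quot_module_carrier quot_module_add quot_module_smult h mod_homD[OF f])
qed

lemma spans_quot_module:
  assumes "spans R M G"
  shows "spans R (quot_module R M N) ((\<lambda>x. N +>\<^bsub>M\<^esub> x) ` G)"
  unfolding spans_def
proof (intro conjI allI impI)
  show "(\<lambda>x. N +>\<^bsub>M\<^esub> x) ` G \<subseteq> carrier (quot_module R M N)"
    using assms by (auto simp: spans_def quot_module_carrier)
  fix D assume D: "submodule D R (quot_module R M N)" "(\<lambda>x. N +>\<^bsub>M\<^esub> x) ` G \<subseteq> D"
  have "submodule {x \<in> carrier M. N +>\<^bsub>M\<^esub> x \<in> D} R M"
    by (rule submodule_preimage[OF module_axioms quot_module_is_module quot_proj_hom D(1)])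
  moreover have "G \<subseteq> {x \<in> carrier M. N +>\<^bsub>M\<^esub> x \<in> D}" using D(2) assms by (auto simp: spans_def)
  ultimately have "carrier M \<subseteq> {x \<in> carrier M. N +>\<^bsub>M\<^esub> x \<in> D}" using assms by (simp add: spans_def)
  then show "carrier (quot_module R M N) \<subseteq> D" by (auto simp: quot_module_carrier)
qed

end

end

section \<open>Free modules\<close>

lemma free_module_simps:
  "f \<in> carrier (free_module R S) \<longleftrightarrow> (\<forall>p. f p \<in> carrier R) \<and> (\<forall>p. p \<notin> S \<longrightarrow> f p = \<zero>\<^bsub>R\<^esub>) \<and> finite {p. f p \<noteq> \<zero>\<^bsub>R\<^esub>}"
  "\<zero>\<^bsub>free_module R S\<^esub> = (\<lambda>_. \<zero>\<^bsub>R\<^esub>)"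
  "f \<oplus>\<^bsub>free_module R S\<^esub> g = (\<lambda>p. f p \<oplus>\<^bsub>R\<^esub> g p)"
  "r \<odot>\<^bsub>free_module R S\<^esub> f = (\<lambda>p. r \<otimes>\<^bsub>R\<^esub> f p)"
  by (auto simp: free_module_def)

definition lin_ext :: "('r,'c) ring_scheme \<Rightarrow> ('r,'a,'d) module_scheme \<Rightarrow> ('p \<Rightarrow> 'a) \<Rightarrow> ('p \<Rightarrow> 'r) \<Rightarrow> 'a"
  where "lin_ext R M \<phi> g = (\<Oplus>\<^bsub>M\<^esub>p\<in>{p. g p \<noteq> \<zero>\<^bsub>R\<^esub>}. g p \<odot>\<^bsub>M\<^esub> \<phi> p)"

context cring
begin

lemma free_module_is_module:
  fixes S :: "'p set"
  shows "module R (free_module R S)"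
proof (rule moduleI)
  let ?F = "free_module R S"
  show "cring R" by (rule is_cring)
  have fin: "finite {p. f p \<oplus> g p \<noteq> \<zero>}" if "finite {p. f p \<noteq> \<zero>}" "finite {p. g p \<noteq> \<zero>}" for f g :: "'p \<Rightarrow> 'a"
    by (rule finite_subset[OF _ finite_UnI[OF that]]) auto
  show "abelian_group ?F"
  proof (rule abelian_groupI)
    fix f assume f: "f \<in> carrier ?F"
    have "{p. \<ominus> f p \<noteq> \<zero>} \<subseteq> {p. f p \<noteq> \<zero>}" by auto
    then have "(\<lambda>p. \<ominus> f p) \<in> carrier ?F"
      using f finite_subset by (auto simp: free_module_simps)
    moreover have "(\<lambda>p. \<ominus> f p) \<oplus>\<^bsub>?F\<^esub> f = \<zero>\<^bsub>?F\<^esub>"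
      using f by (auto simp: free_module_simps l_neg)
    ultimately show "\<exists>g\<in>carrier ?F. g \<oplus>\<^bsub>?F\<^esub> f = \<zero>\<^bsub>?F\<^esub>" by blast
  qed (auto simp: free_module_simps a_ac fin)
  show "r \<odot>\<^bsub>?F\<^esub> f \<in> carrier ?F"
    if "r \<in> carrier R" "f \<in> carrier ?F" for r f
  proof -
    have "{p. r \<otimes> f p \<noteq> \<zero>} \<subseteq> {p. f p \<noteq> \<zero>}" using that by auto
    then show ?thesis using that finite_subset by (auto simp: free_module_simps)
  qed
qed (auto simp: free_module_simps l_distr r_distr m_assoc)

text \<open>Subtraction in the free module rests on a definite description of the inverse, while
  \<open>tensor_rels\<close> subtracts pointwise. They agree because \<open>(f - g) + g = f\<close>
  can be solved at each point.\<close>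

lemma free_module_diff:
  assumes "f \<in> carrier (free_module R S)" "g \<in> carrier (free_module R S)"
  shows "f \<ominus>\<^bsub>free_module R S\<^esub> g = (\<lambda>p. f p \<ominus> g p)"
proof -
  let ?F = "free_module R S"
  interpret F: module R ?F by (rule free_module_is_module)
  have "f \<ominus>\<^bsub>?F\<^esub> g \<in> carrier ?F" using assms by simp
  moreover have "(f \<ominus>\<^bsub>?F\<^esub> g) \<oplus>\<^bsub>?F\<^esub> g = f" by (rule F.diff_add_self(2)[OF assms])
  ultimately have "(f \<ominus>\<^bsub>?F\<^esub> g) p \<in> carrier R" "(f \<ominus>\<^bsub>?F\<^esub> g) p \<oplus> g p = f p" "g p \<in> carrier R" for p
    using assms by (auto simp: free_module_simps fun_eq_iff)
  then show ?thesis
    by (metis (no_types, opaque_lifting) a_minus_def add.inv_closed a_assoc r_neg r_zero ext)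
qed

lemma basis_vec_closed: "p \<in> S \<Longrightarrow> basis_vec R p \<in> carrier (free_module R S)"
  by (auto simp: basis_vec_def free_module_simps)

lemma spans_free_module: "spans R (free_module R S) (basis_vec R ` S)"
  unfolding spans_def
proof (intro conjI allI impI)
  let ?F = "free_module R S"
  interpret F: module R ?F by (rule free_module_is_module)
  show "basis_vec R ` S \<subseteq> carrier ?F" using basis_vec_closed by auto
  fix D assume D: "submodule D R ?F" "basis_vec R ` S \<subseteq> D"
  have "g \<in> D" if "finite A" "g \<in> carrier ?F" "{p. g p \<noteq> \<zero>} \<subseteq> A" for A g
    using that
  proof (induction A arbitrary: g rule: finite_induct)
    case empty
    then have "g = \<zero>\<^bsub>?F\<^esub>" by (auto simp: free_module_simps)
    then show ?case using F.submoduleD(2)[OF D(1)] by simp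
  next
    case (insert a A)
    show ?case
    proof (cases "g a = \<zero>")
      case True
      then show ?thesis using insert by blast
    next
      case False
      have gc: "g p \<in> carrier R" for p using insert.prems by (simp add: free_module_simps)
      have aS: "a \<in> S" using False insert.prems by (auto simp: free_module_simps)
      define g' where "g' = g(a := \<zero>)"
      have "{p. g' p \<noteq> \<zero>} \<subseteq> {p. g p \<noteq> \<zero>}" by (auto simp: g'_def)
      then have "finite {p. g' p \<noteq> \<zero>}"
        using insert.prems(1) by (auto simp: free_module_simps intro: finite_subset)
      moreover have "g' p \<in> carrier R" "p \<notin> S \<Longrightarrow> g' p = \<zero>" for p
        using insert.prems(1) by (auto simp: free_module_simps g'_def)
      ultimately have "g' \<in> carrier ?F" by (simp add: free_module_simps)
      moreover have "{p. g' p \<noteq> \<zero>} \<subseteq> A" using insert.prems by (auto simp: g'_def)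
      ultimately have "g' \<in> D" by (rule insert.IH)
      moreover have "g a \<odot>\<^bsub>?F\<^esub> basis_vec R a \<in> D"
        using F.submoduleD(6)[OF D(1) gc] D(2) aS by blast
      moreover have "g = g' \<oplus>\<^bsub>?F\<^esub> (g a \<odot>\<^bsub>?F\<^esub> basis_vec R a)"
        using gc by (auto simp: free_module_simps g'_def basis_vec_def)
      ultimately show ?thesis using F.submoduleD(3)[OF D(1)] by metis
    qed
  qed
  then show "carrier ?F \<subseteq> D" by (auto simp: free_module_simps)
qed

end

context module
begin

text \<open>Frees the sum from the support of \<open>g\<close>: to compare the extensions of
  \<open>f\<close>, \<open>g\<close> and their sum, all three are written over one finite
  set.\<close>

lemma lin_ext_eq:
  assumes "g \<in> carrier (free_module R S)" "\<And>p. p \<in> S \<Longrightarrow> \<phi> p \<in> carrier M"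
    and "finite A" "{p. g p \<noteq> \<zero>} \<subseteq> A" "A \<subseteq> S"
  shows "lin_ext R M \<phi> g = (\<Oplus>\<^bsub>M\<^esub>p\<in>A. g p \<bullet> \<phi> p)"
  unfolding lin_ext_def
proof (rule M.add.finprod_mono_neutral_cong_left[OF assms(3,4)])
  have gc: "g p \<in> carrier R" for p using assms(1) by (simp add: free_module_simps)
  show "(\<lambda>p. g p \<bullet> \<phi> p) \<in> A \<rightarrow> carrier M" using gc assms(2,5) by auto
  show "g p \<bullet> \<phi> p = \<zero>\<^bsub>M\<^esub>" if "p \<in> A - {p. g p \<noteq> \<zero>}" for p
    using that assms(2,5) by auto
qed auto

lemma lin_ext_hom:
  assumes \<phi>: "\<And>p. p \<in> S \<Longrightarrow> \<phi> p \<in> carrier M"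
  shows "lin_ext R M \<phi> \<in> mod_hom R (free_module R S) M"
proof (rule mod_homI)
  let ?F = "free_module R S"
  interpret F: module R ?F by (rule R.free_module_is_module)
  have supp: "finite {p. g p \<noteq> \<zero>}" "{p. g p \<noteq> \<zero>} \<subseteq> S" "\<And>p. g p \<in> carrier R" if "g \<in> carrier ?F" for g
    using that by (auto simp: free_module_simps)
  show "lin_ext R M \<phi> f \<in> carrier M" if "f \<in> carrier ?F" for f
    unfolding lin_ext_def by (rule M.finsum_closed) (use supp[OF that] \<phi> in auto)
  show "lin_ext R M \<phi> (f \<oplus>\<^bsub>?F\<^esub> g) = lin_ext R M \<phi> f \<boxplus> lin_ext R M \<phi> g"
    if f: "f \<in> carrier ?F" and g: "g \<in> carrier ?F" for f g
  proof -
    define A where "A = {p. f p \<noteq> \<zero>} \<union> {p. g p \<noteq> \<zero>}"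
    have A: "finite A" "A \<subseteq> S" using supp[OF f] supp[OF g] by (auto simp: A_def)
    have fg: "f \<oplus>\<^bsub>?F\<^esub> g \<in> carrier ?F" using f g by simp
    have "lin_ext R M \<phi> (f \<oplus>\<^bsub>?F\<^esub> g) = (\<Oplus>\<^bsub>M\<^esub>p\<in>A. (f p \<oplus> g p) \<bullet> \<phi> p)"
    proof -
      have "{p. f p \<oplus> g p \<noteq> \<zero>} \<subseteq> A" by (auto simp: A_def)
      then show ?thesis using lin_ext_eq[of _ S \<phi>, OF fg _ A(1) _ A(2)] \<phi> by (simp add: free_module_simps)
    qed
    also have "\<dots> = (\<Oplus>\<^bsub>M\<^esub>p\<in>A. f p \<bullet> \<phi> p \<boxplus> g p \<bullet> \<phi> p)"
      by (rule M.finsum_cong') (use A \<phi> supp(3)[OF f] supp(3)[OF g] in \<open>auto simp: smult_l_distr\<close>)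
    also have "\<dots> = (\<Oplus>\<^bsub>M\<^esub>p\<in>A. f p \<bullet> \<phi> p) \<boxplus> (\<Oplus>\<^bsub>M\<^esub>p\<in>A. g p \<bullet> \<phi> p)"
      by (rule M.finsum_addf) (use A \<phi> supp(3)[OF f] supp(3)[OF g] in auto)
    also have "\<dots> = lin_ext R M \<phi> f \<boxplus> lin_ext R M \<phi> g"
      using lin_ext_eq[of _ S \<phi>, OF f _ A(1) _ A(2)] lin_ext_eq[of _ S \<phi>, OF g _ A(1) _ A(2)] \<phi> by (auto simp: A_def)
    finally show ?thesis .
  qed
  show "lin_ext R M \<phi> (r \<odot>\<^bsub>?F\<^esub> f) = r \<bullet> lin_ext R M \<phi> f"
    if r: "r \<in> carrier R" and f: "f \<in> carrier ?F" for r f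
  proof -
    define A where "A = {p. f p \<noteq> \<zero>}"
    have A: "finite A" "A \<subseteq> S" using supp[OF f] by (auto simp: A_def)
    have rf: "r \<odot>\<^bsub>?F\<^esub> f \<in> carrier ?F" using f r by simp
    have "lin_ext R M \<phi> (r \<odot>\<^bsub>?F\<^esub> f) = (\<Oplus>\<^bsub>M\<^esub>p\<in>A. (r \<otimes> f p) \<bullet> \<phi> p)"
    proof -
      have "{p. r \<otimes> f p \<noteq> \<zero>} \<subseteq> A" using r by (auto simp: A_def)
      then show ?thesis using lin_ext_eq[of _ S \<phi>, OF rf _ A(1) _ A(2)] \<phi> by (simp add: free_module_simps)
    qed
    also have "\<dots> = (\<Oplus>\<^bsub>M\<^esub>p\<in>A. r \<bullet> (f p \<bullet> \<phi> p))"
      by (rule M.finsum_cong') (use A \<phi> supp(3)[OF f] r in \<open>auto simp: smult_assoc1\<close>)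
    also have "\<dots> = r \<bullet> (\<Oplus>\<^bsub>M\<^esub>p\<in>A. f p \<bullet> \<phi> p)"
      by (rule finsum_smult_ldistr[symmetric]) (use A \<phi> supp(3)[OF f] r in auto)
    finally show ?thesis by (simp add: lin_ext_def A_def)
  qed
qed

lemma lin_ext_basis:
  assumes "\<phi> p \<in> carrier M" "p \<in> S" "\<And>p. p \<in> S \<Longrightarrow> \<phi> p \<in> carrier M"
  shows "lin_ext R M \<phi> (basis_vec R p) = \<phi> p"
proof -
  have "lin_ext R M \<phi> (basis_vec R p) = (\<Oplus>\<^bsub>M\<^esub>q\<in>{p}. basis_vec R p q \<bullet> \<phi> q)"
    by (rule lin_ext_eq[OF R.basis_vec_closed]) (use assms in \<open>auto simp: basis_vec_def\<close>)
  also have "\<dots> = \<phi> p" using assms by (simp add: basis_vec_def)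
  finally show ?thesis .
qed

end

section \<open>Push-forward of finitely supported functions\<close>

context cring
begin

text \<open>Plays the role of \<open>lin_ext_eq\<close>: the summation set no longer depends on the
  support, so values for different functions can be added.\<close>

lemma push_fwd_eq:
  assumes g: "g \<in> carrier (free_module R S)" and "finite A" "{a. g (a, x) \<noteq> \<zero>} \<subseteq> A"
  shows "push_fwd R f g (b, x) = (\<Oplus>a\<in>{a \<in> A. f a = b}. g (a, x))"
  unfolding push_fwd_def prod.case
  by (rule add.finprod_mono_neutral_cong_left) (use assms in \<open>auto simp: free_module_simps\<close>)

lemma free_module_row_finite:
  assumes "g \<in> carrier (free_module R S)" shows "finite {a. g (a, x) \<noteq> \<zero>}"
proof -
  have "{a. g (a, x) \<noteq> \<zero>} \<subseteq> fst ` {p. g p \<noteq> \<zero>}" by force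
  moreover have "finite (fst ` {p. g p \<noteq> \<zero>})" using assms by (simp add: free_module_simps)
  ultimately show ?thesis by (rule finite_subset)
qed

lemma free_module_coeff: "g \<in> carrier (free_module R S) \<Longrightarrow> g p \<in> carrier R"
  by (simp add: free_module_simps)

lemma push_fwd_hom:
  fixes f :: "'x \<Rightarrow> 'y" and Y :: "'z set"
  assumes f: "\<And>a. a \<in> A \<Longrightarrow> f a \<in> B"
  shows "push_fwd R f \<in> mod_hom R (free_module R (A \<times> Y)) (free_module R (B \<times> Y))"
proof (rule mod_homI)
  let ?F = "free_module R (A \<times> Y)" and ?G = "free_module R (B \<times> Y)"
  interpret F: module R ?F by (rule free_module_is_module)
  note row = free_module_row_finite
  have gc: "g p \<in> carrier R" if "g \<in> carrier ?F" for g p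
    by (rule free_module_coeff[OF that])
  show "push_fwd R f g \<in> carrier ?G" if g: "g \<in> carrier ?F" for g
    unfolding free_module_simps
  proof (intro conjI allI impI)
    show "push_fwd R f g p \<in> carrier R" for p
      unfolding push_fwd_def by (cases p) (use gc[OF g] in \<open>auto intro!: finsum_closed\<close>)
    \<comment> \<open>A nonzero value requires a point of the support of \<open>g\<close> in the
      fibre. This gives finiteness of the support and its position inside
      \<open>B \<times> Y\<close> at once.\<close>
    have sub: "{p. push_fwd R f g p \<noteq> \<zero>} \<subseteq> (\<lambda>(a, x). (f a, x)) ` {p. g p \<noteq> \<zero>}"
    proof
      fix p assume p: "p \<in> {p. push_fwd R f g p \<noteq> \<zero>}"
      obtain b x where bx: "p = (b, x)" by force
      have "{a. g (a, x) \<noteq> \<zero> \<and> f a = b} \<noteq> {}"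
      proof
        assume e: "{a. g (a, x) \<noteq> \<zero> \<and> f a = b} = {}"
        have "push_fwd R f g (b, x) = \<zero>" unfolding push_fwd_def prod.case e by simp
        then show False using p bx by simp
      qed
      then show "p \<in> (\<lambda>(a, x). (f a, x)) ` {p. g p \<noteq> \<zero>}" using bx by force
    qed
    show "finite {p. push_fwd R f g p \<noteq> \<zero>}"
      by (rule finite_subset[OF sub]) (use g in \<open>simp add: free_module_simps\<close>)
    show "push_fwd R f g p = \<zero>" if "p \<notin> B \<times> Y" for p
    proof (rule ccontr)
      assume "push_fwd R f g p \<noteq> \<zero>"
      then obtain a x where ax: "p = (f a, x)" "g (a, x) \<noteq> \<zero>" using sub by auto
      then have "(a, x) \<in> A \<times> Y" using g by (auto simp: free_module_simps)
      then show False using ax f that by auto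
    qed
  qed
  show "push_fwd R f (g \<oplus>\<^bsub>?F\<^esub> h) = push_fwd R f g \<oplus>\<^bsub>?G\<^esub> push_fwd R f h"
    if g: "g \<in> carrier ?F" and h: "h \<in> carrier ?F" for g h
  proof
    fix p :: "'y \<times> 'z" obtain b x where bx: "p = (b, x)" by force
    define A' where "A' = {a. g (a, x) \<noteq> \<zero>} \<union> {a. h (a, x) \<noteq> \<zero>}"
    have A': "finite A'" using row[OF g, of x] row[OF h, of x] by (simp add: A'_def)
    have gh: "g \<oplus>\<^bsub>?F\<^esub> h \<in> carrier ?F" using g h by simp
    have "push_fwd R f (g \<oplus>\<^bsub>?F\<^esub> h) (b, x) = (\<Oplus>a\<in>{a \<in> A'. f a = b}. (g \<oplus>\<^bsub>?F\<^esub> h) (a, x))"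
      by (rule push_fwd_eq[OF gh A']) (auto simp: free_module_simps A'_def)
    also have "\<dots> = (\<Oplus>a\<in>{a \<in> A'. f a = b}. g (a, x) \<oplus> h (a, x))" by (simp add: free_module_simps)
    also have "\<dots> = (\<Oplus>a\<in>{a \<in> A'. f a = b}. g (a, x)) \<oplus> (\<Oplus>a\<in>{a \<in> A'. f a = b}. h (a, x))"
      by (rule finsum_addf) (use gc[OF g] gc[OF h] in auto)
    also have "\<dots> = push_fwd R f g (b, x) \<oplus> push_fwd R f h (b, x)"
      using push_fwd_eq[OF g A', of x f b] push_fwd_eq[OF h A', of x f b] by (simp add: A'_def)
    finally show "push_fwd R f (g \<oplus>\<^bsub>?F\<^esub> h) p = (push_fwd R f g \<oplus>\<^bsub>?G\<^esub> push_fwd R f h) p"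
      unfolding bx by (simp add: free_module_simps)
  qed
  show "push_fwd R f (r \<odot>\<^bsub>?F\<^esub> g) = r \<odot>\<^bsub>?G\<^esub> push_fwd R f g"
    if r: "r \<in> carrier R" and g: "g \<in> carrier ?F" for r g
  proof
    fix p :: "'y \<times> 'z" obtain b x where bx: "p = (b, x)" by force
    define A' where "A' = {a. g (a, x) \<noteq> \<zero>}"
    have A': "finite A'" using row[OF g, of x] by (simp add: A'_def)
    have rg: "r \<odot>\<^bsub>?F\<^esub> g \<in> carrier ?F" using g r by simp
    have "push_fwd R f (r \<odot>\<^bsub>?F\<^esub> g) (b, x) = (\<Oplus>a\<in>{a \<in> A'. f a = b}. (r \<odot>\<^bsub>?F\<^esub> g) (a, x))"
      by (rule push_fwd_eq[OF rg A']) (use r in \<open>auto simp: free_module_simps A'_def\<close>)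
    also have "\<dots> = (\<Oplus>a\<in>{a \<in> A'. f a = b}. r \<otimes> g (a, x))" by (simp add: free_module_simps)
    also have "\<dots> = r \<otimes> (\<Oplus>a\<in>{a \<in> A'. f a = b}. g (a, x))"
      by (rule finsum_rdistr[symmetric]) (use A' gc[OF g] r in auto)
    also have "\<dots> = r \<otimes> push_fwd R f g (b, x)"
      using push_fwd_eq[OF g A', of x f b] by (simp add: A'_def)
    finally show "push_fwd R f (r \<odot>\<^bsub>?F\<^esub> g) p = (r \<odot>\<^bsub>?G\<^esub> push_fwd R f g) p"
      unfolding bx by (simp add: free_module_simps)
  qed
qed

lemma push_fwd_basis:
  fixes f :: "'x \<Rightarrow> 'y" and x :: 'z
  shows "push_fwd R f (basis_vec R (a, x)) = basis_vec R (f a, x)"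
proof
  fix p :: "'y \<times> 'z" obtain b y where bp: "p = (b, y)" by force
  \<comment> \<open>\<open>push_fwd\<close> does not mention an index set, so the free module on
    \<open>UNIV\<close> can be taken and the lemma holds for arbitrary \<open>a\<close> and
    \<open>x\<close>.\<close>
  have bv: "basis_vec R (a, x) \<in> carrier (free_module R UNIV)" by (rule basis_vec_closed) simp
  have "push_fwd R f (basis_vec R (a, x)) (b, y) = (\<Oplus>c\<in>{c \<in> {a}. f c = b}. basis_vec R (a, x) (c, y))"
    by (rule push_fwd_eq[OF bv]) (auto simp: basis_vec_def)
  also have "\<dots> = basis_vec R (f a, x) (b, y)"
  proof (cases "f a = b")
    case True
    then have "{c \<in> {a}. f c = b} = {a}" by auto
    then show ?thesis using True by (simp add: basis_vec_def)
  next
    case False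
    then have e: "{c \<in> {a}. f c = b} = {}" by auto
    show ?thesis unfolding e using False by (auto simp: basis_vec_def)
  qed
  finally show "push_fwd R f (basis_vec R (a, x)) p = basis_vec R (f a, x) p" unfolding bp .
qed

end

section \<open>Tensor products\<close>

definition pure_tensor :: "('r,'c) ring_scheme \<Rightarrow> ('r,'a,'d) module_scheme \<Rightarrow> ('r,'x,'e) module_scheme
    \<Rightarrow> 'a \<Rightarrow> 'x \<Rightarrow> ('a \<times> 'x \<Rightarrow> 'r) set"
  where "pure_tensor R A Y a x =
     tensor_rel_sub R A Y +>\<^bsub>free_module R (carrier A \<times> carrier Y)\<^esub> basis_vec R (a, x)"

locale module_pair = A?: module R A + Y?: module R Y for R (structure) and A and Y
begin

abbreviation "Fr \<equiv> free_module R (carrier A \<times> carrier Y)"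

lemma free_module_pair: "module R Fr"
  by (rule A.R.free_module_is_module)

sublocale Fr: module R Fr by (rule free_module_pair)

lemma basis_pair_closed: "a \<in> carrier A \<Longrightarrow> x \<in> carrier Y \<Longrightarrow> basis_vec R (a, x) \<in> carrier Fr"
  by (rule A.R.basis_vec_closed) simp

text \<open>Expresses the relations by the operations of the free module, so that linear maps can be
  applied to them.\<close>

lemma tensor_rels_eq:
  "tensor_rels R A Y =
     {basis_vec R (a \<oplus>\<^bsub>A\<^esub> a', x) \<ominus>\<^bsub>Fr\<^esub> basis_vec R (a, x) \<ominus>\<^bsub>Fr\<^esub> basis_vec R (a', x)
        | a a' x. a \<in> carrier A \<and> a' \<in> carrier A \<and> x \<in> carrier Y}
   \<union> {basis_vec R (a, x \<oplus>\<^bsub>Y\<^esub> x') \<ominus>\<^bsub>Fr\<^esub> basis_vec R (a, x) \<ominus>\<^bsub>Fr\<^esub> basis_vec R (a, x')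
        | a x x'. a \<in> carrier A \<and> x \<in> carrier Y \<and> x' \<in> carrier Y}
   \<union> {basis_vec R (r \<odot>\<^bsub>A\<^esub> a, x) \<ominus>\<^bsub>Fr\<^esub> r \<odot>\<^bsub>Fr\<^esub> basis_vec R (a, x)
        | r a x. r \<in> carrier R \<and> a \<in> carrier A \<and> x \<in> carrier Y}
   \<union> {basis_vec R (a, r \<odot>\<^bsub>Y\<^esub> x) \<ominus>\<^bsub>Fr\<^esub> r \<odot>\<^bsub>Fr\<^esub> basis_vec R (a, x)
        | r a x. r \<in> carrier R \<and> a \<in> carrier A \<and> x \<in> carrier Y}"
  (is "_ = ?E1 \<union> ?E2 \<union> ?E3 \<union> ?E4")
proof -
  have d: "f \<ominus>\<^bsub>Fr\<^esub> g = (\<lambda>p. f p \<ominus> g p)" if "f \<in> carrier Fr" "g \<in> carrier Fr" for f g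
    by (rule A.R.free_module_diff[OF that])
  note b = basis_pair_closed
  have dd: "f \<ominus>\<^bsub>Fr\<^esub> g \<ominus>\<^bsub>Fr\<^esub> h = (\<lambda>p. f p \<ominus> g p \<ominus> h p)"
    if "f \<in> carrier Fr" "g \<in> carrier Fr" "h \<in> carrier Fr" for f g h
  proof -
    have "f \<ominus>\<^bsub>Fr\<^esub> g \<in> carrier Fr" using that by simp
    from d[OF this that(3)] show ?thesis unfolding d[OF that(1,2)] .
  qed
  have ds: "f \<ominus>\<^bsub>Fr\<^esub> r \<odot>\<^bsub>Fr\<^esub> g = (\<lambda>p. f p \<ominus> r \<otimes> g p)"
    if "f \<in> carrier Fr" "g \<in> carrier Fr" "r \<in> carrier R" for f g r
    using d[of f "r \<odot>\<^bsub>Fr\<^esub> g"] that Fr.smult_closed[of r g] by (simp add: free_module_simps(4))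
  have 1: "?E1 = {(\<lambda>p. basis_vec R (a \<oplus>\<^bsub>A\<^esub> a', x) p \<ominus> basis_vec R (a, x) p \<ominus> basis_vec R (a', x) p)
        | a a' x. a \<in> carrier A \<and> a' \<in> carrier A \<and> x \<in> carrier Y}"
    by (intro Collect_cong ex_cong1) (auto simp: dd b)
  have 2: "?E2 = {(\<lambda>p. basis_vec R (a, x \<oplus>\<^bsub>Y\<^esub> x') p \<ominus> basis_vec R (a, x) p \<ominus> basis_vec R (a, x') p)
        | a x x'. a \<in> carrier A \<and> x \<in> carrier Y \<and> x' \<in> carrier Y}"
    by (intro Collect_cong ex_cong1) (auto simp: dd b)
  have 3: "?E3 = {(\<lambda>p. basis_vec R (r \<odot>\<^bsub>A\<^esub> a, x) p \<ominus> r \<otimes> basis_vec R (a, x) p)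
        | r a x. r \<in> carrier R \<and> a \<in> carrier A \<and> x \<in> carrier Y}"
    by (intro Collect_cong ex_cong1) (auto simp: ds b)
  have 4: "?E4 = {(\<lambda>p. basis_vec R (a, r \<odot>\<^bsub>Y\<^esub> x) p \<ominus> r \<otimes> basis_vec R (a, x) p)
        | r a x. r \<in> carrier R \<and> a \<in> carrier A \<and> x \<in> carrier Y}"
    by (intro Collect_cong ex_cong1) (auto simp: ds b)
  show ?thesis unfolding 1 2 3 4 tensor_rels_def ..
qed

lemma tensor_rels_closed: "tensor_rels R A Y \<subseteq> carrier Fr"
  unfolding tensor_rels_eq
  by (auto intro!: Fr.M.minus_closed Fr.smult_closed basis_pair_closed)

lemma submodule_tensor_rel: "submodule (tensor_rel_sub R A Y) R Fr"
  unfolding tensor_rel_sub_def by (rule Fr.submodule_gen[OF tensor_rels_closed])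

lemma tensor_rel_incl: "g \<in> tensor_rels R A Y \<Longrightarrow> g \<in> tensor_rel_sub R A Y"
  unfolding tensor_rel_sub_def by (rule Fr.gen_submodule_incl)

lemma tensor_is_module: "module R (tensor R A Y)"
  unfolding tensor_def by (rule Fr.quot_module_is_module[OF submodule_tensor_rel])

lemma pure_tensor_closed: "a \<in> carrier A \<Longrightarrow> x \<in> carrier Y \<Longrightarrow> pure_tensor R A Y a x \<in> carrier (tensor R A Y)"
  unfolding tensor_def Fr.quot_module_carrier[OF submodule_tensor_rel] pure_tensor_def
  using basis_pair_closed by blast

lemma spans_tensor: "spans R (tensor R A Y) {pure_tensor R A Y a x | a x. a \<in> carrier A \<and> x \<in> carrier Y}"
proof -
  have "{pure_tensor R A Y a x | a x. a \<in> carrier A \<and> x \<in> carrier Y} =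
      (\<lambda>g. tensor_rel_sub R A Y +>\<^bsub>Fr\<^esub> g) ` (basis_vec R ` (carrier A \<times> carrier Y))"
    by (auto simp: pure_tensor_def)
  then show ?thesis unfolding tensor_def
    using Fr.spans_quot_module[OF submodule_tensor_rel A.R.spans_free_module] by simp
qed

lemma pure_tensor_bilinear:
  shows "a \<in> carrier A \<Longrightarrow> a' \<in> carrier A \<Longrightarrow> x \<in> carrier Y \<Longrightarrow>
      pure_tensor R A Y (a \<oplus>\<^bsub>A\<^esub> a') x = pure_tensor R A Y a x \<oplus>\<^bsub>tensor R A Y\<^esub> pure_tensor R A Y a' x"
    and "a \<in> carrier A \<Longrightarrow> x \<in> carrier Y \<Longrightarrow> x' \<in> carrier Y \<Longrightarrow>
      pure_tensor R A Y a (x \<oplus>\<^bsub>Y\<^esub> x') = pure_tensor R A Y a x \<oplus>\<^bsub>tensor R A Y\<^esub> pure_tensor R A Y a x'"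
    and "r \<in> carrier R \<Longrightarrow> a \<in> carrier A \<Longrightarrow> x \<in> carrier Y \<Longrightarrow>
      pure_tensor R A Y (r \<odot>\<^bsub>A\<^esub> a) x = r \<odot>\<^bsub>tensor R A Y\<^esub> pure_tensor R A Y a x"
    and "r \<in> carrier R \<Longrightarrow> a \<in> carrier A \<Longrightarrow> x \<in> carrier Y \<Longrightarrow>
      pure_tensor R A Y a (r \<odot>\<^bsub>Y\<^esub> x) = r \<odot>\<^bsub>tensor R A Y\<^esub> pure_tensor R A Y a x"
proof -
  note b = basis_pair_closed and T = submodule_tensor_rel
  note qa = Fr.quot_module_add[OF T] and qs = Fr.quot_module_smult[OF T] and ce = Fr.coset_eq_iff[OF T]
  have dd: "f \<ominus>\<^bsub>Fr\<^esub> (g \<oplus>\<^bsub>Fr\<^esub> h) = f \<ominus>\<^bsub>Fr\<^esub> g \<ominus>\<^bsub>Fr\<^esub> h"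
    if "f \<in> carrier Fr" "g \<in> carrier Fr" "h \<in> carrier Fr" for f g h
    using that by (simp add: a_minus_def Fr.M.minus_add Fr.M.a_ac)
  show "pure_tensor R A Y (a \<oplus>\<^bsub>A\<^esub> a') x = pure_tensor R A Y a x \<oplus>\<^bsub>tensor R A Y\<^esub> pure_tensor R A Y a' x"
    if c: "a \<in> carrier A" "a' \<in> carrier A" "x \<in> carrier Y"
  proof -
    have "basis_vec R (a \<oplus>\<^bsub>A\<^esub> a', x) \<ominus>\<^bsub>Fr\<^esub> basis_vec R (a, x) \<ominus>\<^bsub>Fr\<^esub> basis_vec R (a', x) \<in> tensor_rel_sub R A Y"
      by (rule tensor_rel_incl, unfold tensor_rels_eq) (use c in blast)
    then show ?thesis unfolding tensor_def pure_tensor_def using c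
      by (simp add: qa ce b dd)
  qed
  show "pure_tensor R A Y a (x \<oplus>\<^bsub>Y\<^esub> x') = pure_tensor R A Y a x \<oplus>\<^bsub>tensor R A Y\<^esub> pure_tensor R A Y a x'"
    if c: "a \<in> carrier A" "x \<in> carrier Y" "x' \<in> carrier Y"
  proof -
    have "basis_vec R (a, x \<oplus>\<^bsub>Y\<^esub> x') \<ominus>\<^bsub>Fr\<^esub> basis_vec R (a, x) \<ominus>\<^bsub>Fr\<^esub> basis_vec R (a, x') \<in> tensor_rel_sub R A Y"
      by (rule tensor_rel_incl, unfold tensor_rels_eq) (use c in blast)
    then show ?thesis unfolding tensor_def pure_tensor_def using c
      by (simp add: qa ce b dd)
  qed
  show "pure_tensor R A Y (r \<odot>\<^bsub>A\<^esub> a) x = r \<odot>\<^bsub>tensor R A Y\<^esub> pure_tensor R A Y a x"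
    if c: "r \<in> carrier R" "a \<in> carrier A" "x \<in> carrier Y"
  proof -
    have "basis_vec R (r \<odot>\<^bsub>A\<^esub> a, x) \<ominus>\<^bsub>Fr\<^esub> r \<odot>\<^bsub>Fr\<^esub> basis_vec R (a, x) \<in> tensor_rel_sub R A Y"
      by (rule tensor_rel_incl, unfold tensor_rels_eq) (use c in blast)
    then show ?thesis unfolding tensor_def pure_tensor_def using c
      by (simp add: qs ce b)
  qed
  show "pure_tensor R A Y a (r \<odot>\<^bsub>Y\<^esub> x) = r \<odot>\<^bsub>tensor R A Y\<^esub> pure_tensor R A Y a x"
    if c: "r \<in> carrier R" "a \<in> carrier A" "x \<in> carrier Y"
  proof -
    have "basis_vec R (a, r \<odot>\<^bsub>Y\<^esub> x) \<ominus>\<^bsub>Fr\<^esub> r \<odot>\<^bsub>Fr\<^esub> basis_vec R (a, x) \<in> tensor_rel_sub R A Y"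
      by (rule tensor_rel_incl, unfold tensor_rels_eq) (use c in blast)
    then show ?thesis unfolding tensor_def pure_tensor_def using c
      by (simp add: qs ce b)
  qed
qed

lemma pure_tensor_right_hom:
  "a \<in> carrier A \<Longrightarrow> pure_tensor R A Y a \<in> mod_hom R Y (tensor R A Y)"
  by (rule mod_homI) (simp_all add: pure_tensor_closed pure_tensor_bilinear)

lemma pure_tensor_left_hom:
  "x \<in> carrier Y \<Longrightarrow> (\<lambda>a. pure_tensor R A Y a x) \<in> mod_hom R A (tensor R A Y)"
  by (rule mod_homI) (simp_all add: pure_tensor_closed pure_tensor_bilinear)

text \<open>The descent half of the universal property. It starts from a linear map on the free
  module because it is needed both for linear extensions of bilinear maps and for
  \<open>tensor_map\<close>, which comes from \<open>push_fwd\<close>.\<close>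

lemma hom_kills_tensor_rel:
  assumes L: "module R L" and f: "f \<in> mod_hom R Fr L"
    and 1: "\<And>a a' x. a \<in> carrier A \<Longrightarrow> a' \<in> carrier A \<Longrightarrow> x \<in> carrier Y \<Longrightarrow>
      f (basis_vec R (a \<oplus>\<^bsub>A\<^esub> a', x)) = f (basis_vec R (a, x)) \<oplus>\<^bsub>L\<^esub> f (basis_vec R (a', x))"
    and 2: "\<And>a x x'. a \<in> carrier A \<Longrightarrow> x \<in> carrier Y \<Longrightarrow> x' \<in> carrier Y \<Longrightarrow>
      f (basis_vec R (a, x \<oplus>\<^bsub>Y\<^esub> x')) = f (basis_vec R (a, x)) \<oplus>\<^bsub>L\<^esub> f (basis_vec R (a, x'))"
    and 3: "\<And>r a x. r \<in> carrier R \<Longrightarrow> a \<in> carrier A \<Longrightarrow> x \<in> carrier Y \<Longrightarrow>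
      f (basis_vec R (r \<odot>\<^bsub>A\<^esub> a, x)) = r \<odot>\<^bsub>L\<^esub> f (basis_vec R (a, x))"
    and 4: "\<And>r a x. r \<in> carrier R \<Longrightarrow> a \<in> carrier A \<Longrightarrow> x \<in> carrier Y \<Longrightarrow>
      f (basis_vec R (a, r \<odot>\<^bsub>Y\<^esub> x)) = r \<odot>\<^bsub>L\<^esub> f (basis_vec R (a, x))"
    and g: "g \<in> tensor_rel_sub R A Y"
  shows "f g = \<zero>\<^bsub>L\<^esub>"
proof -
  interpret L: module R L by fact
  have "submodule {g \<in> carrier Fr. f g \<in> {\<zero>\<^bsub>L\<^esub>}} R Fr"
    by (rule submodule_preimage[OF free_module_pair L f L.submodule_zero])
  moreover have "tensor_rels R A Y \<subseteq> {g \<in> carrier Fr. f g \<in> {\<zero>\<^bsub>L\<^esub>}}"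
  proof
    note b = basis_pair_closed
    note fc = mod_homD(1)[OF f] and fs = mod_homD(3)[OF f]
    have fd: "f (x \<ominus>\<^bsub>Fr\<^esub> y) = f x \<ominus>\<^bsub>L\<^esub> f y" if "x \<in> carrier Fr" "y \<in> carrier Fr" for x y
      by (rule mod_hom_diff[OF free_module_pair L f that])
    have z0: "x \<ominus>\<^bsub>L\<^esub> x = \<zero>\<^bsub>L\<^esub>" if "x \<in> carrier L" for x
      using that by (simp add: a_minus_def L.M.r_neg)
    have z: "x \<oplus>\<^bsub>L\<^esub> y \<ominus>\<^bsub>L\<^esub> x \<ominus>\<^bsub>L\<^esub> y = \<zero>\<^bsub>L\<^esub>" if "x \<in> carrier L" "y \<in> carrier L" for x y
      using that L.diff_add_self(3)[of y x] z0 by simp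
    fix g assume g: "g \<in> tensor_rels R A Y"
    have "f g = \<zero>\<^bsub>L\<^esub>"
      using g unfolding tensor_rels_eq
      by (elim UnE CollectE exE conjE; hypsubst)
         (simp_all add: b fc fs fd 1 2 3 4 z z0)
    then show "g \<in> {g \<in> carrier Fr. f g \<in> {\<zero>\<^bsub>L\<^esub>}}" using g tensor_rels_closed by auto
  qed
  ultimately have "tensor_rel_sub R A Y \<subseteq> {g \<in> carrier Fr. f g \<in> {\<zero>\<^bsub>L\<^esub>}}"
    unfolding tensor_rel_sub_def by (rule Fr.gen_submodule_least)
  then show ?thesis using g by auto
qed

lemma tensor_universal:
  assumes L: "module R L"
    and c: "\<And>a x. a \<in> carrier A \<Longrightarrow> x \<in> carrier Y \<Longrightarrow> \<phi> a x \<in> carrier L"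
    and 1: "\<And>a a' x. a \<in> carrier A \<Longrightarrow> a' \<in> carrier A \<Longrightarrow> x \<in> carrier Y \<Longrightarrow> \<phi> (a \<oplus>\<^bsub>A\<^esub> a') x = \<phi> a x \<oplus>\<^bsub>L\<^esub> \<phi> a' x"
    and 2: "\<And>a x x'. a \<in> carrier A \<Longrightarrow> x \<in> carrier Y \<Longrightarrow> x' \<in> carrier Y \<Longrightarrow> \<phi> a (x \<oplus>\<^bsub>Y\<^esub> x') = \<phi> a x \<oplus>\<^bsub>L\<^esub> \<phi> a x'"
    and 3: "\<And>r a x. r \<in> carrier R \<Longrightarrow> a \<in> carrier A \<Longrightarrow> x \<in> carrier Y \<Longrightarrow> \<phi> (r \<odot>\<^bsub>A\<^esub> a) x = r \<odot>\<^bsub>L\<^esub> \<phi> a x"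
    and 4: "\<And>r a x. r \<in> carrier R \<Longrightarrow> a \<in> carrier A \<Longrightarrow> x \<in> carrier Y \<Longrightarrow> \<phi> a (r \<odot>\<^bsub>Y\<^esub> x) = r \<odot>\<^bsub>L\<^esub> \<phi> a x"
  obtains h where "h \<in> mod_hom R (tensor R A Y) L"
    "\<And>a x. a \<in> carrier A \<Longrightarrow> x \<in> carrier Y \<Longrightarrow> h (pure_tensor R A Y a x) = \<phi> a x"
proof -
  interpret L: module R L by fact
  define f where "f = lin_ext R L (\<lambda>(a, x). \<phi> a x)"
  have f: "f \<in> mod_hom R Fr L" unfolding f_def by (rule L.lin_ext_hom) (use c in auto)
  have fb: "f (basis_vec R (a, x)) = \<phi> a x" if "a \<in> carrier A" "x \<in> carrier Y" for a x
    unfolding f_def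
    by (subst L.lin_ext_basis[of _ _ "carrier A \<times> carrier Y"]) (use c that in auto)
  have k: "f g = \<zero>\<^bsub>L\<^esub>" if "g \<in> tensor_rel_sub R A Y" for g
    by (rule hom_kills_tensor_rel[OF L f]) (use that in \<open>simp_all add: fb 1 2 3 4\<close>)
  have ql1: "f (SOME y. y \<in> tensor_rel_sub R A Y +>\<^bsub>Fr\<^esub> g) = f g" if "g \<in> carrier Fr" for g
    by (rule Fr.quot_lift(1)[OF submodule_tensor_rel L f k that])
  have ql2: "(\<lambda>c. f (SOME y. y \<in> c)) \<in> mod_hom R (quot_module R Fr (tensor_rel_sub R A Y)) L"
    by (rule Fr.quot_lift(2)[OF submodule_tensor_rel L f k])
  show ?thesis
  proof (rule that)
    show "(\<lambda>c. f (SOME x. x \<in> c)) \<in> mod_hom R (tensor R A Y) L" unfolding tensor_def by (rule ql2)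
    show "f (SOME y. y \<in> pure_tensor R A Y a x) = \<phi> a x" if "a \<in> carrier A" "x \<in> carrier Y" for a x
      unfolding pure_tensor_def using ql1[OF basis_pair_closed[OF that]] fb[OF that] by simp
  qed
qed

end

lemma module_pairI: "module R A \<Longrightarrow> module R Y \<Longrightarrow> module_pair R A Y"
  by (simp add: module_pair_def)

text \<open>\<open>tensor_map\<close> unites the cosets obtained from all representatives. They
  coincide because \<open>push_fwd\<close> followed by the projection kills the tensor relations, so
  the union is a single coset and linearity is inherited.\<close>

lemma tensor_map_hom:
  assumes mA: "module R A" and mB: "module R B" and mY: "module R Y" and f: "f \<in> mod_hom R A B"
  shows "tensor_map R B Y f \<in> mod_hom R (tensor R A Y) (tensor R B Y)"
    and "a \<in> carrier A \<Longrightarrow> x \<in> carrier Y \<Longrightarrow> tensor_map R B Y f (pure_tensor R A Y a x) = pure_tensor R B Y (f a) x"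
proof -
  interpret A: module_pair R A Y by (rule module_pairI[OF mA mY])
  interpret B: module_pair R B Y by (rule module_pairI[OF mB mY])
  note fD = mod_homD[OF f]
  have push: "push_fwd R f \<in> mod_hom R A.Fr B.Fr"
    by (rule A.R.push_fwd_hom) (rule fD(1))
  define h where "h g = tensor_rel_sub R B Y +>\<^bsub>B.Fr\<^esub> push_fwd R f g" for g
  have h: "h \<in> mod_hom R A.Fr (tensor R B Y)"
    unfolding h_def tensor_def
    by (rule mod_hom_compose[OF push B.Fr.quot_proj_hom[OF B.submodule_tensor_rel]])
  have hb: "h (basis_vec R (a, x)) = pure_tensor R B Y (f a) x" for a x
    by (simp add: h_def A.R.push_fwd_basis pure_tensor_def)
  have k: "h g = \<zero>\<^bsub>tensor R B Y\<^esub>" if "g \<in> tensor_rel_sub R A Y" for g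
    by (rule A.hom_kills_tensor_rel[OF B.tensor_is_module h])
       (use that in \<open>simp_all add: hb fD B.pure_tensor_bilinear\<close>)
  have eq: "tensor_map R B Y f (tensor_rel_sub R A Y +>\<^bsub>A.Fr\<^esub> g) = h g" if g: "g \<in> carrier A.Fr" for g
  proof -
    interpret TB: module R "tensor R B Y" by (rule B.tensor_is_module)
    have "h g' = h g" if g': "g' \<in> tensor_rel_sub R A Y +>\<^bsub>A.Fr\<^esub> g" for g'
    proof -
      have gc: "g' \<in> carrier A.Fr" by (rule A.Fr.coset_subset[OF A.submodule_tensor_rel g g'])
      have "h (g' \<ominus>\<^bsub>A.Fr\<^esub> g) = \<zero>\<^bsub>tensor R B Y\<^esub>"
        using k g' A.Fr.coset_mem_iff[OF A.submodule_tensor_rel g gc] by simp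
      then have "h g' \<ominus>\<^bsub>tensor R B Y\<^esub> h g = \<zero>\<^bsub>tensor R B Y\<^esub>"
        using mod_hom_diff[OF A.free_module_pair B.tensor_is_module h gc g] by simp
      then show ?thesis
        using TB.diff_add_self(2)[OF mod_homD(1)[OF h gc] mod_homD(1)[OF h g]] mod_homD(1)[OF h g] by simp
    qed
    then show ?thesis unfolding tensor_map_def
      using A.Fr.coset_self[OF A.submodule_tensor_rel g] unfolding h_def by blast
  qed
  note q = A.Fr.quot_module_carrier[OF A.submodule_tensor_rel]
    A.Fr.quot_module_add[OF A.submodule_tensor_rel] A.Fr.quot_module_smult[OF A.submodule_tensor_rel]
  show "tensor_map R B Y f \<in> mod_hom R (tensor R A Y) (tensor R B Y)"
    unfolding tensor_def[of R A]
    by (rule mod_homI) (auto simp: q eq mod_homD[OF h])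
  show "tensor_map R B Y f (pure_tensor R A Y a x) = pure_tensor R B Y (f a) x"
    if "a \<in> carrier A" "x \<in> carrier Y"
    unfolding pure_tensor_def[of R A] using eq[OF A.basis_pair_closed[OF that]] hb by simp
qed

text \<open>Membership of a pure tensor in \<open>D\<close> is a linear condition in each argument,
  so the spanning principle applies first in \<open>Y\<close>, with a generator of \<open>A\<close>
  fixed, and then in \<open>A\<close>.\<close>

lemma fin_gen_tensor:
  assumes mA: "module R A" and mY: "module R Y" and "fin_gen_module R A" "fin_gen_module R Y"
  shows "fin_gen_module R (tensor R A Y)"
proof -
  interpret P: module_pair R A Y by (rule module_pairI[OF mA mY])
  interpret T: module R "tensor R A Y" by (rule P.tensor_is_module)
  obtain G where G: "finite G" "spans R A G" by (rule P.A.fin_gen_spans[OF assms(3)])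
  obtain H where H: "finite H" "spans R Y H" by (rule P.Y.fin_gen_spans[OF assms(4)])
  define K where "K = (\<lambda>(a, x). pure_tensor R A Y a x) ` (G \<times> H)"
  have Kc: "K \<subseteq> carrier (tensor R A Y)"
    using G(2) H(2) unfolding K_def spans_def by (auto intro!: P.pure_tensor_closed)
  have "spans R (tensor R A Y) K" unfolding spans_def
  proof (intro conjI allI impI)
    fix D assume D: "submodule D R (tensor R A Y)" "K \<subseteq> D"
    have 1: "pure_tensor R A Y a x \<in> D" if a: "a \<in> G" and x: "x \<in> carrier Y" for a x
    proof -
      have ac: "a \<in> carrier A" using a G(2) by (auto simp: spans_def)
      have "submodule {x \<in> carrier Y. pure_tensor R A Y a x \<in> D} R Y"
        by (rule submodule_preimage[OF mY P.tensor_is_module P.pure_tensor_right_hom[OF ac] D(1)])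
      moreover have "H \<subseteq> {x \<in> carrier Y. pure_tensor R A Y a x \<in> D}"
        using D(2) a H(2) by (auto simp: K_def spans_def)
      ultimately show ?thesis using H(2) x unfolding spans_def by blast
    qed
    have 2: "pure_tensor R A Y a x \<in> D" if a: "a \<in> carrier A" and x: "x \<in> carrier Y" for a x
    proof -
      have "submodule {a \<in> carrier A. pure_tensor R A Y a x \<in> D} R A"
        by (rule submodule_preimage[OF mA P.tensor_is_module P.pure_tensor_left_hom[OF x] D(1)])
      moreover have "G \<subseteq> {a \<in> carrier A. pure_tensor R A Y a x \<in> D}"
        using 1[OF _ x] G(2) by (auto simp: spans_def)
      ultimately show ?thesis using G(2) a unfolding spans_def by blast
    qed
    show "carrier (tensor R A Y) \<subseteq> D"
      using P.spans_tensor 2 D(1) unfolding spans_def by blast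
  qed (rule Kc)
  then show ?thesis by (rule T.spans_imp_fin_gen) (use G H in \<open>simp add: K_def\<close>)
qed

section \<open>Powers of an ideal and reduction of tensor products modulo them\<close>

lemma (in cring) ideal_pow_is_ideal: "ideal I R \<Longrightarrow> ideal (ideal_pow R I n) R"
  by (induction n) (auto intro: oneideal ideal_prod_is_ideal)

text \<open>Translates powers of \<open>I\<close> into the iterated action of generators, the form
  used by the filtration lemmas. One passes from \<open>S\<close> to \<open>I\<close> because the
  scalars carrying \<open>N\<close> into \<open>N'\<close> form an ideal.\<close>

lemma (in module) ideal_smult_eq_set_pow:
  assumes S: "S \<subseteq> carrier R" and I: "I = Idl S"
  shows "ideal_smult R (ideal_pow R I n) M = adic S n"
proof (induction n)
  case 0
  have "carrier M \<subseteq> ideal_smult R (carrier R) M"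
  proof
    fix x assume x: "x \<in> carrier M"
    have "\<one> \<bullet> x \<in> ideal_smult R (carrier R) M"
      unfolding ideal_smult_def by (rule gen_submodule_incl) (use x in blast)
    then show "x \<in> ideal_smult R (carrier R) M" using x by simp
  qed
  moreover have "ideal_smult R (carrier R) M \<subseteq> carrier M"
    unfolding ideal_smult_def by (rule gen_submodule_least[OF carrier_is_submodule]) auto
  ultimately show ?case by simp
next
  case (Suc n)
  have idI: "ideal I R" unfolding I by (rule R.genideal_ideal[OF S])
  interpret I: ideal I R by (rule idI)
  have SI: "S \<subseteq> I" unfolding I by (rule R.genideal_self[OF S])
  define J where "J = ideal_pow R I n"
  have idJ: "ideal J R" unfolding J_def by (rule R.ideal_pow_is_ideal[OF idI])
  interpret J: ideal J R by (rule idJ)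
  define N where "N = adic S n"
  have sN: "submodule N R M" unfolding N_def by (rule submodule_set_pow[OF carrier_is_submodule S])
  have Nc: "N \<subseteq> carrier M" using submoduleD(1)[OF sN] by blast
  define N' where "N' = set_smult R M S N"
  have sN': "submodule N' R M" unfolding N'_def by (rule submodule_set_smult[OF S Nc])
  have IH: "ideal_smult R J M = N" using Suc by (simp add: J_def N_def)
  have JN: "j \<bullet> x \<in> N" if "j \<in> J" "x \<in> carrier M" for j x
    unfolding IH[symmetric] ideal_smult_def by (rule gen_submodule_incl) (use that in blast)
  have "ideal {i \<in> carrier R. \<forall>y\<in>N. i \<bullet> y \<in> N'} R"
    by (rule R.ideal_by_closure)
       (use submoduleD[OF sN'] submoduleD(1)[OF sN] in \<open>auto simp: smult_l_distr smult_assoc1\<close>)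
  moreover have "S \<subseteq> {i \<in> carrier R. \<forall>y\<in>N. i \<bullet> y \<in> N'}"
    using S set_smult_incl[of _ S _ N] unfolding N'_def by auto
  ultimately have "I \<subseteq> {i \<in> carrier R. \<forall>y\<in>N. i \<bullet> y \<in> N'}"
    unfolding I by (rule R.genideal_minimal)
  then have IN: "i \<bullet> y \<in> N'" if "i \<in> I" "y \<in> N" for i y using that by auto
  have prod: "r \<in> carrier R \<and> (\<forall>x\<in>carrier M. r \<bullet> x \<in> N')" if "r \<in> ideal_prod R I J" for r
    using that
  proof (induction r rule: ideal_prod.induct)
    case (prod i j)
    have "(i \<otimes> j) \<bullet> x \<in> N'" if x: "x \<in> carrier M" for x
      using IN[OF prod(1) JN[OF prod(2) x]] smult_assoc1[OF I.Icarr[OF prod(1)] J.Icarr[OF prod(2)] x] by simp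
    then show ?case using prod I.Icarr J.Icarr by auto
  next
    case (sum r s)
    then show ?case using submoduleD(3)[OF sN'] by (auto simp: smult_l_distr)
  qed
  have "ideal_smult R (ideal_prod R I J) M \<subseteq> N'"
    unfolding ideal_smult_def by (rule gen_submodule_least[OF sN']) (use prod in auto)
  moreover have "N' \<subseteq> ideal_smult R (ideal_prod R I J) M"
  proof -
    define W where "W = ideal_smult R (ideal_prod R I J) M"
    have sW: "submodule W R M" unfolding W_def ideal_smult_def
      by (rule submodule_gen) (use R.ideal_prod_in_carrier[OF idI idJ] in auto)
    have "set_smult R M S N \<subseteq> W"
    proof (rule set_smult_least[OF sW])
      fix a y assume a: "a \<in> S" and y: "y \<in> N"
      have ac: "a \<in> carrier R" using a S by auto
      have "gen_submodule R M {r \<bullet> m | r m. r \<in> J \<and> m \<in> carrier M} \<subseteq> {y \<in> carrier M. a \<bullet> y \<in> W}"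
      proof (rule gen_submodule_least[OF submodule_colon[OF sW ac]], safe)
        fix r m assume r: "r \<in> J" and m: "m \<in> carrier M"
        have rc: "r \<in> carrier R" using r J.Icarr by auto
        show "r \<bullet> m \<in> carrier M" using rc m by simp
        have "a \<otimes> r \<in> ideal_prod R I J" using a SI r by (auto intro: ideal_prod.prod)
        then have "(a \<otimes> r) \<bullet> m \<in> W" unfolding W_def ideal_smult_def
          by (intro gen_submodule_incl) (use m in blast)
        then show "a \<bullet> (r \<bullet> m) \<in> W" using smult_assoc1[OF ac rc m] by simp
      qed
      then show "a \<bullet> y \<in> W" using y IH unfolding ideal_smult_def by blast
    qed
    then show ?thesis by (simp add: W_def N'_def)
  qed
  ultimately show ?case by (simp add: J_def N_def N'_def)
qed

lemma set_prods_set_pow: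
  assumes "module R M" "S \<subseteq> carrier R" "p \<in> set_prods R S n" "x \<in> carrier M"
  shows "p \<odot>\<^bsub>M\<^esub> x \<in> set_pow_smult R M S n (carrier M)"
proof -
  interpret module R M by fact
  have "p \<odot>\<^bsub>M\<^esub> x \<in> set_pow_smult R M S (0 + n) (carrier M)"
  proof (rule set_prods_smult_mem[OF assms(2,3)])
    show "set_pow_smult R M S n (carrier M) \<subseteq> carrier M" for n
      using submoduleD(1)[OF submodule_set_pow[OF carrier_is_submodule assms(2)]] by blast
  qed (use assms(4) in \<open>auto intro: set_smult_incl\<close>)
  then show ?thesis by simp
qed

lemma (in module_pair) tensor_hom_eq:
  assumes "module R L" "f \<in> mod_hom R (tensor R A Y) L" "g \<in> mod_hom R (tensor R A Y) L"
    and "\<And>a x. a \<in> carrier A \<Longrightarrow> x \<in> carrier Y \<Longrightarrow> f (pure_tensor R A Y a x) = g (pure_tensor R A Y a x)"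
    and "t \<in> carrier (tensor R A Y)"
  shows "f t = g t"
  by (rule mod_hom_eq_on_span[OF tensor_is_module assms(1-3) spans_tensor _ assms(5)]) (use assms(4) in blast)

text \<open>Tensoring \<open>Z\<close> with \<open>M/I^n M\<close> amounts to reducing
  \<open>Z \<otimes> M\<close> modulo \<open>I^n\<close>, for arbitrary \<open>Z\<close>. The kernel
  of \<open>q\<close> is bounded from above by a map \<open>h\<close> back to the quotient of
  \<open>Z \<otimes> M\<close> by \<open>E\<close> whose composite with \<open>q\<close> is the
  projection.\<close>

lemma tensor_quotient:
  fixes n :: nat
  assumes mZ: "module R Z" and mM: "module R M" and S: "S \<subseteq> carrier R"
  defines "N \<equiv> set_pow_smult R M S n (carrier M)"
  defines "Y \<equiv> quot_module R M N"
  obtains q where "q \<in> mod_hom R (tensor R Z M) (tensor R Z Y)"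
    "\<And>z m. z \<in> carrier Z \<Longrightarrow> m \<in> carrier M \<Longrightarrow> q (pure_tensor R Z M z m) = pure_tensor R Z Y z (N +>\<^bsub>M\<^esub> m)"
    "q ` carrier (tensor R Z M) = carrier (tensor R Z Y)"
    "\<And>t. t \<in> carrier (tensor R Z M) \<Longrightarrow>
       q t = \<zero>\<^bsub>tensor R Z Y\<^esub> \<longleftrightarrow> t \<in> set_pow_smult R (tensor R Z M) S n (carrier (tensor R Z M))"
proof -
  let ?T = "tensor R Z M" and ?T' = "tensor R Z Y" and ?p = "pure_tensor R Z M" and ?p' = "pure_tensor R Z Y"
  interpret M: module R M by fact
  have sN: "submodule N R M" unfolding N_def by (rule M.submodule_set_pow[OF M.carrier_is_submodule S])
  have mY: "module R Y" unfolding Y_def by (rule M.quot_module_is_module[OF sN])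
  interpret ZM: module_pair R Z M by (rule module_pairI[OF mZ mM])
  interpret ZY: module_pair R Z Y by (rule module_pairI[OF mZ mY])
  have mT: "module R ?T" by (rule ZM.tensor_is_module)
  have mT': "module R ?T'" by (rule ZY.tensor_is_module)
  interpret T: module R ?T by (rule mT)
  interpret T': module R ?T' by (rule mT')
  have Yc: "carrier Y = (\<lambda>m. N +>\<^bsub>M\<^esub> m) ` carrier M" unfolding Y_def by (rule M.quot_module_carrier[OF sN])
  have proj: "(\<lambda>m. N +>\<^bsub>M\<^esub> m) \<in> mod_hom R M Y" unfolding Y_def by (rule M.quot_proj_hom[OF sN])
  note projD = mod_homD[OF proj]
  obtain q where q: "q \<in> mod_hom R ?T ?T'"
    and qp: "\<And>z m. z \<in> carrier Z \<Longrightarrow> m \<in> carrier M \<Longrightarrow> q (?p z m) = ?p' z (N +>\<^bsub>M\<^esub> m)"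
  proof (rule ZM.tensor_universal[OF mT', of "\<lambda>z m. ?p' z (N +>\<^bsub>M\<^esub> m)"])
  qed (simp_all add: projD ZY.pure_tensor_closed ZY.pure_tensor_bilinear)
  have surj: "q ` carrier ?T = carrier ?T'"
  proof (rule mod_hom_span_surj[OF mT mT' q ZY.spans_tensor], safe)
    fix z y assume z: "z \<in> carrier Z" and "y \<in> carrier Y"
    then obtain m where m: "m \<in> carrier M" "y = N +>\<^bsub>M\<^esub> m" by (auto simp: Yc)
    show "?p' z y \<in> q ` carrier ?T"
      unfolding m(2) qp[OF z m(1), symmetric] by (rule imageI[OF ZM.pure_tensor_closed[OF z m(1)]])
  qed
  define E where "E = set_pow_smult R ?T S n (carrier ?T)"
  have sE: "submodule E R ?T" unfolding E_def by (rule T.submodule_set_pow[OF T.carrier_is_submodule S])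
  have NE: "?p z m \<in> E" if z: "z \<in> carrier Z" and m: "m \<in> N" for z m
  proof -
    have "N \<subseteq> {m \<in> carrier M. ?p z m \<in> E}" unfolding N_def
    proof (rule M.set_pow_least[OF S M.carrier_is_submodule])
      show "submodule {m \<in> carrier M. ?p z m \<in> E} R M"
        by (rule submodule_preimage[OF mM mT ZM.pure_tensor_right_hom[OF z] sE])
      fix p x assume p: "p \<in> set_prods R S n" and x: "x \<in> carrier M"
      have pc: "p \<in> carrier R" using p M.R.set_prods_carrier[OF S] by blast
      have "p \<odot>\<^bsub>?T\<^esub> ?p z x \<in> E"
        unfolding E_def by (rule set_prods_set_pow[OF mT S p ZM.pure_tensor_closed[OF z x]])
      then show "p \<odot>\<^bsub>M\<^esub> x \<in> {m \<in> carrier M. ?p z m \<in> E}"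
        using pc x z by (simp add: ZM.pure_tensor_bilinear)
    qed
    then show ?thesis using m by auto
  qed
  \<comment> \<open>Products of \<open>n\<close> generators annihilate \<open>M/N\<close>, hence all
    of its tensor product with \<open>Z\<close>; so \<open>q\<close> sends \<open>E\<close> to
    zero.\<close>
  have kill: "p \<odot>\<^bsub>?T'\<^esub> t = \<zero>\<^bsub>?T'\<^esub>" if p: "p \<in> set_prods R S n" and t: "t \<in> carrier ?T'" for p t
  proof -
    have pc: "p \<in> carrier R" using p M.R.set_prods_carrier[OF S] by blast
    have "submodule {t \<in> carrier ?T'. p \<odot>\<^bsub>?T'\<^esub> t \<in> {\<zero>\<^bsub>?T'\<^esub>}} R ?T'"
      by (rule T'.submodule_colon[OF T'.submodule_zero pc])
    moreover have "{?p' a x | a x. a \<in> carrier Z \<and> x \<in> carrier Y}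
        \<subseteq> {t \<in> carrier ?T'. p \<odot>\<^bsub>?T'\<^esub> t \<in> {\<zero>\<^bsub>?T'\<^esub>}}"
    proof
      fix t assume "t \<in> {?p' a x | a x. a \<in> carrier Z \<and> x \<in> carrier Y}"
      then obtain z y where t: "t = ?p' z y" and z: "z \<in> carrier Z" and y: "y \<in> carrier Y" by blast
      obtain m where m: "m \<in> carrier M" "y = N +>\<^bsub>M\<^esub> m" using y by (auto simp: Yc)
      have "p \<odot>\<^bsub>M\<^esub> m \<in> N" unfolding N_def by (rule set_prods_set_pow[OF mM S p m(1)])
      then have "N +>\<^bsub>M\<^esub> (p \<odot>\<^bsub>M\<^esub> m) = \<zero>\<^bsub>Y\<^esub>"
        using M.coset_eq_self_iff[OF sN] pc m(1) by (simp add: Y_def M.quot_module_zero[OF sN])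
      then have py: "p \<odot>\<^bsub>Y\<^esub> y = \<zero>\<^bsub>Y\<^esub>" using projD(3)[OF pc m(1)] m(2) by simp
      have "p \<odot>\<^bsub>?T'\<^esub> ?p' z y = ?p' z (p \<odot>\<^bsub>Y\<^esub> y)"
        using ZY.pure_tensor_bilinear(4)[OF pc z y] by simp
      also have "\<dots> = \<zero>\<^bsub>?T'\<^esub>"
        unfolding py by (rule mod_hom_zero[OF mY mT' ZY.pure_tensor_right_hom[OF z]])
      finally show "t \<in> {t \<in> carrier ?T'. p \<odot>\<^bsub>?T'\<^esub> t \<in> {\<zero>\<^bsub>?T'\<^esub>}}"
        using ZY.pure_tensor_closed[OF z y] by (simp add: t)
    qed
    ultimately show ?thesis using ZY.spans_tensor t unfolding spans_def by blast
  qed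
  have EQ: "q t = \<zero>\<^bsub>?T'\<^esub>" if t: "t \<in> E" for t
  proof -
    have "E \<subseteq> {t \<in> carrier ?T. q t \<in> {\<zero>\<^bsub>?T'\<^esub>}}" unfolding E_def
    proof (rule T.set_pow_least[OF S T.carrier_is_submodule])
      show "submodule {t \<in> carrier ?T. q t \<in> {\<zero>\<^bsub>?T'\<^esub>}} R ?T"
        by (rule submodule_preimage[OF mT mT' q T'.submodule_zero])
      fix p x assume p: "p \<in> set_prods R S n" and x: "x \<in> carrier ?T"
      have pc: "p \<in> carrier R" using p M.R.set_prods_carrier[OF S] by blast
      show "p \<odot>\<^bsub>?T\<^esub> x \<in> {t \<in> carrier ?T. q t \<in> {\<zero>\<^bsub>?T'\<^esub>}}"
        using mod_homD(3)[OF q pc x] kill[OF p mod_homD(1)[OF q x]] pc x by simp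
    qed
    then show ?thesis using t by auto
  qed
  let ?Q = "quot_module R ?T E"
  have mQ: "module R ?Q" by (rule T.quot_module_is_module[OF sE])
  have pE: "(\<lambda>t. E +>\<^bsub>?T\<^esub> t) \<in> mod_hom R ?T ?Q" by (rule T.quot_proj_hom[OF sE])
  have hz: "(\<lambda>m. E +>\<^bsub>?T\<^esub> ?p z m) \<in> mod_hom R M ?Q" if z: "z \<in> carrier Z" for z
    by (rule mod_hom_compose[OF ZM.pure_tensor_right_hom[OF z] pE])
  \<comment> \<open>The bilinear map behind \<open>h\<close>: for each \<open>z\<close> the map
    induced on \<open>M/N\<close>, well defined since \<open>NE\<close> puts the pure tensors of
    \<open>z\<close> with \<open>N\<close> into \<open>E\<close>.\<close>
  define \<psi> where "\<psi> z c = E +>\<^bsub>?T\<^esub> ?p z (SOME m. m \<in> c)" for z c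
  have hzN: "E +>\<^bsub>?T\<^esub> ?p z m = \<zero>\<^bsub>?Q\<^esub>" if "z \<in> carrier Z" "m \<in> N" for z m
    using T.coset_eq_self_iff[OF sE] NE[OF that] T.submoduleD(1)[OF sE NE[OF that]]
    by (simp add: T.quot_module_zero[OF sE])
  have \<psi>c: "\<psi> z (N +>\<^bsub>M\<^esub> m) = E +>\<^bsub>?T\<^esub> ?p z m" if z: "z \<in> carrier Z" and m: "m \<in> carrier M" for z m
    unfolding \<psi>_def by (rule M.quot_lift(1)[OF sN mQ hz[OF z] hzN[OF z] m])
  have \<psi>h: "\<psi> z \<in> mod_hom R Y ?Q" if z: "z \<in> carrier Z" for z
    unfolding \<psi>_def Y_def by (rule M.quot_lift(2)[OF sN mQ hz[OF z] hzN[OF z]])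
  obtain h where h: "h \<in> mod_hom R ?T' ?Q"
    and hp: "\<And>z y. z \<in> carrier Z \<Longrightarrow> y \<in> carrier Y \<Longrightarrow> h (?p' z y) = \<psi> z y"
  proof (rule ZY.tensor_universal[OF mQ, of \<psi>])
    show "\<psi> a x \<in> carrier ?Q" if "a \<in> carrier Z" "x \<in> carrier Y" for a x
      using mod_homD(1)[OF \<psi>h] that by auto
    show "\<psi> a (x \<oplus>\<^bsub>Y\<^esub> x') = \<psi> a x \<oplus>\<^bsub>?Q\<^esub> \<psi> a x'" if "a \<in> carrier Z" "x \<in> carrier Y" "x' \<in> carrier Y" for a x x'
      by (rule mod_homD(2)[OF \<psi>h]) (use that in auto)
    show "\<psi> a (r \<odot>\<^bsub>Y\<^esub> x) = r \<odot>\<^bsub>?Q\<^esub> \<psi> a x" if "r \<in> carrier R" "a \<in> carrier Z" "x \<in> carrier Y" for r a x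
      by (rule mod_homD(3)[OF \<psi>h]) (use that in auto)
    show "\<psi> (a \<oplus>\<^bsub>Z\<^esub> a') x = \<psi> a x \<oplus>\<^bsub>?Q\<^esub> \<psi> a' x" if c: "a \<in> carrier Z" "a' \<in> carrier Z" "x \<in> carrier Y" for a a' x
    proof -
      obtain m where m: "m \<in> carrier M" "x = N +>\<^bsub>M\<^esub> m" using c by (auto simp: Yc)
      show ?thesis unfolding m(2) using c m(1)
        by (simp add: \<psi>c ZM.pure_tensor_bilinear(1) mod_homD(2)[OF pE] ZM.pure_tensor_closed)
    qed
    show "\<psi> (r \<odot>\<^bsub>Z\<^esub> a) x = r \<odot>\<^bsub>?Q\<^esub> \<psi> a x" if c: "r \<in> carrier R" "a \<in> carrier Z" "x \<in> carrier Y" for r a x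
    proof -
      obtain m where m: "m \<in> carrier M" "x = N +>\<^bsub>M\<^esub> m" using c by (auto simp: Yc)
      show ?thesis unfolding m(2) using c m(1)
        by (simp add: \<psi>c ZM.pure_tensor_bilinear(3) mod_homD(3)[OF pE] ZM.pure_tensor_closed)
    qed
  qed blast
  have hq: "h (q t) = E +>\<^bsub>?T\<^esub> t" if t: "t \<in> carrier ?T" for t
  proof (rule ZM.tensor_hom_eq[OF mQ mod_hom_compose[OF q h] pE _ t])
    fix z m assume z: "z \<in> carrier Z" and m: "m \<in> carrier M"
    show "h (q (?p z m)) = E +>\<^bsub>?T\<^esub> ?p z m"
      using hp[OF z projD(1)[OF m]] \<psi>c[OF z m] qp[OF z m] by simp
  qed
  show ?thesis
  proof (rule that[OF q qp surj, folded E_def])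
    fix t assume t: "t \<in> carrier ?T"
    show "q t = \<zero>\<^bsub>?T'\<^esub> \<longleftrightarrow> t \<in> E"
    proof
      assume "q t = \<zero>\<^bsub>?T'\<^esub>"
      then have "E +>\<^bsub>?T\<^esub> t = E"
        using hq[OF t] mod_hom_zero[OF mT' mQ h] by (simp add: T.quot_module_zero[OF sE])
      then show "t \<in> E" using T.coset_eq_self_iff[OF sE t] by simp
    qed (rule EQ)
  qed
qed

text \<open>The annihilator of the coset of \<open>x\<close> is the colon \<open>(I : x)\<close>,
  which can be computed in \<open>M\<close>. This removes the quotient and the restricted carrier
  from the description of the associated primes.\<close>

lemma Ass_quot_restricted:
  assumes mM: "module R M" and sK: "submodule K R M" and sI: "submodule I R M" and IK: "I \<subseteq> K"
  shows "Ass R (quot_module R (M\<lparr>carrier := K\<rparr>) I) =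
    {P. primeideal P R \<and> (\<exists>x\<in>K. P = {r \<in> carrier R. r \<odot>\<^bsub>M\<^esub> x \<in> I})}"
proof -
  interpret M: module R M by fact
  let ?K = "M\<lparr>carrier := K\<rparr>"
  have mK: "module R ?K" by (rule submodule.submodule_is_module[OF sK mM])
  interpret K: module R ?K by (rule mK)
  \<comment> \<open>Additive inverses are a definite description over the carrier, so those of the
    restricted structure are identified by the action of the scalar \<open>-1\<close>, which is the
    same in both structures.\<close>
  have sI': "submodule I R ?K"
  proof (rule K.submoduleI)
    show "\<ominus>\<^bsub>?K\<^esub> x \<in> I" if x: "x \<in> I" for x
    proof -
      have "\<ominus>\<^bsub>?K\<^esub> x = (\<ominus>\<^bsub>R\<^esub> \<one>\<^bsub>R\<^esub>) \<odot>\<^bsub>?K\<^esub> x"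
        using K.smult_l_minus[of "\<one>\<^bsub>R\<^esub>" x] K.smult_one[of x] x IK by auto
      then show ?thesis using M.submoduleD(6)[OF sI, of "\<ominus>\<^bsub>R\<^esub> \<one>\<^bsub>R\<^esub>" x] x by simp
    qed
  qed (use IK M.submoduleD[OF sI] in auto)
  have ann: "ann_elem R (quot_module R ?K I) (I +>\<^bsub>?K\<^esub> x) = {r \<in> carrier R. r \<odot>\<^bsub>M\<^esub> x \<in> I}" if x: "x \<in> K" for x
  proof -
    have "r \<odot>\<^bsub>quot_module R ?K I\<^esub> (I +>\<^bsub>?K\<^esub> x) = \<zero>\<^bsub>quot_module R ?K I\<^esub> \<longleftrightarrow> r \<odot>\<^bsub>M\<^esub> x \<in> I"
      if r: "r \<in> carrier R" for r
      using K.quot_module_smult[OF sI' r, of x] K.coset_eq_self_iff[OF sI', of "r \<odot>\<^bsub>?K\<^esub> x"]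
        K.smult_closed[OF r, of x] x by (simp add: K.quot_module_zero[OF sI'])
    then show ?thesis by (auto simp: ann_elem_def)
  qed
  have "carrier (quot_module R ?K I) = (\<lambda>x. I +>\<^bsub>?K\<^esub> x) ` K"
    using K.quot_module_carrier[OF sI'] by simp
  then show ?thesis unfolding Ass_def using ann by auto
qed

section \<open>Associated primes of the functor\<close>

text \<open>Applied to \<open>M/I^n M\<close> it places the image inside the kernel; applied to
  \<open>M\<close> it gives \<open>V \<subseteq> K n\<close>.\<close>

lemma tensor_map_complex:
  assumes mA: "module R A" and mB: "module R B" and mC: "module R C" and mY: "module R Y"
    and \<alpha>: "\<alpha> \<in> mod_hom R A B" and \<beta>: "\<beta> \<in> mod_hom R B C"
    and z: "\<And>a. a \<in> carrier A \<Longrightarrow> \<beta> (\<alpha> a) = \<zero>\<^bsub>C\<^esub>" and t: "t \<in> carrier (tensor R A Y)"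
  shows "tensor_map R C Y \<beta> (tensor_map R B Y \<alpha> t) = \<zero>\<^bsub>tensor R C Y\<^esub>"
proof -
  interpret AY: module_pair R A Y by (rule module_pairI[OF mA mY])
  interpret CY: module_pair R C Y by (rule module_pairI[OF mC mY])
  interpret T: module R "tensor R C Y" by (rule CY.tensor_is_module)
  note \<alpha>Y = tensor_map_hom[OF mA mB mY \<alpha>] and \<beta>Y = tensor_map_hom[OF mB mC mY \<beta>]
  have z0: "(\<lambda>_. \<zero>\<^bsub>tensor R C Y\<^esub>) \<in> mod_hom R (tensor R A Y) (tensor R C Y)" by (rule mod_homI) auto
  show ?thesis
  proof (rule AY.tensor_hom_eq[OF T.module_axioms mod_hom_compose[OF \<alpha>Y(1) \<beta>Y(1)] z0 _ t])
    fix a y assume a: "a \<in> carrier A" and y: "y \<in> carrier Y"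
    have "tensor_map R C Y \<beta> (tensor_map R B Y \<alpha> (pure_tensor R A Y a y)) = pure_tensor R C Y \<zero>\<^bsub>C\<^esub> y"
      using \<alpha>Y(2)[OF a y] \<beta>Y(2)[OF mod_homD(1)[OF \<alpha> a] y] z[OF a] by simp
    also have "\<dots> = \<zero>\<^bsub>tensor R C Y\<^esub>"
      by (rule mod_hom_zero[OF mC T.module_axioms CY.pure_tensor_left_hom[OF y]])
    finally show "tensor_map R C Y \<beta> (tensor_map R B Y \<alpha> (pure_tensor R A Y a y)) = \<zero>\<^bsub>tensor R C Y\<^esub>" .
  qed
qed

text \<open>Everything is pulled back to \<open>U\<close> along the surjection \<open>qB\<close>.
  The kernel becomes the preimage of \<open>I^n W\<close> because \<open>qC\<close> has kernel
  \<open>I^n W\<close>; the image becomes \<open>I^n U + V\<close> because \<open>qA\<close> is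
  surjective and \<open>qB\<close> has kernel \<open>I^n U\<close>. Colons are unchanged by the
  pullback.\<close>

lemma Ass_complex_functor_reduction:
  fixes n :: nat
  assumes mM: "module R M" and mA: "module R A" and mB: "module R B" and mC: "module R C"
    and \<alpha>: "\<alpha> \<in> mod_hom R A B" and \<beta>: "\<beta> \<in> mod_hom R B C"
    and z: "\<And>a. a \<in> carrier A \<Longrightarrow> \<beta> (\<alpha> a) = \<zero>\<^bsub>C\<^esub>" and S: "S \<subseteq> carrier R"
  defines "U \<equiv> tensor R B M" and "W \<equiv> tensor R C M"
  shows "Ass R (complex_functor R A B C \<alpha> \<beta> (quot_module R M (set_pow_smult R M S n (carrier M)))) =
    {P. primeideal P R \<and> (\<exists>x\<in>{t \<in> carrier U. tensor_map R C M \<beta> t \<in> set_pow_smult R W S n (carrier W)}.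
       P = {r \<in> carrier R. r \<odot>\<^bsub>U\<^esub> x \<in> set_pow_smult R U S n (carrier U) <+>\<^bsub>U\<^esub>
                tensor_map R B M \<alpha> ` carrier (tensor R A M)})}"
proof -
  interpret M: module R M by fact
  interpret mC: module R C by fact
  define N where "N = set_pow_smult R M S n (carrier M)"
  define Y where "Y = quot_module R M N"
  have sN: "submodule N R M" unfolding N_def by (rule M.submodule_set_pow[OF M.carrier_is_submodule S])
  have mY: "module R Y" unfolding Y_def by (rule M.quot_module_is_module[OF sN])
  have Nc: "N +>\<^bsub>M\<^esub> m \<in> carrier Y" if "m \<in> carrier M" for m
    using mod_homD(1)[OF M.quot_proj_hom[OF sN] that] by (simp add: Y_def)
  interpret AM: module_pair R A M by (rule module_pairI[OF mA mM])
  interpret BM: module_pair R B M by (rule module_pairI[OF mB mM])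
  interpret AY: module_pair R A Y by (rule module_pairI[OF mA mY])
  interpret BY: module_pair R B Y by (rule module_pairI[OF mB mY])
  interpret CM: module_pair R C M by (rule module_pairI[OF mC mM])
  interpret CY: module_pair R C Y by (rule module_pairI[OF mC mY])
  note tAM = AM.tensor_is_module and tBM = BM.tensor_is_module and tCM = CM.tensor_is_module
    and tAY = AY.tensor_is_module and tBY = BY.tensor_is_module and tCY = CY.tensor_is_module
  interpret U: module R U unfolding U_def by (rule tBM)
  interpret TBY: module R "tensor R B Y" by (rule tBY)
  interpret TCY: module R "tensor R C Y" by (rule tCY)
  note \<alpha>M = tensor_map_hom[OF mA mB mM \<alpha>] and \<alpha>Y = tensor_map_hom[OF mA mB mY \<alpha>]
    and \<beta>M = tensor_map_hom[OF mB mC mM \<beta>] and \<beta>Y = tensor_map_hom[OF mB mC mY \<beta>]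
  obtain qA where qA: "qA \<in> mod_hom R (tensor R A M) (tensor R A Y)"
    "\<And>z m. z \<in> carrier A \<Longrightarrow> m \<in> carrier M \<Longrightarrow> qA (pure_tensor R A M z m) = pure_tensor R A Y z (N +>\<^bsub>M\<^esub> m)"
    "qA ` carrier (tensor R A M) = carrier (tensor R A Y)"
    by (rule tensor_quotient[OF mA mM S, of n, folded N_def, folded Y_def]) blast
  obtain qB where qB: "qB \<in> mod_hom R (tensor R B M) (tensor R B Y)"
    "\<And>z m. z \<in> carrier B \<Longrightarrow> m \<in> carrier M \<Longrightarrow> qB (pure_tensor R B M z m) = pure_tensor R B Y z (N +>\<^bsub>M\<^esub> m)"
    "qB ` carrier (tensor R B M) = carrier (tensor R B Y)"
    "\<And>t. t \<in> carrier (tensor R B M) \<Longrightarrow>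
       qB t = \<zero>\<^bsub>tensor R B Y\<^esub> \<longleftrightarrow> t \<in> set_pow_smult R (tensor R B M) S n (carrier (tensor R B M))"
    by (rule tensor_quotient[OF mB mM S, of n, folded N_def, folded Y_def]) blast
  obtain qC where qC: "qC \<in> mod_hom R (tensor R C M) (tensor R C Y)"
    "\<And>z m. z \<in> carrier C \<Longrightarrow> m \<in> carrier M \<Longrightarrow> qC (pure_tensor R C M z m) = pure_tensor R C Y z (N +>\<^bsub>M\<^esub> m)"
    "\<And>t. t \<in> carrier (tensor R C M) \<Longrightarrow>
       qC t = \<zero>\<^bsub>tensor R C Y\<^esub> \<longleftrightarrow> t \<in> set_pow_smult R (tensor R C M) S n (carrier (tensor R C M))"
    by (rule tensor_quotient[OF mC mM S, of n, folded N_def, folded Y_def]) blast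
  \<comment> \<open>The squares formed by the reductions and the induced maps commute: on pure
    tensors one side reduces the factor from \<open>M\<close>, the other acts on the factor from the
    complex.\<close>
  have natA: "tensor_map R B Y \<alpha> (qA t) = qB (tensor_map R B M \<alpha> t)" if t: "t \<in> carrier (tensor R A M)" for t
  proof (rule AM.tensor_hom_eq[OF tBY mod_hom_compose[OF qA(1) \<alpha>Y(1)] mod_hom_compose[OF \<alpha>M(1) qB(1)] _ t])
    fix a m assume a: "a \<in> carrier A" and m: "m \<in> carrier M"
    show "tensor_map R B Y \<alpha> (qA (pure_tensor R A M a m)) = qB (tensor_map R B M \<alpha> (pure_tensor R A M a m))"
      using qA(2)[OF a m] qB(2)[OF mod_homD(1)[OF \<alpha> a] m] \<alpha>M(2)[OF a m] \<alpha>Y(2)[OF a Nc[OF m]] by simp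
  qed
  have natB: "tensor_map R C Y \<beta> (qB t) = qC (tensor_map R C M \<beta> t)" if t: "t \<in> carrier (tensor R B M)" for t
  proof (rule BM.tensor_hom_eq[OF tCY mod_hom_compose[OF qB(1) \<beta>Y(1)] mod_hom_compose[OF \<beta>M(1) qC(1)] _ t])
    fix a m assume a: "a \<in> carrier B" and m: "m \<in> carrier M"
    show "tensor_map R C Y \<beta> (qB (pure_tensor R B M a m)) = qC (tensor_map R C M \<beta> (pure_tensor R B M a m))"
      using qB(2)[OF a m] qC(2)[OF mod_homD(1)[OF \<beta> a] m] \<beta>M(2)[OF a m] \<beta>Y(2)[OF a Nc[OF m]] by simp
  qed
  define K where "K = {t \<in> carrier (tensor R B Y). tensor_map R C Y \<beta> t = \<zero>\<^bsub>tensor R C Y\<^esub>}"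
  define Im where "Im = tensor_map R B Y \<alpha> ` carrier (tensor R A Y)"
  have sIm: "submodule Im R (tensor R B Y)" unfolding Im_def by (rule submodule_image[OF tAY tBY \<alpha>Y(1)])
  have sK: "submodule K R (tensor R B Y)"
    using submodule_preimage[OF tBY tCY \<beta>Y(1) TCY.submodule_zero] by (simp add: K_def)
  have \<beta>\<alpha>Y: "tensor_map R C Y \<beta> (tensor_map R B Y \<alpha> t) = \<zero>\<^bsub>tensor R C Y\<^esub>" if "t \<in> carrier (tensor R A Y)" for t
    by (rule tensor_map_complex[OF mA mB mC mY \<alpha> \<beta> z that])
  have "Im \<subseteq> K" using \<beta>\<alpha>Y mod_homD(1)[OF \<alpha>Y(1)] by (auto simp: Im_def K_def)
  then have AssK: "Ass R (complex_functor R A B C \<alpha> \<beta> Y) =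
      {P. primeideal P R \<and> (\<exists>x\<in>K. P = {r \<in> carrier R. r \<odot>\<^bsub>tensor R B Y\<^esub> x \<in> Im})}"
    using Ass_quot_restricted[OF tBY sK sIm] unfolding complex_functor_def Let_def K_def Im_def by simp
  define V where "V = tensor_map R B M \<alpha> ` carrier (tensor R A M)"
  have sV: "submodule V R U" unfolding V_def U_def by (rule submodule_image[OF tAM tBM \<alpha>M(1)])
  define pU where "pU = set_pow_smult R U S n (carrier U)"
  have spU: "submodule pU R U" unfolding pU_def by (rule U.submodule_set_pow[OF U.carrier_is_submodule S])
  note qB' = qB[folded U_def, folded pU_def]
  have imq: "qB u \<in> Im \<longleftrightarrow> u \<in> pU <+>\<^bsub>U\<^esub> V" if u: "u \<in> carrier U" for u
  proof
    assume "qB u \<in> Im"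
    then obtain s' where s': "s' \<in> carrier (tensor R A Y)" "qB u = tensor_map R B Y \<alpha> s'" by (auto simp: Im_def)
    then obtain s where s: "s \<in> carrier (tensor R A M)" "s' = qA s" using qA(3) by blast
    define v where "v = tensor_map R B M \<alpha> s"
    have v: "v \<in> V" using s by (simp add: v_def V_def)
    have vc: "v \<in> carrier U" by (rule U.submoduleD(1)[OF sV v])
    have e: "qB u = qB v" using s' s natA by (simp add: v_def)
    have "qB (u \<ominus>\<^bsub>U\<^esub> v) = qB u \<ominus>\<^bsub>tensor R B Y\<^esub> qB v"
      by (rule mod_hom_diff[OF U.module_axioms tBY qB'(1) u vc])
    also have "\<dots> = \<zero>\<^bsub>tensor R B Y\<^esub>"
      unfolding e using mod_homD(1)[OF qB'(1) vc] by (simp add: a_minus_def TBY.M.r_neg)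
    finally have "u \<ominus>\<^bsub>U\<^esub> v \<in> pU" using qB'(4)[of "u \<ominus>\<^bsub>U\<^esub> v"] u vc by simp
    moreover have "u = (u \<ominus>\<^bsub>U\<^esub> v) \<oplus>\<^bsub>U\<^esub> v" using U.diff_add_self(2)[OF u vc] by simp
    ultimately show "u \<in> pU <+>\<^bsub>U\<^esub> V" using v unfolding U.set_add_iff by blast
  next
    assume "u \<in> pU <+>\<^bsub>U\<^esub> V"
    then obtain y v where yv: "y \<in> pU" "v \<in> V" "u = y \<oplus>\<^bsub>U\<^esub> v" by (auto simp: U.set_add_iff)
    obtain s where s: "s \<in> carrier (tensor R A M)" "v = tensor_map R B M \<alpha> s" using yv(2) by (auto simp: V_def)
    have c: "y \<in> carrier U" "v \<in> carrier U" using yv U.submoduleD(1)[OF spU] U.submoduleD(1)[OF sV] by auto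
    have "qB u = qB y \<oplus>\<^bsub>tensor R B Y\<^esub> qB v" unfolding yv(3) by (rule mod_homD(2)[OF qB'(1) c])
    then have "qB u = qB v" using qB'(4)[OF c(1)] yv(1) mod_homD(1)[OF qB'(1) c(2)] by simp
    then have "qB u = tensor_map R B Y \<alpha> (qA s)" using natA[OF s(1)] s(2) by simp
    then show "qB u \<in> Im" using mod_homD(1)[OF qA(1) s(1)] by (simp add: Im_def)
  qed
  have Kq: "qB u \<in> K \<longleftrightarrow> tensor_map R C M \<beta> u \<in> set_pow_smult R W S n (carrier W)" if u: "u \<in> carrier U" for u
    using qC(3)[OF mod_homD(1)[OF \<beta>M(1)], of u] natB[of u] u mod_homD(1)[OF qB(1), of u]
    by (simp add: K_def U_def W_def)
  have col: "{r \<in> carrier R. r \<odot>\<^bsub>tensor R B Y\<^esub> qB u \<in> Im} = {r \<in> carrier R. r \<odot>\<^bsub>U\<^esub> u \<in> pU <+>\<^bsub>U\<^esub> V}"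
    if u: "u \<in> carrier U" for u
  proof (rule Collect_cong, rule conj_cong[OF refl])
    fix r assume r: "r \<in> carrier R"
    show "r \<odot>\<^bsub>tensor R B Y\<^esub> qB u \<in> Im \<longleftrightarrow> r \<odot>\<^bsub>U\<^esub> u \<in> pU <+>\<^bsub>U\<^esub> V"
      using imq[OF U.smult_closed[OF r u]] mod_homD(3)[OF qB'(1) r u] by simp
  qed
  \<comment> \<open>Each element of \<open>K\<close> has a preimage under \<open>qB\<close>, and by
    \<open>col\<close> the preimage has the same colon, so the two conditions on \<open>P\<close>
    coincide.\<close>
  have "(\<exists>x\<in>K. P = {r \<in> carrier R. r \<odot>\<^bsub>tensor R B Y\<^esub> x \<in> Im}) \<longleftrightarrow>
     (\<exists>x\<in>{t \<in> carrier U. tensor_map R C M \<beta> t \<in> set_pow_smult R W S n (carrier W)}.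
        P = {r \<in> carrier R. r \<odot>\<^bsub>U\<^esub> x \<in> pU <+>\<^bsub>U\<^esub> V})" for P
  proof
    assume "\<exists>x\<in>K. P = {r \<in> carrier R. r \<odot>\<^bsub>tensor R B Y\<^esub> x \<in> Im}"
    then obtain x where x: "x \<in> K" "P = {r \<in> carrier R. r \<odot>\<^bsub>tensor R B Y\<^esub> x \<in> Im}" by blast
    have "x \<in> carrier (tensor R B Y)" using x(1) by (simp add: K_def)
    then obtain u where u: "u \<in> carrier U" "x = qB u" using qB'(3) by blast
    show "\<exists>x\<in>{t \<in> carrier U. tensor_map R C M \<beta> t \<in> set_pow_smult R W S n (carrier W)}.
        P = {r \<in> carrier R. r \<odot>\<^bsub>U\<^esub> x \<in> pU <+>\<^bsub>U\<^esub> V}"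
      by (rule bexI[of _ u]) (use x u col[OF u(1)] Kq[OF u(1)] in auto)
  next
    assume "\<exists>x\<in>{t \<in> carrier U. tensor_map R C M \<beta> t \<in> set_pow_smult R W S n (carrier W)}.
        P = {r \<in> carrier R. r \<odot>\<^bsub>U\<^esub> x \<in> pU <+>\<^bsub>U\<^esub> V}"
    then obtain u where u: "u \<in> carrier U" "tensor_map R C M \<beta> u \<in> set_pow_smult R W S n (carrier W)"
      "P = {r \<in> carrier R. r \<odot>\<^bsub>U\<^esub> u \<in> pU <+>\<^bsub>U\<^esub> V}" by blast
    show "\<exists>x\<in>K. P = {r \<in> carrier R. r \<odot>\<^bsub>tensor R B Y\<^esub> x \<in> Im}"
      by (rule bexI[of _ "qB u"]) (use u col[OF u(1)] Kq[OF u(1)] in auto)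
  qed
  then show ?thesis using AssK unfolding Y_def N_def pU_def V_def by simp
qed

theorem theorem5p6:
  fixes R :: "('r,'c) ring_scheme"
    and A :: "('r,'a,'d1) module_scheme" and B :: "('r,'b,'d2) module_scheme"
    and C :: "('r,'g,'d3) module_scheme"
    and M :: "('r,'m,'d4) module_scheme"
    and \<alpha> :: "'a \<Rightarrow> 'b" and \<beta> :: "'b \<Rightarrow> 'g"
    and I :: "'r set"
  assumes "noetherian_domain R"
    and "krull_dim R = 1"
    and "ideal I R"
    and "module R M" and "fin_gen_module R M"
    and "module R A" and "module R B" and "module R C"
    and "\<alpha> \<in> mod_hom R A B" and "\<beta> \<in> mod_hom R B C"
    and "\<forall>a\<in>carrier A. \<beta> (\<alpha> a) = \<zero>\<^bsub>C\<^esub>"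
    and "fin_gen_module R B"
  shows "\<exists>N\<ge>1. \<forall>n\<ge>N.
           Ass R (complex_functor R A B C \<alpha> \<beta> (quot_module R M (ideal_smult R (ideal_pow R I n) M)))
         = Ass R (complex_functor R A B C \<alpha> \<beta> (quot_module R M (ideal_smult R (ideal_pow R I N) M)))"
proof -
  have dim: "one_dim_noetherian_domain R" by (rule one_dim_noetherian_domainI[OF assms(1,2)])
  interpret one_dim_noetherian_domain R by (rule dim)
  interpret I: ideal I R by fact
  show ?thesis
  proof (cases "I = {\<zero>\<^bsub>R\<^esub>}")
    case True
    \<comment> \<open>The zeroth power is the whole ring even for the zero ideal, so the sequence is
      constant only from \<open>n = 1\<close> on.\<close>
    have pow: "ideal_pow R I n = {\<zero>\<^bsub>R\<^esub>}" if n: "n \<ge> 1" for n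
    proof -
      obtain m where m: "n = Suc m" using not0_implies_Suc[of n] n by auto
      have "ideal (ideal_pow R I m) R" by (rule ideal_pow_is_ideal[OF assms(3)])
      then have "ideal_prod R I (ideal_pow R I m) \<subseteq> I" "ideal (ideal_prod R I (ideal_pow R I m)) R"
        using ideal_prod_inter[OF assms(3)] ideal_prod_is_ideal[OF assms(3)] by blast+
      then show ?thesis unfolding m using True additive_subgroup.zero_closed[OF ideal.axioms(1)] by fastforce
    qed
    show ?thesis by (rule exI[of _ 1]) (simp add: pow del: ideal_pow.simps)
  next
    case False
    obtain S where S: "S \<subseteq> carrier R" "finite S" "I = Idl\<^bsub>R\<^esub> S" using finetely_gen[OF assms(3)] by blast
    have "\<not> S \<subseteq> {\<zero>\<^bsub>R\<^esub>}"
    proof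
      assume "S \<subseteq> {\<zero>\<^bsub>R\<^esub>}"
      then have "I \<subseteq> {\<zero>\<^bsub>R\<^esub>}" unfolding S(3) by (rule genideal_minimal[OF zeroideal])
      then show False using False I.zero_closed by blast
    qed
    \<comment> \<open>A nonzero generator supplies both the nonzerodivisor modulo torsion for the
      colon lemma and the nonzero elements \<open>a^n\<close> in the annihilators.\<close>
    then obtain a where a: "a \<in> S" "a \<noteq> \<zero>\<^bsub>R\<^esub>" by blast
    note mM = assms(4) and mA = assms(6) and mB = assms(7) and mC = assms(8) and \<alpha> = assms(9) and \<beta> = assms(10)
    interpret M: module R M by (rule mM)
    interpret AM: module_pair R A M by (rule module_pairI[OF mA mM])
    interpret BM: module_pair R B M by (rule module_pairI[OF mB mM])
    interpret CM: module_pair R C M by (rule module_pairI[OF mC mM])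
    define U where "U = tensor R B M"
    define W where "W = tensor R C M"
    have mU: "module R U" unfolding U_def by (rule BM.tensor_is_module)
    have mW: "module R W" unfolding W_def by (rule CM.tensor_is_module)
    interpret U: module R U by (rule mU)
    interpret W: module R W by (rule mW)
    have noeth: "noetherian_module R U" unfolding U_def
      by (rule module.fin_gen_imp_noetherian[OF BM.tensor_is_module noetherian_ring_axioms fin_gen_tensor[OF mB mM assms(12,5)]])
    note \<alpha>M = tensor_map_hom[OF mA mB mM \<alpha>, folded U_def] and \<beta>M = tensor_map_hom[OF mB mC mM \<beta>, folded U_def W_def]
    define V where "V = tensor_map R B M \<alpha> ` carrier (tensor R A M)"
    have sV: "submodule V R U" unfolding V_def by (rule submodule_image[OF AM.tensor_is_module mU \<alpha>M(1)])
    define pW where "pW n = set_pow_smult R W S n (carrier W)" for n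
    have spW: "submodule (pW n) R W" for n unfolding pW_def by (rule W.submodule_set_pow[OF W.carrier_is_submodule S(1)])
    define K where "K n = {t \<in> carrier U. tensor_map R C M \<beta> t \<in> pW n}" for n
    have sK: "submodule (K n) R U" for n
      unfolding K_def by (rule submodule_preimage[OF mU mW \<beta>M(1) spW])
    have Kdec: "K (Suc n) \<subseteq> K n" for n
      using W.set_pow_antimono[OF W.carrier_is_submodule S(1), of n "Suc n"] unfolding K_def pW_def by auto
    have Kmul: "b \<odot>\<^bsub>U\<^esub> x \<in> K (Suc n)" if b: "b \<in> S" and x: "x \<in> K n" for n b x
    proof -
      have bc: "b \<in> carrier R" and xc: "x \<in> carrier U" and xp: "tensor_map R C M \<beta> x \<in> pW n"
        using b x S by (auto simp: K_def)
      have "b \<odot>\<^bsub>W\<^esub> tensor_map R C M \<beta> x \<in> pW (Suc n)"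
        using W.set_smult_incl[OF b xp] by (simp add: pW_def)
      then show ?thesis using mod_homD(3)[OF \<beta>M(1) bc xc] bc xc by (simp add: K_def)
    qed
    have \<beta>\<alpha>: "tensor_map R C M \<beta> (tensor_map R B M \<alpha> t) = \<zero>\<^bsub>W\<^esub>" if t: "t \<in> carrier (tensor R A M)" for t
      unfolding W_def by (rule tensor_map_complex[OF mA mB mC mM \<alpha> \<beta> _ t]) (use assms(11) in blast)
    have Kpow: "set_pow_smult R U S n (carrier U) <+>\<^bsub>U\<^esub> V \<subseteq> K n" for n
    proof (rule U.set_add_least[OF sK])
      show "V \<subseteq> K n"
        using \<beta>\<alpha> W.submoduleD(2)[OF spW] mod_homD(1)[OF \<alpha>M(1)] by (auto simp: V_def K_def)
      show "set_pow_smult R U S n (carrier U) \<subseteq> K n"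
      proof (rule U.set_pow_least[OF S(1) U.carrier_is_submodule sK])
        fix p x assume p: "p \<in> set_prods R S n" and x: "x \<in> carrier U"
        have pc: "p \<in> carrier R" using p set_prods_carrier[OF S(1)] by blast
        show "p \<odot>\<^bsub>U\<^esub> x \<in> K n"
          using set_prods_set_pow[OF mW S(1) p mod_homD(1)[OF \<beta>M(1) x]] mod_homD(3)[OF \<beta>M(1) pc x] pc x
          by (simp add: K_def pW_def)
      qed
    qed
    define F where "F n = {P. primeideal P R \<and> (\<exists>x\<in>K n. P = {r \<in> carrier R. r \<odot>\<^bsub>U\<^esub> x \<in> set_pow_smult R U S n (carrier U) <+>\<^bsub>U\<^esub> V})}" for n
    have "\<exists>N. \<forall>n\<ge>N. F n = F N"
      unfolding F_def by (rule U.colon_primes_eventually_constant[OF dim noeth sV S(2,1) a sK Kdec Kmul Kpow])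
    then obtain N where N: "\<And>n. n \<ge> N \<Longrightarrow> F n = F N" by blast
    have eq: "Ass R (complex_functor R A B C \<alpha> \<beta> (quot_module R M (ideal_smult R (ideal_pow R I n) M))) = F n" for n
      unfolding M.ideal_smult_eq_set_pow[OF S(1,3)]
      using Ass_complex_functor_reduction[OF mM mA mB mC \<alpha> \<beta> _ S(1), of n] assms(11)
      by (simp add: F_def K_def pW_def U_def W_def V_def)
    show ?thesis unfolding eq
    \<comment> \<open>The bound \<open>N\<close> obtained for \<open>F\<close> may be
      \<open>0\<close>; the maximum meets the demand that the index be at least
      \<open>1\<close>.\<close>
    proof (intro exI[of _ "max N 1"] conjI allI impI)
      fix n assume "n \<ge> max N 1"
      then show "F n = F (max N 1)" using N[of n] N[of "max N 1"] by simp
    qed simp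
  qed
qed

end
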